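(* Let $\Gamma$ be a finite simplicial graph with vertex set $V$, and let $\mathcal G=\mathcal G(\Gamma,\{G_v\}_{v\in V})$ be the graph product of nontrivial groups $G_v$ over $\Gamma$. Let $N<\mathcal G$ be a finitely generated full normal subgroup of $\mathcal G$. Suppose that for each central vertex $v$ of $\Gamma$, every proper quotient of $G_v$ (i.e. every quotient $G_v/M$ with $M\neq 1$ a normal subgroup of $G_v$) is both abelian-by-finite and finite-by-abelian. Then $\mathcal G/N$ is both finite-by-abelian and abelian-by-finite, i.e. there are exact sequences $$1\to A\to \mathcal G/N\to Q\to 1 \qquad\text{and}\qquad 1\to Q'\to \mathcal G/N\to A'\to 1$$ with $A,A'$ abelian and $Q,Q'$ finite.
   Context: Graphs are simplicial (no loops, no multiple edges). The graph product $\mathcal G(\Gamma,\{G_v\})$ is the quotient of the free product $\ast_{v\in V}G_v$ by the relations $[g,h]=1$ for all $g\in G_u$, $h\in G_w$ whenever $u,w$ are adjacent in $\Gamma$. For an induced subgraph $\Delta$, $\mathcal G(\Delta)$ denotes the subgroup generated by the vertex groups of $\Delta$. The join of graphs $\Gamma_1,\Gamma_2$ is their disjoint union with every vertex of $\Gamma_1$ joined to every vertex of $\Gamma_2$. A vertex $v$ is central if it is adjacent to every other vertex of $\Gamma$. Every finite graph $\Gamma$ decomposes as a join of induced subgraphs $\Gamma_1,\dots,\Gamma_k$, each of which is not a join of two nonempty subgraphs; this yields $\mathcal G=\mathcal G(\Gamma_1)\times\cdots\times\mathcal G(\Gamma_k)$. A subgroup $N<\mathcal G$ is full if $N\cap \mathcal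 G(\Gamma_i)\neq 1$ for every $i\in\{1,\dots,k\}$. *)

theory Defs
  imports "HOL-Algebra.Algebra"
begin

definition simplicial_graph :: "'v set \<Rightarrow> ('v \<Rightarrow> 'v \<Rightarrow> bool) \<Rightarrow> bool" where
  "simplicial_graph V E \<longleftrightarrow> finite V \<and> (\<forall>u\<in>V. \<forall>w\<in>V. E u w \<longrightarrow> E w u) \<and> (\<forall>v\<in>V. \<not> E v v)"

definition is_join :: "('v \<Rightarrow> 'v \<Rightarrow> bool) \<Rightarrow> 'v set \<Rightarrow> bool" where
  "is_join E D \<longleftrightarrow> (\<exists>A B. A \<noteq> {} \<and> B \<noteq> {} \<and> A \<inter> B = {} \<and> A \<union> B = D \<and>
                         (\<forall>a\<in>A. \<forall>b\<in>B. E a b))"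

definition join_decomposition :: "'v set \<Rightarrow> ('v \<Rightarrow> 'v \<Rightarrow> bool) \<Rightarrow> 'v set set \<Rightarrow> bool" where
  "join_decomposition V E P \<longleftrightarrow>
     (\<Union>P = V) \<and> (\<forall>D\<in>P. D \<noteq> {}) \<and> (\<forall>D1\<in>P. \<forall>D2\<in>P. D1 \<noteq> D2 \<longrightarrow> D1 \<inter> D2 = {}) \<and>
     (\<forall>D1\<in>P. \<forall>D2\<in>P. D1 \<noteq> D2 \<longrightarrow> (\<forall>a\<in>D1. \<forall>b\<in>D2. E a b)) \<and>
     (\<forall>D\<in>P. \<not> is_join E D)"

definition central_vertex :: "'v set \<Rightarrow> ('v \<Rightarrow> 'v \<Rightarrow> bool) \<Rightarrow> 'v \<Rightarrow> bool" where
  "central_vertex V E v \<longleftrightarrow> v \<in> V \<and> (\<forall>w\<in>V. w \<noteq> v \<longrightarrow> E v w)"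

definition gp_letters :: "'v set \<Rightarrow> ('v \<Rightarrow> 'g monoid) \<Rightarrow> ('v \<times> 'g) set" where
  "gp_letters V G = {(v, g). v \<in> V \<and> g \<in> carrier (G v)}"

inductive gp_basic :: "'v set \<Rightarrow> ('v \<Rightarrow> 'v \<Rightarrow> bool) \<Rightarrow> ('v \<Rightarrow> 'g monoid)
    \<Rightarrow> ('v \<times> 'g) list \<Rightarrow> ('v \<times> 'g) list \<Rightarrow> bool"
  for V E G where
  mult: "v \<in> V \<Longrightarrow> g \<in> carrier (G v) \<Longrightarrow> h \<in> carrier (G v) \<Longrightarrow>
           gp_basic V E G [(v, g), (v, h)] [(v, g \<otimes>\<^bsub>G v\<^esub> h)]"
| one: "v \<in> V \<Longrightarrow> gp_basic V E G [(v, \<one>\<^bsub>G v\<^esub>)] []"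
| comm: "u \<in> V \<Longrightarrow> w \<in> V \<Longrightarrow> E u w \<Longrightarrow> g \<in> carrier (G u) \<Longrightarrow> h \<in> carrier (G w) \<Longrightarrow>
           gp_basic V E G [(u, g), (w, h)] [(w, h), (u, g)]"

inductive gp_eq :: "'v set \<Rightarrow> ('v \<Rightarrow> 'v \<Rightarrow> bool) \<Rightarrow> ('v \<Rightarrow> 'g monoid)
    \<Rightarrow> ('v \<times> 'g) list \<Rightarrow> ('v \<times> 'g) list \<Rightarrow> bool"
  for V E G where
  refl: "w \<in> lists (gp_letters V G) \<Longrightarrow> gp_eq V E G w w"
| sym: "gp_eq V E G a b \<Longrightarrow> gp_eq V E G b a"
| trans: "gp_eq V E G a b \<Longrightarrow> gp_eq V E G b c \<Longrightarrow> gp_eq V E G a c"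
| ctx: "gp_basic V E G l r \<Longrightarrow> xs \<in> lists (gp_letters V G) \<Longrightarrow> ys \<in> lists (gp_letters V G) \<Longrightarrow>
          gp_eq V E G (xs @ l @ ys) (xs @ r @ ys)"

definition gp_mult :: "'v set \<Rightarrow> ('v \<Rightarrow> 'v \<Rightarrow> bool) \<Rightarrow> ('v \<Rightarrow> 'g monoid)
    \<Rightarrow> ('v \<times> 'g) list set \<Rightarrow> ('v \<times> 'g) list set \<Rightarrow> ('v \<times> 'g) list set" where
  "gp_mult V E G S T = {z. \<exists>a\<in>S. \<exists>b\<in>T. gp_eq V E G (a @ b) z}"

definition graph_product :: "'v set \<Rightarrow> ('v \<Rightarrow> 'v \<Rightarrow> bool) \<Rightarrow> ('v \<Rightarrow> 'g monoid)
    \<Rightarrow> ('v \<times> 'g) list set monoid" where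
  "graph_product V E G =
     \<lparr> carrier = lists (gp_letters V G) // {(a, b). gp_eq V E G a b},
       monoid.mult = gp_mult V E G,
       one = {z. gp_eq V E G [] z} \<rparr>"

definition gp_incl :: "'v set \<Rightarrow> ('v \<Rightarrow> 'v \<Rightarrow> bool) \<Rightarrow> ('v \<Rightarrow> 'g monoid) \<Rightarrow> 'v \<Rightarrow> 'g
    \<Rightarrow> ('v \<times> 'g) list set" where
  "gp_incl V E G v g = {z. gp_eq V E G [(v, g)] z}"

definition gp_sub :: "'v set \<Rightarrow> ('v \<Rightarrow> 'v \<Rightarrow> bool) \<Rightarrow> ('v \<Rightarrow> 'g monoid) \<Rightarrow> 'v set
    \<Rightarrow> ('v \<times> 'g) list set set" where
  "gp_sub V E G D = generate (graph_product V E G) (\<Union>v\<in>D. gp_incl V E G v ` carrier (G v))"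

definition full_subgroup :: "'v set \<Rightarrow> ('v \<Rightarrow> 'v \<Rightarrow> bool) \<Rightarrow> ('v \<Rightarrow> 'g monoid)
    \<Rightarrow> ('v \<times> 'g) list set set \<Rightarrow> bool" where
  "full_subgroup V E G N \<longleftrightarrow>
     (\<exists>P. join_decomposition V E P \<and>
          (\<forall>D\<in>P. N \<inter> gp_sub V E G D \<noteq> {\<one>\<^bsub>graph_product V E G\<^esub>}))"

definition finitely_generated_subgroup :: "('a, 'b) monoid_scheme \<Rightarrow> 'a set \<Rightarrow> bool" where
  "finitely_generated_subgroup H N \<longleftrightarrow> (\<exists>S. finite S \<and> S \<subseteq> carrier H \<and> generate H S = N)"

definition abelian_by_finite :: "('a, 'b) monoid_scheme \<Rightarrow> bool" where
  "abelian_by_finite H \<longleftrightarrow>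
     (\<exists>A. A \<lhd> H \<and> comm_group (H\<lparr>carrier := A\<rparr>) \<and> finite (carrier (H Mod A)))"

definition finite_by_abelian :: "('a, 'b) monoid_scheme \<Rightarrow> bool" where
  "finite_by_abelian H \<longleftrightarrow> (\<exists>Q. Q \<lhd> H \<and> finite Q \<and> comm_group (H Mod Q))"

end

theory Submission
  imports Defs
begin

text \<open>
  For a vertex \<open>v\<close> let \<open>C\<close> be the subgroup generated by the vertex groups of the link of \<open>v\<close>; it
  commutes with the vertex group of \<open>v\<close>. If \<open>v\<close> is not central, the graph product splits as an
  amalgam over \<open>C\<close>. A finitely generated normal subgroup \<open>N\<close> that is not contained in \<open>C\<close> contains
  an element acting hyperbolically on the associated tree, so \<open>N\<close> acts with finitely many orbits of
  edges, that is, \<open>N C\<close> has finite index. Fullness excludes \<open>N \<subseteq> C\<close>: this inclusion would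
  propagate along non-adjacent vertices to all links in the join factor of \<open>v\<close>, and these have trivial
  common intersection with the factor. Hence in the quotient by \<open>N\<close> the image of each vertex group has
  a centralizer of finite index; for central \<open>v\<close> this comes from the hypothesis on proper quotients,
  since an abelian-by-finite and finite-by-abelian group has a center of finite index. As these images
  generate the quotient, its center has finite index, and Schur's theorem concludes.

  Instead of the tree we use the reduced words of the free product of the conjugates of the vertex
  group of \<open>v\<close>, on which the whole graph product acts.
\<close>

section \<open>Centralizers and finite index\<close>

text \<open>A graph product given by words modulo relations comes without normal forms, so nothing
  can be shown nontrivial, or outside a subgroup, by inspection. Such facts are read off from
  homomorphisms out of it, all supplied by one universal property: retractions onto subgroups of
  induced subgraphs, and the action on reduced words, where the image of the empty word serves as
  the normal form of the free product component. For finite index it is enough to tell apart the two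
  sides of one wall. A word with different first and last indices is cyclically reduced: its powers
  push every word to one side, the powers of its inverse push it to the other. Right multiplication
  by a fixed element crosses the wall only at finitely many cosets \<open>C f\<close>, and a finite
  generating set of \<open>N\<close> needs only finitely many of these altogether; this is where
  finite generation enters. The resulting sets \<open>C f N\<close> equal \<open>C N f\<close>
  because \<open>N\<close> is normal, and a decomposition of this shape is all that the quotient
  needs.\<close>

context group
begin

lemma mult_inv_cancel:
  assumes "x \<in> carrier G" "y \<in> carrier G"
  shows "x \<otimes> (inv x \<otimes> y) = y" "inv x \<otimes> (x \<otimes> y) = y"
  using assms by (simp_all add: m_assoc[symmetric])

lemma commute_mult:
  assumes "z \<in> carrier G" "a \<in> carrier G" "b \<in> carrier G" "z \<otimes> a = a \<otimes> z" "z \<otimes> b = b \<otimes> z"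
  shows "z \<otimes> (a \<otimes> b) = a \<otimes> b \<otimes> z"
proof -
  have "z \<otimes> (a \<otimes> b) = (z \<otimes> a) \<otimes> b" using assms(1-3) by (simp add: m_assoc)
  also have "\<dots> = a \<otimes> (z \<otimes> b)" using assms by (simp add: m_assoc)
  also have "\<dots> = a \<otimes> b \<otimes> z" using assms by (simp add: m_assoc)
  finally show ?thesis .
qed

lemma nat_pow_commute:
  fixes n :: nat
  assumes "c \<in> carrier G"
  shows "c \<otimes> c [^] n = c [^] n \<otimes> c"
  using assms nat_pow_Suc2[of c n] by simp

text \<open>Taken for arbitrary sets, so that one notion covers the center, with
  \<open>carrier G\<close> as the set, as well as centralizers of single elements and of images of
  vertex groups.\<close>

definition centralizer :: "'a set \<Rightarrow> 'a set" where
  "centralizer S = {g \<in> carrier G. \<forall>s\<in>S. g \<otimes> s = s \<otimes> g}"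

lemma centralizerD:
  assumes "g \<in> centralizer S"
  shows "g \<in> carrier G" "s \<in> S \<Longrightarrow> g \<otimes> s = s \<otimes> g"
  using assms unfolding centralizer_def by blast+

lemma centralizerI:
  assumes "g \<in> carrier G" "\<And>s. s \<in> S \<Longrightarrow> g \<otimes> s = s \<otimes> g"
  shows "g \<in> centralizer S"
  using assms unfolding centralizer_def by blast

lemma centralizer_subgroup:
  assumes "S \<subseteq> carrier G"
  shows "subgroup (centralizer S) G"
proof (rule subgroupI)
  show "centralizer S \<subseteq> carrier G" "centralizer S \<noteq> {}"
    using assms by (auto simp: centralizer_def intro!: exI[of _ \<one>])
next
  fix a assume a: "a \<in> centralizer S"
  have "inv a \<otimes> s = s \<otimes> inv a" if "s \<in> S" for s
  proof -
    have s: "s \<in> carrier G" and as: "a \<otimes> s = s \<otimes> a" and ac: "a \<in> carrier G"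
      using that assms centralizerD[OF a] by auto
    have "inv a \<otimes> s = inv a \<otimes> (s \<otimes> a) \<otimes> inv a"
      using s ac by (simp add: m_assoc)
    also have "\<dots> = s \<otimes> inv a"
      using s ac by (simp add: as[symmetric] m_assoc[symmetric])
    finally show ?thesis .
  qed
  then show "inv a \<in> centralizer S"
    using centralizerD(1)[OF a] by (auto intro: centralizerI)
next
  fix a b assume ab: "a \<in> centralizer S" "b \<in> centralizer S"
  have "a \<otimes> b \<otimes> s = s \<otimes> (a \<otimes> b)" if "s \<in> S" for s
  proof -
    have s: "s \<in> carrier G" "a \<otimes> s = s \<otimes> a" "b \<otimes> s = s \<otimes> b" "a \<in> carrier G" "b \<in> carrier G"
      using that assms centralizerD[OF ab(1)] centralizerD[OF ab(2)] by auto
    then show ?thesis using commute_mult[of s a b] by simp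
  qed
  then show "a \<otimes> b \<in> centralizer S"
    using ab[THEN centralizerD(1)] by (auto intro: centralizerI)
qed

lemma centralizer_generate:
  assumes "S \<subseteq> carrier G" "g \<in> centralizer S"
  shows "g \<in> centralizer (generate G S)"
proof -
  have g: "g \<in> carrier G" by (rule centralizerD(1)[OF assms(2)])
  have "S \<subseteq> centralizer {g}"
    using assms centralizerD[OF assms(2)] by (auto intro!: centralizerI)
  then have "generate G S \<subseteq> centralizer {g}"
    using generate_subgroup_incl centralizer_subgroup g by simp
  then have "s \<otimes> g = g \<otimes> s" if "s \<in> generate G S" for s
    using centralizerD(2)[of s "{g}" g] that by auto
  then show ?thesis using g centralizerI[of g] by metis
qed

lemma center_normal: "centralizer (carrier G) \<lhd> G"
  unfolding normal_inv_iff
proof (intro conjI ballI)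
  show "subgroup (centralizer (carrier G)) G" by (simp add: centralizer_subgroup)
  fix x h assume xh: "x \<in> carrier G" "h \<in> centralizer (carrier G)"
  then have hx: "h \<in> carrier G" "x \<otimes> h = h \<otimes> x"
    using centralizerD[OF xh(2)] by auto
  then have "x \<otimes> h \<otimes> inv x = h" using xh(1) by (simp add: m_assoc)
  then show "x \<otimes> h \<otimes> inv x \<in> centralizer (carrier G)" using xh by simp
qed

lemma center_comm_group: "comm_group (G\<lparr>carrier := centralizer (carrier G)\<rparr>)"
proof (rule group.group_comm_groupI)
  show "group (G\<lparr>carrier := centralizer (carrier G)\<rparr>)"
    by (rule subgroup_imp_group[OF centralizer_subgroup[OF order.refl]])
qed (use centralizerD in auto)

text \<open>Finite index is handled through factorizations \<open>g = a f\<close> with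
  \<open>f\<close> from a finite set, here and in the converse \<open>finite_rcosetsI\<close>: these
  pass directly through quotient maps.\<close>

lemma finite_rcosets_obtain:
  assumes sub: "subgroup A G" and "finite (rcosets A)"
  obtains F where "finite F" "F \<subseteq> carrier G"
    "\<And>g. g \<in> carrier G \<Longrightarrow> \<exists>a\<in>A. \<exists>f\<in>F. g = a \<otimes> f"
proof -
  have "rcosets A = (\<lambda>a. A #> a) ` carrier G" by (auto simp: RCOSETS_def)
  then obtain F where F: "F \<subseteq> carrier G" "finite F" "rcosets A = (\<lambda>a. A #> a) ` F"
    using assms finite_subset_image[of "rcosets A" "\<lambda>a. A #> a" "carrier G"] by auto
  have "\<exists>a\<in>A. \<exists>f\<in>F. g = a \<otimes> f" if g: "g \<in> carrier G" for g
  proof -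
    have "A #> g \<in> rcosets A" using g by (auto simp: RCOSETS_def)
    then obtain f where f: "f \<in> F" "A #> g = A #> f" using F(3) by auto
    have "g \<in> A #> g" using g sub by (simp add: rcos_self)
    then have "g \<in> A #> f" using f(2) by simp
    then show ?thesis using f(1) unfolding r_coset_def by blast
  qed
  with F that show ?thesis by blast
qed

lemma finite_rcosetsI:
  assumes "subgroup A G" "finite F" "F \<subseteq> carrier G"
    "\<And>g. g \<in> carrier G \<Longrightarrow> \<exists>a\<in>A. \<exists>f\<in>F. g = a \<otimes> f"
  shows "finite (rcosets A)"
proof (rule finite_subset)
  show "rcosets A \<subseteq> (\<lambda>f. A #> f) ` F"
  proof
    fix R assume "R \<in> rcosets A"
    then obtain g where g: "g \<in> carrier G" "R = A #> g" by (auto simp: RCOSETS_def)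
    obtain a f where af: "a \<in> A" "f \<in> F" "g = a \<otimes> f" using assms(4) g by blast
    have "A #> g = A #> f"
    proof -
      have "A #> (a \<otimes> f) = A #> a #> f"
        using af assms by (metis coset_mult_assoc subgroup.mem_carrier subgroup.subset subsetD)
      also have "A #> a = A" using af assms(1) by (simp add: coset_join2 subgroup.mem_carrier)
      finally show ?thesis using af by simp
    qed
    then show "R \<in> (\<lambda>f. A #> f) ` F" using g af by blast
  qed
qed (use assms in simp)

text \<open>A coset of the intersection is the intersection of the cosets of \<open>A\<close> and
  \<open>B\<close> through the same element, so pairs of cosets bound the index.\<close>

lemma finite_rcosets_Int:
  assumes "subgroup A G" "subgroup B G" "finite (rcosets A)" "finite (rcosets B)"
  shows "finite (rcosets (A \<inter> B))"
proof (rule finite_subset)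
  show "rcosets (A \<inter> B) \<subseteq> (\<Union>S\<in>rcosets A. \<Union>T\<in>rcosets B. {S \<inter> T})"
  proof
    fix R assume "R \<in> rcosets (A \<inter> B)"
    then obtain g where g: "g \<in> carrier G" "R = (A \<inter> B) #> g" by (auto simp: RCOSETS_def)
    have "h = k" if "h \<in> A" "k \<in> B" "h \<otimes> g = k \<otimes> g" for h k
      using that g subgroup.mem_carrier[OF assms(1)] subgroup.mem_carrier[OF assms(2)] by simp
    then have "R = (A #> g) \<inter> (B #> g)"
      using g(2) unfolding r_coset_def by blast
    then show "R \<in> (\<Union>S\<in>rcosets A. \<Union>T\<in>rcosets B. {S \<inter> T})"
      using g unfolding RCOSETS_def by blast
  qed
  show "finite ((\<Union>S\<in>rcosets A. \<Union>T\<in>rcosets B. {S \<inter> T}))"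
    using assms by simp
qed

lemma finite_rcosets_mono:
  assumes "subgroup A G" "subgroup B G" "A \<subseteq> B" "finite (rcosets A)"
  shows "finite (rcosets B)"
proof -
  obtain F where "finite F" "F \<subseteq> carrier G"
    "\<And>g. g \<in> carrier G \<Longrightarrow> \<exists>a\<in>A. \<exists>f\<in>F. g = a \<otimes> f"
    using finite_rcosets_obtain[OF assms(1,4)] by blast
  then show ?thesis
    using assms by (intro finite_rcosetsI[of B F]) blast+
qed

lemma finite_rcosets_centralizer_UN:
  assumes "finite I" "\<And>i. i \<in> I \<Longrightarrow> S i \<subseteq> carrier G"
    "\<And>i. i \<in> I \<Longrightarrow> finite (rcosets (centralizer (S i)))"
  shows "finite (rcosets (centralizer (\<Union>i\<in>I. S i)))"
  using assms
proof (induction I rule: finite_induct)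
  case empty
  have "rcosets (carrier G) \<subseteq> {carrier G}"
    by (auto simp: RCOSETS_def coset_join2 subgroup_self)
  moreover have "centralizer {} = carrier G" by (simp add: centralizer_def)
  ultimately show ?case by (simp add: finite_subset)
next
  case (insert i I)
  have "centralizer (\<Union>i\<in>insert i I. S i) = centralizer (S i) \<inter> centralizer (\<Union>i\<in>I. S i)"
    by (auto simp: centralizer_def)
  moreover have "finite (rcosets (centralizer (S i) \<inter> centralizer (\<Union>i\<in>I. S i)))"
    using insert by (intro finite_rcosets_Int centralizer_subgroup) auto
  ultimately show ?case by simp
qed

text \<open>What commutes with a generating set is central, and the centralizer of a finite union is
  a finite intersection of subgroups of finite index. In the application \<open>I\<close> is the
  vertex set.\<close>

lemma finite_rcosets_center:
  assumes "finite I" "\<And>i. i \<in> I \<Longrightarrow> S i \<subseteq> carrier G"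
    "\<And>i. i \<in> I \<Longrightarrow> finite (rcosets (centralizer (S i)))"
    "generate G (\<Union>i\<in>I. S i) = carrier G"
  shows "finite (rcosets (centralizer (carrier G)))"
proof -
  have sub: "(\<Union>i\<in>I. S i) \<subseteq> carrier G" using assms(2) by blast
  have "centralizer (\<Union>i\<in>I. S i) \<subseteq> centralizer (carrier G)"
    using centralizer_generate[OF sub] assms(4) by auto
  then show ?thesis
    by (rule finite_rcosets_mono[OF centralizer_subgroup[OF sub] centralizer_subgroup[OF order.refl] _
          finite_rcosets_centralizer_UN[OF assms(1-3)]])
qed

text \<open>Orbit-stabilizer for conjugation: modulo \<open>Q\<close> all conjugates of
  \<open>t\<close> agree, so the conjugacy class lies in the coset of \<open>t\<close>, which is
  finite because \<open>Q\<close> is.\<close>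

lemma finite_rcosets_centralizer_singleton:
  assumes Q: "Q \<lhd> G" "finite Q" "comm_group (G Mod Q)" and t: "t \<in> carrier G"
  shows "finite (rcosets (centralizer {t}))"
proof -
  let ?C = "centralizer {t}"
  interpret Q: normal Q G by fact
  interpret M: comm_group "G Mod Q" by fact
  have sub: "subgroup ?C G" using t centralizer_subgroup by simp
  have conj: "inv g \<otimes> t \<otimes> g \<in> Q #> t" if g: "g \<in> carrier G" for g
  proof -
    have "(Q #> inv g) <#> (Q #> t) <#> (Q #> g) = Q #> t"
    proof -
      have c: "Q #> inv g \<in> carrier (G Mod Q)" "Q #> t \<in> carrier (G Mod Q)" "Q #> g \<in> carrier (G Mod Q)"
        using g t by (auto simp: FactGroup_def RCOSETS_def)
      have "(Q #> inv g) <#> (Q #> t) <#> (Q #> g) = (Q #> t) <#> ((Q #> inv g) <#> (Q #> g))"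
        using M.m_comm M.m_assoc c by (simp add: FactGroup_def)
      then show ?thesis using g t by (simp add: Q.rcos_sum del: coset_mult_one)
    qed
    then have "Q #> (inv g \<otimes> t \<otimes> g) = Q #> t" using g t by (simp add: Q.rcos_sum)
    then show ?thesis using g t by (metis rcos_self inv_closed m_closed Q.subgroup_axioms)
  qed
  \<comment> \<open>The value \<open>inv g t g\<close> is constant on a right coset of the
    centralizer. Taking the image of the whole coset, a singleton, avoids choosing a
    representative.\<close>
  have "inj_on (\<lambda>R. (\<lambda>g. inv g \<otimes> t \<otimes> g) ` R) (rcosets ?C)"
  proof -
    have eq: "?C #> g = ?C #> h"
      if g: "g \<in> carrier G" and h: "h \<in> carrier G"
        and im: "(\<lambda>g. inv g \<otimes> t \<otimes> g) ` (?C #> g) = (\<lambda>g. inv g \<otimes> t \<otimes> g) ` (?C #> h)" for g h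
    proof -
      have "g \<in> ?C #> g" using sub g by (simp add: rcos_self)
      then obtain k where k: "k \<in> ?C #> h" "inv g \<otimes> t \<otimes> g = inv k \<otimes> t \<otimes> k" using im by blast
      have kc: "k \<in> carrier G" using k(1) h sub by (auto simp: r_coset_def dest: subgroup.mem_carrier)
      have "k \<otimes> inv g \<otimes> t = k \<otimes> (inv g \<otimes> t \<otimes> g) \<otimes> inv g"
        using g kc t by (simp add: m_assoc)
      also have "\<dots> = t \<otimes> (k \<otimes> inv g)"
        unfolding k(2) using g kc t by (simp add: m_assoc mult_inv_cancel)
      finally have "k \<otimes> inv g \<in> ?C" using g kc by (intro centralizerI) auto
      then have "k \<in> ?C #> g"
        using g kc by (auto simp: r_coset_def m_assoc intro!: bexI[of _ "k \<otimes> inv g"])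
      then have "?C #> g = ?C #> k" using repr_independence[of k ?C g] g sub by blast
      moreover have "?C #> h = ?C #> k" using repr_independence[of k ?C h] k(1) h sub by blast
      ultimately show ?thesis by simp
    qed
    show ?thesis by (rule inj_onI) (use eq in \<open>auto simp: RCOSETS_def\<close>)
  qed
  moreover have "(\<lambda>R. (\<lambda>g. inv g \<otimes> t \<otimes> g) ` R) ` (rcosets ?C) \<subseteq> Pow (Q #> t)"
  proof -
    have "R \<subseteq> carrier G" if "R \<in> rcosets ?C" for R
      using that sub by (simp add: subgroup.rcosets_carrier)
    then show ?thesis using conj by blast
  qed
  moreover have "finite (Pow (Q #> t))" using Q(2) by (simp add: r_coset_def)
  ultimately show ?thesis by (meson finite_imageD finite_subset)
qed

text \<open>An element of \<open>A\<close> that commutes with the finitely many representatives of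
  the cosets of \<open>A\<close> is central. The first hypothesis provides these representatives,
  the second the finite index of their centralizers.\<close>

lemma finite_rcosets_center_of_abelian_by_finite:
  assumes "abelian_by_finite G" "finite_by_abelian G"
  shows "finite (rcosets (centralizer (carrier G)))"
proof -
  obtain A where A: "A \<lhd> G" "comm_group (G\<lparr>carrier := A\<rparr>)" "finite (carrier (G Mod A))"
    using assms(1) by (auto simp: abelian_by_finite_def)
  obtain Q where Q: "Q \<lhd> G" "finite Q" "comm_group (G Mod Q)"
    using assms(2) by (auto simp: finite_by_abelian_def)
  have subA: "subgroup A G" using A(1) by (simp add: normal_imp_subgroup)
  interpret A: comm_group "G\<lparr>carrier := A\<rparr>" by (rule A(2))
  have "finite (rcosets A)" using A(3) by (simp add: FactGroup_def)
  then obtain F where F: "finite F" "F \<subseteq> carrier G"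
    "\<And>g. g \<in> carrier G \<Longrightarrow> \<exists>a\<in>A. \<exists>f\<in>F. g = a \<otimes> f"
    using finite_rcosets_obtain[OF subA] by blast
  \<comment> \<open>A union of singletons is the shape that
    \<open>finite_rcosets_centralizer_UN\<close> expects.\<close>
  let ?C = "centralizer (\<Union>t\<in>F. {t})"
  have "finite (rcosets ?C)"
    using F finite_rcosets_centralizer_singleton[OF Q] by (intro finite_rcosets_centralizer_UN) auto
  then have fin: "finite (rcosets (A \<inter> ?C))"
    using F by (intro finite_rcosets_Int subA \<open>finite (rcosets A)\<close> centralizer_subgroup) auto
  have "A \<inter> ?C \<subseteq> centralizer (carrier G)"
  proof
    fix z assume z: "z \<in> A \<inter> ?C"
    have zc: "z \<in> carrier G" using z centralizerD(1) by blast
    have "z \<otimes> g = g \<otimes> z" if g: "g \<in> carrier G" for g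
    proof -
      obtain a f where af: "a \<in> A" "f \<in> F" "g = a \<otimes> f" using F(3) g by blast
      have c: "a \<in> carrier G" "f \<in> carrier G" using af F(2) subgroup.mem_carrier[OF subA] by auto
      have "z \<otimes> a = a \<otimes> z" using A.m_comm z af by simp
      moreover have "z \<otimes> f = f \<otimes> z" using z af centralizerD(2)[of z] by blast
      ultimately show ?thesis using af(3) c zc commute_mult by simp
    qed
    then show "z \<in> centralizer (carrier G)" using zc by (intro centralizerI)
  qed
  then show ?thesis
    using finite_rcosets_mono[OF subgroups_Inter_pair[OF subA centralizer_subgroup]
        centralizer_subgroup[OF order.refl] _ fin] F(2) by auto
qed

section \<open>Schur's theorem\<close>

lemma list_prod_closed:
  assumes "set l \<subseteq> carrier G"
  shows "foldr (\<otimes>) l \<one> \<in> carrier G"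
  using assms by (induction l) auto

lemma list_prod_append:
  assumes "set k \<subseteq> carrier G" "set l \<subseteq> carrier G"
  shows "foldr (\<otimes>) (k @ l) \<one> = foldr (\<otimes>) k \<one> \<otimes> foldr (\<otimes>) l \<one>"
  using assms by (induction k) (auto simp: m_assoc list_prod_closed)

lemma list_prod_replicate:
  assumes "c \<in> carrier G"
  shows "foldr (\<otimes>) (replicate n c) \<one> = c [^] n"
  using assms by (induction n) (auto simp: nat_pow_commute)

lemma generate_list_prod:
  assumes "C \<subseteq> carrier G" "\<And>c. c \<in> C \<Longrightarrow> inv c \<in> C" "g \<in> generate G C"
  shows "\<exists>l. set l \<subseteq> C \<and> g = foldr (\<otimes>) l \<one>"
  using assms(3)
proof (induction rule: generate.induct)
  case one
  show ?case by (rule exI[of _ "[]"]) simp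
next
  case (incl h)
  then show ?case using assms(1) by (intro exI[of _ "[h]"]) auto
next
  case (inv h)
  then show ?case using assms(1,2) by (intro exI[of _ "[inv h]"]) auto
next
  case (eng g h)
  then obtain k l where "set k \<subseteq> C" "g = foldr (\<otimes>) k \<one>" "set l \<subseteq> C" "h = foldr (\<otimes>) l \<one>" by blast
  then show ?case using assms(1) list_prod_append[of k l] by (intro exI[of _ "k @ l"]) auto
qed

text \<open>A power of \<open>c\<close> moves left past a factor \<open>a\<close> at the price of
  conjugating \<open>a\<close>, and \<open>C\<close> is closed under conjugation. The number of
  factors is unchanged. The new list may contain \<open>c\<close> again; only the occurrences in
  \<open>l\<close> are counted.\<close>

lemma list_prod_collect:
  assumes C: "C \<subseteq> carrier G" "\<And>c g. c \<in> C \<Longrightarrow> g \<in> carrier G \<Longrightarrow> g \<otimes> c \<otimes> inv g \<in> C"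
    and c: "c \<in> C" and l: "set l \<subseteq> C"
  shows "\<exists>l'. set l' \<subseteq> C \<and> length l' + count_list l c = length l \<and>
    foldr (\<otimes>) l \<one> = c [^] count_list l c \<otimes> foldr (\<otimes>) l' \<one>"
  using l
proof (induction l)
  case Nil
  then show ?case by auto
next
  case (Cons a l)
  obtain l' where l': "set l' \<subseteq> C" "length l' + count_list l c = length l"
    "foldr (\<otimes>) l \<one> = c [^] count_list l c \<otimes> foldr (\<otimes>) l' \<one>"
    using Cons by auto
  have cc: "c \<in> carrier G" "a \<in> carrier G" "foldr (\<otimes>) l' \<one> \<in> carrier G"
    using C c Cons.prems l'(1) by (auto intro: list_prod_closed)
  show ?case
  proof (cases "a = c")
    case True
    then show ?thesis using l' cc
      by (intro exI[of _ l']) (auto simp: m_assoc[symmetric] nat_pow_commute)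
  next
    case False
    let ?p = "c [^] count_list l c"
    have "inv ?p \<otimes> a \<otimes> ?p \<in> C" using C(2)[of a "inv ?p"] Cons.prems cc by simp
    moreover have "a \<otimes> (?p \<otimes> foldr (\<otimes>) l' \<one>) = ?p \<otimes> ((inv ?p \<otimes> a \<otimes> ?p) \<otimes> foldr (\<otimes>) l' \<one>)"
      using cc by (simp add: m_assoc mult_inv_cancel)
    ultimately show ?thesis using False l' by (intro exI[of _ "(inv ?p \<otimes> a \<otimes> ?p) # l'"]) auto
  qed
qed

text \<open>Split off the last factor \<open>c\<close> and move the central power in front of it
  past its first letter \<open>x\<close>. What remains regroups into a conjugate of the
  \<open>n\<close>-th power of \<open>c\<close> and the commutator of the square of \<open>x\<close>
  with \<open>y\<close>. So \<open>n + 2\<close> commutators become \<open>n + 1\<close>.\<close>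

lemma commutator_pow_Suc:
  fixes n :: nat
  assumes xy: "x \<in> carrier G" "y \<in> carrier G" and c: "c = x \<otimes> y \<otimes> inv x \<otimes> inv y"
    and cen: "c [^] Suc n \<in> centralizer (carrier G)"
  shows "c [^] Suc (Suc n) =
    (x \<otimes> c \<otimes> inv x) [^] n \<otimes> ((x \<otimes> x) \<otimes> y \<otimes> inv (x \<otimes> x) \<otimes> inv y)"
proof -
  have cc: "c \<in> carrier G" using xy c by simp
  have conj: "(x \<otimes> c \<otimes> inv x) [^] n = x \<otimes> c [^] n \<otimes> inv x"
    using xy cc by (induction n) (auto simp: m_assoc mult_inv_cancel)
  define e where "e = c [^] n"
  have e: "e \<in> carrier G" "c [^] Suc n = e \<otimes> c" using cc by (simp_all add: e_def)
  have comm: "e \<otimes> c \<otimes> x = x \<otimes> (e \<otimes> c)" by (rule centralizerD(2)[OF cen[unfolded e(2)] xy(1)])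
  have "c [^] Suc (Suc n) = e \<otimes> c \<otimes> c" using e by simp
  also have "\<dots> = e \<otimes> c \<otimes> (x \<otimes> (y \<otimes> inv x \<otimes> inv y))"
    using xy by (simp add: c m_assoc)
  also have "\<dots> = (e \<otimes> c \<otimes> x) \<otimes> (y \<otimes> inv x \<otimes> inv y)" using xy e(1) cc by (simp add: m_assoc)
  also have "\<dots> = x \<otimes> e \<otimes> c \<otimes> (y \<otimes> inv x \<otimes> inv y)" using xy e(1) cc by (simp add: comm m_assoc)
  also have "\<dots> = (x \<otimes> e \<otimes> inv x) \<otimes> ((x \<otimes> x) \<otimes> y \<otimes> inv (x \<otimes> x) \<otimes> inv y)"
    using xy e(1) by (simp add: c m_assoc mult_inv_cancel inv_mult_group)
  finally show ?thesis using conj by (simp add: e_def)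
qed

text \<open>Central factors cancel in a commutator, so it depends only on the cosets of the two
  entries modulo the center.\<close>

lemma finite_derived_set:
  assumes fin: "finite (rcosets (centralizer (carrier G)))"
  shows "finite (derived_set G (carrier G))"
proof -
  let ?Z = "centralizer (carrier G)"
  obtain F where F: "finite F" "F \<subseteq> carrier G"
    "\<And>g. g \<in> carrier G \<Longrightarrow> \<exists>a\<in>?Z. \<exists>f\<in>F. g = a \<otimes> f"
    using finite_rcosets_obtain[OF centralizer_subgroup[OF order.refl] fin] by blast
  have "x \<otimes> y \<otimes> inv x \<otimes> inv y \<in> derived_set G F"
    if x: "x \<in> carrier G" and y: "y \<in> carrier G" for x y
  proof -
    obtain a f b e where af: "a \<in> ?Z" "f \<in> F" "x = a \<otimes> f" and be: "b \<in> ?Z" "e \<in> F" "y = b \<otimes> e"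
      using F(3)[OF x] F(3)[OF y] by blast
    have c: "a \<in> carrier G" "b \<in> carrier G" "f \<in> carrier G" "e \<in> carrier G"
      using af be F(2) by (auto dest: centralizerD(1))
    have a: "a \<otimes> g = g \<otimes> a" and b: "b \<otimes> g = g \<otimes> b" if "g \<in> carrier G" for g
      using centralizerD(2)[OF af(1) that] centralizerD(2)[OF be(1) that] by auto
    have "x \<otimes> y \<otimes> inv x \<otimes> inv y = (a \<otimes> (f \<otimes> b \<otimes> e \<otimes> inv f)) \<otimes> inv a \<otimes> inv e \<otimes> inv b"
      using c af be by (simp add: m_assoc inv_mult_group)
    also have "a \<otimes> (f \<otimes> b \<otimes> e \<otimes> inv f) = f \<otimes> b \<otimes> e \<otimes> inv f \<otimes> a"
      by (rule a) (use c in simp)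
    also have "f \<otimes> b \<otimes> e \<otimes> inv f \<otimes> a \<otimes> inv a \<otimes> inv e \<otimes> inv b =
        f \<otimes> (b \<otimes> (e \<otimes> inv f \<otimes> inv e)) \<otimes> inv b"
      using c by (simp add: m_assoc mult_inv_cancel)
    also have "b \<otimes> (e \<otimes> inv f \<otimes> inv e) = e \<otimes> inv f \<otimes> inv e \<otimes> b"
      by (rule b) (use c in simp)
    also have "f \<otimes> (e \<otimes> inv f \<otimes> inv e \<otimes> b) \<otimes> inv b = f \<otimes> e \<otimes> inv f \<otimes> inv e"
      using c by (simp add: m_assoc)
    finally show ?thesis using af be by blast
  qed
  then have "derived_set G (carrier G) \<subseteq> derived_set G F" by blast
  then show ?thesis using F(1) by (simp add: finite_subset)
qed

text \<open>A product of commutators in which some commutator \<open>c\<close> occurs more often than the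
  index \<open>n\<close> of the center can be rewritten with one commutator fewer, because \<open>c [^] (n + 1)\<close> is a
  product of \<open>n\<close> commutators. Hence boundedly many commutators suffice.\<close>

theorem finite_derived:
  assumes fin: "finite (rcosets (centralizer (carrier G)))"
  shows "finite (derived G (carrier G))"
proof -
  let ?Z = "centralizer (carrier G)"
  define C where "C = derived_set G (carrier G)"
  interpret Z: normal ?Z G by (rule center_normal)
  interpret M: group "G Mod ?Z" by (rule Z.factorgroup_is_group)
  \<comment> \<open>One less than the index, because \<open>commutator_pow_Suc\<close> asks for a
    central power with exponent \<open>Suc n\<close>; by Lagrange in the quotient by the center, the
    index is such an exponent.\<close>
  define n where "n = card (rcosets ?Z) - 1"
  have "?Z \<in> rcosets ?Z" by (rule Z.subgroup_in_rcosets[OF is_group])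
  then have "card (rcosets ?Z) > 0" using fin by (auto simp: card_gt_0_iff)
  then have n: "Suc n = order (G Mod ?Z)" by (simp add: n_def order_def FactGroup_def)
  have pow: "c [^] Suc n \<in> ?Z" if c: "c \<in> carrier G" for c
  proof -
    have "(?Z #> c) [^]\<^bsub>G Mod ?Z\<^esub> Suc n = \<one>\<^bsub>G Mod ?Z\<^esub>"
      unfolding n using c by (intro M.pow_order_eq_1) (auto simp: FactGroup_def RCOSETS_def)
    then have "?Z #> (c [^] Suc n) = ?Z"
      using c Z.FactGroup_pow[of c "Suc n"] by (simp add: FactGroup_def)
    then show ?thesis using c rcos_self[of "c [^] Suc n" ?Z] Z.subgroup_axioms by simp
  qed
  have C_I: "x \<otimes> y \<otimes> inv x \<otimes> inv y \<in> C" if "x \<in> carrier G" "y \<in> carrier G" for x y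
    using that unfolding C_def by blast
  have C_E: "\<exists>x\<in>carrier G. \<exists>y\<in>carrier G. c = x \<otimes> y \<otimes> inv x \<otimes> inv y" if "c \<in> C" for c
    using that unfolding C_def by simp
  have CC: "C \<subseteq> carrier G" unfolding C_def by (rule derived_set_in_carrier) simp
  have inv: "inv c \<in> C" if cC: "c \<in> C" for c
  proof -
    obtain x y where xy: "x \<in> carrier G" "y \<in> carrier G" "c = x \<otimes> y \<otimes> inv x \<otimes> inv y"
      using C_E[OF cC] by blast
    then have "inv c = y \<otimes> x \<otimes> inv y \<otimes> inv x" by (simp add: inv_mult_group m_assoc)
    then show ?thesis using C_I[OF xy(2,1)] by simp
  qed
  have conj: "g \<otimes> c \<otimes> inv g \<in> C" if cC: "c \<in> C" and g: "g \<in> carrier G" for c g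
  proof -
    obtain x y where xy: "x \<in> carrier G" "y \<in> carrier G" "c = x \<otimes> y \<otimes> inv x \<otimes> inv y"
      using C_E[OF cC] by blast
    let ?x = "g \<otimes> x \<otimes> inv g" and ?y = "g \<otimes> y \<otimes> inv g"
    have "g \<otimes> c \<otimes> inv g = ?x \<otimes> ?y \<otimes> inv ?x \<otimes> inv ?y"
      using xy g by (simp add: inv_mult_group m_assoc mult_inv_cancel)
    then show ?thesis using C_I[of ?x ?y] xy g by simp
  qed
  have finC: "finite C" unfolding C_def by (rule finite_derived_set[OF fin])
  have shorten: "\<exists>l'. set l' \<subseteq> C \<and> length l' < length l \<and> foldr (\<otimes>) l' \<one> = foldr (\<otimes>) l \<one>"
    if l: "set l \<subseteq> C" "length l > card C * Suc n" for l
  proof -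
    have "\<exists>c\<in>C. count_list l c > Suc n"
    proof (rule ccontr)
      assume "\<not> ?thesis"
      then have "sum (count_list l) C \<le> card C * Suc n"
        using sum_bounded_above[of C "count_list l" "Suc n"] by (auto simp: not_less)
      moreover have "sum (count_list l) C = length l" using sum_count_set[OF l(1) finC] .
      ultimately show False using l(2) by simp
    qed
    then obtain c where c: "c \<in> C" "count_list l c > Suc n" by blast
    obtain x y where xy: "x \<in> carrier G" "y \<in> carrier G" "c = x \<otimes> y \<otimes> inv x \<otimes> inv y"
      using C_E[OF c(1)] by blast
    have cc: "c \<in> carrier G" using c CC by blast
    obtain l' where l': "set l' \<subseteq> C" "length l' + count_list l c = length l"
      "foldr (\<otimes>) l \<one> = c [^] count_list l c \<otimes> foldr (\<otimes>) l' \<one>"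
      using list_prod_collect[OF CC conj c(1) l(1)] by blast
    \<comment> \<open>Of the copies of \<open>c\<close> collected in front,
      \<open>Suc (Suc n)\<close> are traded for \<open>n\<close> conjugates and one further
      commutator; the other \<open>m\<close> copies stay.\<close>
    obtain m where m: "count_list l c = Suc (Suc n) + m" using c(2) le_Suc_ex[of "Suc (Suc n)" "count_list l c"] by auto
    let ?d = "x \<otimes> c \<otimes> inv x" and ?e = "(x \<otimes> x) \<otimes> y \<otimes> inv (x \<otimes> x) \<otimes> inv y"
    have d: "?d \<in> C" by (rule conj[OF c(1) xy(1)])
    have e: "?e \<in> C" using xy by (intro C_I) auto
    let ?k = "replicate n ?d @ ?e # replicate m c @ l'"
    have "foldr (\<otimes>) ?k \<one> = foldr (\<otimes>) l \<one>"
    proof -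
      have cl: "foldr (\<otimes>) l' \<one> \<in> carrier G" "?d \<in> carrier G" "?e \<in> carrier G"
        using l'(1) CC xy cc by (auto intro!: list_prod_closed)
      have "foldr (\<otimes>) ?k \<one> = ?d [^] n \<otimes> (?e \<otimes> (c [^] m \<otimes> foldr (\<otimes>) l' \<one>))"
      proof -
        have "set (replicate m c) \<subseteq> carrier G" "set l' \<subseteq> carrier G"
          "set (replicate n ?d) \<subseteq> carrier G" "set (?e # replicate m c @ l') \<subseteq> carrier G"
          using cl cc l'(1) CC by auto
        then show ?thesis using cl cc
          by (simp add: list_prod_append list_prod_replicate del: foldr_append foldr_replicate)
      qed
      also have "\<dots> = (?d [^] n \<otimes> ?e) \<otimes> (c [^] m \<otimes> foldr (\<otimes>) l' \<one>)"
        using cl cc by (simp add: m_assoc)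
      also have "?d [^] n \<otimes> ?e = c [^] Suc (Suc n)"
        using commutator_pow_Suc[OF xy pow[OF cc]] by simp
      also have "c [^] Suc (Suc n) \<otimes> (c [^] m \<otimes> foldr (\<otimes>) l' \<one>) = foldr (\<otimes>) l \<one>"
        unfolding l'(3) m using cl cc by (simp only: nat_pow_mult[symmetric] m_assoc nat_pow_closed)
      finally show ?thesis .
    qed
    moreover have "set ?k \<subseteq> C" using d e c(1) l'(1) by auto
    moreover have "length ?k < length l" using l'(2) m by simp
    ultimately show ?thesis by blast
  qed
  have "derived G (carrier G) \<subseteq> (\<lambda>l. foldr (\<otimes>) l \<one>) ` {l. set l \<subseteq> C \<and> length l \<le> card C * Suc n}"
  proof
    fix g assume "g \<in> derived G (carrier G)"
    then obtain l0 where l0: "set l0 \<subseteq> C \<and> g = foldr (\<otimes>) l0 \<one>"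
      unfolding derived_def C_def[symmetric] using generate_list_prod[OF CC inv] by blast
    obtain l where l: "set l \<subseteq> C" "g = foldr (\<otimes>) l \<one>"
      and min: "\<And>k. set k \<subseteq> C \<Longrightarrow> g = foldr (\<otimes>) k \<one> \<Longrightarrow> length l \<le> length k"
      using ex_has_least_nat[of "\<lambda>l. set l \<subseteq> C \<and> g = foldr (\<otimes>) l \<one>", OF l0, of length] by auto
    have "length l \<le> card C * Suc n"
    proof (rule ccontr)
      assume "\<not> ?thesis"
      then obtain l' where "set l' \<subseteq> C" "length l' < length l" "foldr (\<otimes>) l' \<one> = g"
        using shorten[OF l(1)] l(2) by auto
      then show False using min[of l'] by simp
    qed
    then show "g \<in> (\<lambda>l. foldr (\<otimes>) l \<one>) ` {l. set l \<subseteq> C \<and> length l \<le> card C * Suc n}"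
      using l by blast
  qed
  then show ?thesis
    by (rule finite_subset) (intro finite_imageI finite_lists_length_le finC)
qed

lemma abelian_by_finite_if_center:
  assumes "finite (rcosets (centralizer (carrier G)))"
  shows "abelian_by_finite G"
  using assms center_normal center_comm_group
  by (auto simp: abelian_by_finite_def FactGroup_def)

lemma finite_by_abelian_if_center:
  assumes "finite (rcosets (centralizer (carrier G)))"
  shows "finite_by_abelian G"
  unfolding finite_by_abelian_def
proof (intro exI conjI)
  show "derived G (carrier G) \<lhd> G" by (rule derived_self_is_normal)
  show "finite (derived G (carrier G))" by (rule finite_derived[OF assms])
  show "comm_group (G Mod derived G (carrier G))"
    by (rule derived_quot_is_comm_group)
qed

end

section \<open>Graph products\<close>

locale graph_product_groups =
  fixes V :: "'v set" and E :: "'v \<Rightarrow> 'v \<Rightarrow> bool" and G :: "'v \<Rightarrow> 'g monoid"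
  assumes graph: "simplicial_graph V E"
    and groups: "v \<in> V \<Longrightarrow> group (G v)"
begin

abbreviation GP :: "('v \<times> 'g) list set monoid" where
  "GP \<equiv> graph_product V E G"

abbreviation L :: "('v \<times> 'g) set" where
  "L \<equiv> gp_letters V G"

abbreviation incl :: "'v \<Rightarrow> 'g \<Rightarrow> ('v \<times> 'g) list set" where
  "incl \<equiv> gp_incl V E G"

definition cls :: "('v \<times> 'g) list \<Rightarrow> ('v \<times> 'g) list set" where
  "cls w = {z. gp_eq V E G w z}"

section \<open>Words modulo the defining relations\<close>

lemma gp_basic_letters:
  assumes "gp_basic V E G l r"
  shows "set l \<subseteq> L" "set r \<subseteq> L"
  using assms by (cases; auto simp: gp_letters_def groups group.is_monoid monoid.m_closed monoid.one_closed)+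

lemma letter_iff: "(v, x) \<in> L \<longleftrightarrow> v \<in> V \<and> x \<in> carrier (G v)"
  by (simp add: gp_letters_def)

lemma gp_eq_letters:
  assumes "gp_eq V E G a b"
  shows "set a \<subseteq> L \<and> set b \<subseteq> L"
  using assms
proof induction
  case (ctx l r xs ys)
  then show ?case using gp_basic_letters[OF ctx(1)] by (auto simp: lists_eq_set)
qed auto

lemma gp_eq_context:
  assumes "gp_eq V E G a b" "set s \<subseteq> L" "set t \<subseteq> L"
  shows "gp_eq V E G (s @ a @ t) (s @ b @ t)"
  using assms(1)
proof induction
  case (refl w)
  then show ?case using assms(2,3) by (intro gp_eq.refl) (auto simp: lists_eq_set)
next
  case (sym a b)
  then show ?case by (blast intro: gp_eq.sym)
next
  case (trans a b c)
  then show ?case by (blast intro: gp_eq.trans)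
next
  case (ctx l r xs ys)
  then have "gp_eq V E G ((s @ xs) @ l @ (ys @ t)) ((s @ xs) @ r @ (ys @ t))"
    using assms(2,3) by (intro gp_eq.ctx) (auto simp: lists_eq_set)
  then show ?case by simp
qed

lemma gp_eq_append:
  assumes "gp_eq V E G a b" "gp_eq V E G c d"
  shows "gp_eq V E G (a @ c) (b @ d)"
proof -
  have "gp_eq V E G ([] @ a @ c) ([] @ b @ c)" "gp_eq V E G (b @ c @ []) (b @ d @ [])"
    using assms gp_eq_letters by (intro gp_eq_context; auto)+
  then show ?thesis by (auto intro: gp_eq.trans)
qed

lemma cls_eq_iff:
  assumes "set a \<subseteq> L"
  shows "cls a = cls b \<longleftrightarrow> gp_eq V E G a b"
proof
  assume "cls a = cls b"
  moreover have "a \<in> cls a" using assms by (simp add: cls_def gp_eq.refl lists_eq_set)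
  ultimately show "gp_eq V E G a b" by (auto simp: cls_def intro: gp_eq.sym)
next
  assume "gp_eq V E G a b"
  then show "cls a = cls b" by (auto simp: cls_def intro: gp_eq.sym gp_eq.trans)
qed

lemma carrier_GP: "carrier GP = cls ` {w. set w \<subseteq> L}"
  by (auto simp: graph_product_def quotient_def cls_def lists_eq_set)

lemma one_GP: "\<one>\<^bsub>GP\<^esub> = cls []"
  by (simp add: graph_product_def cls_def)

lemma mult_GP:
  assumes "set a \<subseteq> L" "set b \<subseteq> L"
  shows "cls a \<otimes>\<^bsub>GP\<^esub> cls b = cls (a @ b)"
proof -
  have "(\<exists>a'\<in>cls a. \<exists>b'\<in>cls b. gp_eq V E G (a' @ b') z) \<longleftrightarrow> gp_eq V E G (a @ b) z" for z
  proof
    assume "\<exists>a'\<in>cls a. \<exists>b'\<in>cls b. gp_eq V E G (a' @ b') z"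
    then show "gp_eq V E G (a @ b) z" by (auto simp: cls_def intro: gp_eq_append gp_eq.trans)
  next
    assume "gp_eq V E G (a @ b) z"
    then show "\<exists>a'\<in>cls a. \<exists>b'\<in>cls b. gp_eq V E G (a' @ b') z"
      using assms by (intro bexI[of _ a] bexI[of _ b]) (auto simp: cls_def lists_eq_set intro!: gp_eq.refl)
  qed
  then show ?thesis by (simp add: graph_product_def gp_mult_def cls_def)
qed

lemma incl_cls: "incl v x = cls [(v, x)]"
  by (simp add: gp_incl_def cls_def)

lemma cls_basic:
  assumes "gp_basic V E G l r"
  shows "cls l = cls r"
  using gp_eq.ctx[OF assms, of "[]" "[]"] gp_basic_letters[OF assms] by (simp add: cls_eq_iff)

lemma incl_closed:
  assumes "v \<in> V" "x \<in> carrier (G v)"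
  shows "incl v x \<in> carrier GP"
  using assms by (auto simp: carrier_GP incl_cls gp_letters_def)

lemma incl_mult:
  assumes "v \<in> V" "x \<in> carrier (G v)" "y \<in> carrier (G v)"
  shows "incl v (x \<otimes>\<^bsub>G v\<^esub> y) = incl v x \<otimes>\<^bsub>GP\<^esub> incl v y"
  using cls_basic[OF gp_basic.mult[of v V x G y E]] assms by (simp add: incl_cls mult_GP gp_letters_def)

lemma incl_one:
  assumes "v \<in> V"
  shows "incl v \<one>\<^bsub>G v\<^esub> = \<one>\<^bsub>GP\<^esub>"
  using cls_basic[OF gp_basic.one[OF assms]] by (simp add: incl_cls one_GP)

lemma incl_commute:
  assumes "u \<in> V" "w \<in> V" "E u w" "x \<in> carrier (G u)" "y \<in> carrier (G w)"
  shows "incl u x \<otimes>\<^bsub>GP\<^esub> incl w y = incl w y \<otimes>\<^bsub>GP\<^esub> incl u x"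
  using cls_basic[OF gp_basic.comm[of u V w E x G y]] assms by (simp add: incl_cls mult_GP gp_letters_def)

lemma monoid_GP: "monoid GP"
proof (rule monoidI)
  show "\<one>\<^bsub>GP\<^esub> \<in> carrier GP" by (auto simp: one_GP carrier_GP)
  fix a b assume "a \<in> carrier GP" "b \<in> carrier GP"
  then show "a \<otimes>\<^bsub>GP\<^esub> b \<in> carrier GP"
  proof -
    obtain k l where "set k \<subseteq> L" "a = cls k" "set l \<subseteq> L" "b = cls l"
      using \<open>a \<in> carrier GP\<close> \<open>b \<in> carrier GP\<close> by (auto simp: carrier_GP)
    then show ?thesis unfolding carrier_GP by (intro image_eqI[of _ _ "k @ l"]) (auto simp: mult_GP)
  qed
next
  fix a b c assume "a \<in> carrier GP" "b \<in> carrier GP" "c \<in> carrier GP"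
  then show "a \<otimes>\<^bsub>GP\<^esub> b \<otimes>\<^bsub>GP\<^esub> c = a \<otimes>\<^bsub>GP\<^esub> (b \<otimes>\<^bsub>GP\<^esub> c)"
    by (auto simp: carrier_GP mult_GP)
next
  fix a assume "a \<in> carrier GP"
  then show "\<one>\<^bsub>GP\<^esub> \<otimes>\<^bsub>GP\<^esub> a = a" "a \<otimes>\<^bsub>GP\<^esub> \<one>\<^bsub>GP\<^esub> = a"
    by (auto simp: carrier_GP mult_GP one_GP)
qed

text \<open>Vertex groups contain their inverses, so a word needs no inverse letters and a single
  induction step suffices. The rule rests on the monoid structure only and thus serves to prove that
  inverses exist.\<close>

lemma GP_induct [consumes 1, case_names one mult]:
  assumes "g \<in> carrier GP" "P \<one>\<^bsub>GP\<^esub>"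
    and "\<And>v x g. v \<in> V \<Longrightarrow> x \<in> carrier (G v) \<Longrightarrow> g \<in> carrier GP \<Longrightarrow> P g \<Longrightarrow> P (incl v x \<otimes>\<^bsub>GP\<^esub> g)"
  shows "P g"
proof -
  obtain w where w: "set w \<subseteq> L" "g = cls w" using assms(1) by (auto simp: carrier_GP)
  have "P (cls w)" using w(1)
  proof (induction w)
    case Nil
    then show ?case using assms(2) by (simp add: one_GP)
  next
    case (Cons a w)
    obtain v x where a: "a = (v, x)" by fastforce
    have vx: "v \<in> V" "x \<in> carrier (G v)" using Cons.prems a by (auto simp: gp_letters_def)
    have "P (incl v x \<otimes>\<^bsub>GP\<^esub> cls w)"
      using assms(3)[OF vx, of "cls w"] Cons by (auto simp: carrier_GP)
    then show ?case using Cons.prems a by (simp add: incl_cls mult_GP)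
  qed
  then show ?thesis using w by simp
qed

lemma group_GP: "group GP"
proof (rule monoid.group_l_invI[OF monoid_GP])
  interpret monoid GP by (rule monoid_GP)
  fix g assume "g \<in> carrier GP"
  then show "\<exists>h\<in>carrier GP. h \<otimes>\<^bsub>GP\<^esub> g = \<one>\<^bsub>GP\<^esub>"
  proof (induction rule: GP_induct)
    case one
    then show ?case by (intro bexI[of _ "\<one>\<^bsub>GP\<^esub>"]) auto
  next
    case (mult v x g)
    interpret Gv: group "G v" using groups mult by blast
    obtain h where h: "h \<in> carrier GP" "h \<otimes>\<^bsub>GP\<^esub> g = \<one>\<^bsub>GP\<^esub>" using mult by blast
    let ?y = "incl v (inv\<^bsub>G v\<^esub> x)"
    have cl: "?y \<in> carrier GP" "incl v x \<in> carrier GP" using mult by (simp_all add: incl_closed)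
    have "?y \<otimes>\<^bsub>GP\<^esub> incl v x = \<one>\<^bsub>GP\<^esub>"
      using mult incl_mult[of v "inv\<^bsub>G v\<^esub> x" x] by (simp add: incl_one)
    then have "?y \<otimes>\<^bsub>GP\<^esub> (incl v x \<otimes>\<^bsub>GP\<^esub> g) = g"
      using cl mult by (simp add: m_assoc[symmetric])
    then have "h \<otimes>\<^bsub>GP\<^esub> ?y \<otimes>\<^bsub>GP\<^esub> (incl v x \<otimes>\<^bsub>GP\<^esub> g) = \<one>\<^bsub>GP\<^esub>"
      using h cl mult by (simp add: m_assoc)
    then show ?case using h cl by (intro bexI[of _ "h \<otimes>\<^bsub>GP\<^esub> ?y"]) auto
  qed
qed

sublocale GP: group GP
  by (rule group_GP)

section \<open>Homomorphisms out of the graph product\<close>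

lemma incl_hom:
  assumes "v \<in> V"
  shows "incl v \<in> hom (G v) GP"
  using assms by (auto simp: hom_def incl_closed incl_mult)

lemma incl_inv:
  assumes "v \<in> V" "x \<in> carrier (G v)"
  shows "incl v (inv\<^bsub>G v\<^esub> x) = inv\<^bsub>GP\<^esub> (incl v x)"
proof -
  interpret group_hom "G v" GP "incl v"
    using assms incl_hom groups by (auto simp: group_hom_def group_hom_axioms_def group_GP)
  show ?thesis using assms by simp
qed

text \<open>The target is only a monoid because the main application maps into all self-maps of the
  set of words, where bijectivity need not be checked. Preservation of the unit does not follow from
  \<open>hom\<close> for monoids, hence it is both assumed for the vertex groups and
  asserted.\<close>

lemma universal_property:
  fixes M (structure)
  assumes "monoid M"
    and closed: "\<And>v x. v \<in> V \<Longrightarrow> x \<in> carrier (G v) \<Longrightarrow> \<phi> v x \<in> carrier M"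
    and mult: "\<And>v x y. v \<in> V \<Longrightarrow> x \<in> carrier (G v) \<Longrightarrow> y \<in> carrier (G v) \<Longrightarrow>
      \<phi> v (x \<otimes>\<^bsub>G v\<^esub> y) = \<phi> v x \<otimes> \<phi> v y"
    and one: "\<And>v. v \<in> V \<Longrightarrow> \<phi> v \<one>\<^bsub>G v\<^esub> = \<one>"
    and comm: "\<And>u w x y. u \<in> V \<Longrightarrow> w \<in> V \<Longrightarrow> E u w \<Longrightarrow> x \<in> carrier (G u) \<Longrightarrow> y \<in> carrier (G w) \<Longrightarrow>
      \<phi> u x \<otimes> \<phi> w y = \<phi> w y \<otimes> \<phi> u x"
  shows "\<exists>f. f \<in> hom GP M \<and> f \<one>\<^bsub>GP\<^esub> = \<one> \<and> (\<forall>v\<in>V. \<forall>x\<in>carrier (G v). f (incl v x) = \<phi> v x)"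
proof -
  interpret monoid M by fact
  define F where "F w = foldr (\<lambda>(v, x) a. \<phi> v x \<otimes> a) w \<one>" for w
  have F_simps: "F [] = \<one>" "F ((v, x) # w) = \<phi> v x \<otimes> F w" for v x w by (simp_all add: F_def)
  have F_closed: "F w \<in> carrier M" if "set w \<subseteq> L" for w
    using that by (induction w) (auto simp: F_simps letter_iff closed)
  have F_append: "F (a @ b) = F a \<otimes> F b" if "set a \<subseteq> L" "set b \<subseteq> L" for a b
    using that(1)
  proof (induction a)
    case (Cons l a)
    have "F a \<in> carrier M" "F b \<in> carrier M" using Cons.prems that(2) by (auto intro: F_closed)
    then show ?case using Cons by (cases l) (auto simp: F_simps letter_iff closed m_assoc)
  qed (use F_closed[OF that(2)] in \<open>simp add: F_simps\<close>)
  have F_basic: "F l = F r" if "gp_basic V E G l r" for l r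
    using that
  proof cases
    case (mult v g h)
    then show ?thesis using assms(3) by (simp add: F_simps closed)
  next
    case (one v)
    then show ?thesis using assms(4) by (simp add: F_simps closed)
  next
    case (comm u w g h)
    then show ?thesis using assms(5) by (simp add: F_simps closed)
  qed
  have F_eq: "F a = F b" if "gp_eq V E G a b" for a b
    using that
  proof induction
    case (ctx l r xs ys)
    then show ?case using gp_basic_letters[OF ctx(1)] F_basic[OF ctx(1)] by (simp add: F_append lists_eq_set)
  qed auto
  \<comment> \<open>Any word of the class will do, since \<open>F\<close> is constant on classes by
    \<open>F_eq\<close>.\<close>
  define f where "f S = F (SOME w. w \<in> S)" for S
  have f_cls: "f (cls w) = F w" if "set w \<subseteq> L" for w
  proof -
    have "w \<in> cls w" using that by (simp add: cls_def gp_eq.refl lists_eq_set)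
    then have "(SOME w'. w' \<in> cls w) \<in> cls w" by (rule someI)
    then show ?thesis unfolding f_def by (auto simp: cls_def dest: F_eq)
  qed
  have "f \<in> hom GP M"
    unfolding hom_def by (auto simp: carrier_GP mult_GP f_cls F_closed F_append)
  moreover have "f \<one>\<^bsub>GP\<^esub> = \<one>" by (simp add: one_GP f_cls F_simps)
  moreover have "f (incl v x) = \<phi> v x" if "v \<in> V" "x \<in> carrier (G v)" for v x
    using that closed[OF that] by (simp add: incl_cls f_cls gp_letters_def F_simps)
  ultimately show ?thesis by blast
qed

text \<open>The projection that kills all other vertex groups detects \<open>x\<close>. It respects
  the commutation relations because \<open>v\<close> is not adjacent to itself.\<close>

lemma incl_eq_one_iff:
  assumes "v \<in> V" "x \<in> carrier (G v)"
  shows "incl v x = \<one>\<^bsub>GP\<^esub> \<longleftrightarrow> x = \<one>\<^bsub>G v\<^esub>"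
proof -
  interpret Gv: group "G v" using groups assms by blast
  have irr: "\<not> E v v" using graph assms by (simp add: simplicial_graph_def)
  have "\<exists>f. f \<in> hom GP (G v) \<and> f \<one>\<^bsub>GP\<^esub> = \<one>\<^bsub>G v\<^esub> \<and>
    (\<forall>u\<in>V. \<forall>x\<in>carrier (G u). f (incl u x) = (if u = v then x else \<one>\<^bsub>G v\<^esub>))"
    by (rule universal_property) (use irr in auto)
  then show ?thesis using assms incl_one[OF assms(1)] by force
qed

text \<open>An endomorphism instead of a map to the graph product of the smaller graph: retractions
  can then be composed, and elements of \<open>gp_sub V E G A\<close> are recognized as fixed
  points.\<close>

definition retract :: "'v set \<Rightarrow> ('v \<times> 'g) list set \<Rightarrow> ('v \<times> 'g) list set" where
  "retract A = (SOME f. f \<in> hom GP GP \<and>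
     (\<forall>v\<in>V. \<forall>x\<in>carrier (G v). f (incl v x) = (if v \<in> A then incl v x else \<one>\<^bsub>GP\<^esub>)))"

lemma retract_props:
  "retract A \<in> hom GP GP \<and>
   (\<forall>v\<in>V. \<forall>x\<in>carrier (G v). retract A (incl v x) = (if v \<in> A then incl v x else \<one>\<^bsub>GP\<^esub>))"
proof -
  have "\<exists>f. f \<in> hom GP GP \<and> f \<one>\<^bsub>GP\<^esub> = \<one>\<^bsub>GP\<^esub> \<and>
    (\<forall>v\<in>V. \<forall>x\<in>carrier (G v). f (incl v x) = (if v \<in> A then incl v x else \<one>\<^bsub>GP\<^esub>))"
  proof (rule universal_property[OF monoid_GP], goal_cases)
    case (4 u w x y)
    then show ?case
      using incl_commute[of u w x y] GP.l_one GP.r_one by (simp add: incl_closed)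
  qed (simp_all add: incl_closed incl_mult incl_one)
  then have "\<exists>f. f \<in> hom GP GP \<and>
     (\<forall>v\<in>V. \<forall>x\<in>carrier (G v). f (incl v x) = (if v \<in> A then incl v x else \<one>\<^bsub>GP\<^esub>))" by blast
  from someI_ex[OF this] show ?thesis unfolding retract_def .
qed

lemma retract_incl:
  assumes "v \<in> V" "x \<in> carrier (G v)"
  shows "retract A (incl v x) = (if v \<in> A then incl v x else \<one>\<^bsub>GP\<^esub>)"
  using retract_props assms by blast

lemma retract_group_hom: "group_hom GP GP (retract A)"
  using retract_props by (auto simp: group_hom_def group_hom_axioms_def group_GP)

lemma retract_closed: "g \<in> carrier GP \<Longrightarrow> retract A g \<in> carrier GP"
  using group_hom.hom_closed[OF retract_group_hom] .

lemma retract_mult: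
  "g \<in> carrier GP \<Longrightarrow> h \<in> carrier GP \<Longrightarrow> retract A (g \<otimes>\<^bsub>GP\<^esub> h) = retract A g \<otimes>\<^bsub>GP\<^esub> retract A h"
  using group_hom.hom_mult[OF retract_group_hom] .

lemma retract_one: "retract A \<one>\<^bsub>GP\<^esub> = \<one>\<^bsub>GP\<^esub>"
  using group_hom.hom_one[OF retract_group_hom] .

text \<open>The substitute for computing intersections of subgroups of induced subgraphs: an element
  fixed by two retractions is fixed by the one onto the common vertices.\<close>

lemma retract_retract:
  assumes "g \<in> carrier GP"
  shows "retract A (retract B g) = retract (A \<inter> B) g"
  using assms
proof (induction rule: GP_induct)
  case one
  then show ?case by (simp add: retract_one)
next
  case (mult v x g)
  then show ?case by (simp add: retract_mult incl_closed retract_closed retract_incl retract_one)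
qed

lemma retract_empty:
  assumes "g \<in> carrier GP"
  shows "retract {} g = \<one>\<^bsub>GP\<^esub>"
  using assms
proof (induction rule: GP_induct)
  case one
  then show ?case by (simp add: retract_one)
next
  case (mult v x g)
  then show ?case by (simp add: retract_mult incl_closed retract_incl)
qed

section \<open>Subgroups of induced subgraphs\<close>

lemma sub_generators_closed:
  assumes "A \<subseteq> V"
  shows "(\<Union>v\<in>A. incl v ` carrier (G v)) \<subseteq> carrier GP"
  using assms incl_closed by auto

lemma sub_subgroup:
  assumes "A \<subseteq> V"
  shows "subgroup (gp_sub V E G A) GP"
  unfolding gp_sub_def by (rule GP.generate_is_subgroup[OF sub_generators_closed[OF assms]])

lemma incl_in_sub:
  assumes "v \<in> A" "x \<in> carrier (G v)"
  shows "incl v x \<in> gp_sub V E G A"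
  unfolding gp_sub_def using assms by (intro generate.incl) auto

lemma sub_minimal:
  assumes "subgroup H GP" "\<And>v x. v \<in> A \<Longrightarrow> x \<in> carrier (G v) \<Longrightarrow> incl v x \<in> H"
  shows "gp_sub V E G A \<subseteq> H"
  unfolding gp_sub_def using assms by (intro GP.generate_subgroup_incl) auto

lemma retract_in_sub:
  assumes "A \<subseteq> V" "g \<in> carrier GP"
  shows "retract A g \<in> gp_sub V E G A"
  using assms(2)
proof (induction rule: GP_induct)
  case one
  then show ?case using subgroup.one_closed[OF sub_subgroup[OF assms(1)]] by (simp add: retract_one)
next
  case (mult v x g)
  then show ?case
    using subgroup.m_closed[OF sub_subgroup[OF assms(1)]] subgroup.one_closed[OF sub_subgroup[OF assms(1)]]
    by (simp add: retract_mult incl_closed retract_incl incl_in_sub retract_closed)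
qed

lemma retract_sub:
  assumes "A \<subseteq> V" "A \<subseteq> B" "g \<in> gp_sub V E G A"
  shows "retract B g = g"
proof -
  interpret group_hom GP GP "retract B" by (rule retract_group_hom)
  have "subgroup {g \<in> carrier GP. retract B g = g} GP"
    by (rule GP.subgroupI) auto
  then have "gp_sub V E G A \<subseteq> {g \<in> carrier GP. retract B g = g}"
    by (rule sub_minimal) (use assms in \<open>auto simp: retract_incl incl_closed subset_iff\<close>)
  then show ?thesis using assms(3) by auto
qed

lemma incl_in_sub_iff:
  assumes "A \<subseteq> V" "v \<in> V" "x \<in> carrier (G v)" "x \<noteq> \<one>\<^bsub>G v\<^esub>"
  shows "incl v x \<in> gp_sub V E G A \<longleftrightarrow> v \<in> A"
proof
  assume "incl v x \<in> gp_sub V E G A"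
  then have "retract A (incl v x) = incl v x" using retract_sub assms(1) by blast
  then show "v \<in> A" using assms incl_eq_one_iff[of v x] by (simp add: retract_incl split: if_splits)
qed (use assms incl_in_sub in blast)

lemma sub_V: "gp_sub V E G V = carrier GP"
proof
  show "gp_sub V E G V \<subseteq> carrier GP" using subgroup.subset[OF sub_subgroup] by blast
  show "carrier GP \<subseteq> gp_sub V E G V"
  proof
    fix g assume "g \<in> carrier GP"
    then show "g \<in> gp_sub V E G V"
      by (induction rule: GP_induct)
        (auto intro: subgroup.one_closed subgroup.m_closed sub_subgroup incl_in_sub)
  qed
qed

section \<open>Links\<close>

definition link :: "'v \<Rightarrow> 'v set" where
  "link v = {u \<in> V. E v u}"

lemma link_subset: "link v \<subseteq> V"
  by (auto simp: link_def)

lemma sub_link_commute: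
  assumes "v \<in> V" "x \<in> carrier (G v)" "c \<in> gp_sub V E G (link v)"
  shows "c \<otimes>\<^bsub>GP\<^esub> incl v x = incl v x \<otimes>\<^bsub>GP\<^esub> c"
proof -
  have "gp_sub V E G (link v) \<subseteq> GP.centralizer {incl v x}"
  proof (rule sub_minimal)
    show "subgroup (GP.centralizer {incl v x}) GP"
      using assms by (intro GP.centralizer_subgroup) (auto simp: incl_closed)
    fix u y assume "u \<in> link v" "y \<in> carrier (G u)"
    then show "incl u y \<in> GP.centralizer {incl v x}"
      using assms(1,2) incl_commute[of v u x y]
      by (intro GP.centralizerI) (auto simp: link_def incl_closed)
  qed
  then show ?thesis using assms(3) GP.centralizerD(2) by blast
qed

text \<open>As \<open>u\<close> is not in its own link, \<open>n\<close> is fixed by the retraction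
  that kills \<open>u\<close>, for each \<open>u\<close> in \<open>D\<close>. Composing these shows
  that \<open>n\<close> survives killing all of \<open>D\<close>; being fixed by the retraction onto
  \<open>D\<close> as well, it is fixed by the one onto the empty set.\<close>

lemma trivial_if_in_links:
  assumes D: "D \<subseteq> V" and n: "n \<in> gp_sub V E G D" "\<And>u. u \<in> D \<Longrightarrow> n \<in> gp_sub V E G (link u)"
  shows "n = \<one>\<^bsub>GP\<^esub>"
proof -
  have nc: "n \<in> carrier GP" using n(1) subgroup.mem_carrier[OF sub_subgroup[OF D]] by blast
  have fin: "finite D" using D graph finite_subset by (auto simp: simplicial_graph_def)
  have "retract (V - D') n = n" if "D' \<subseteq> D" for D'
    using finite_subset[OF that fin] that
  proof (induction D' rule: finite_induct)
    case empty
    then show ?case using retract_sub[OF D _ n(1)] D by simp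
  next
    case (insert u D')
    have "u \<notin> link u" using insert.prems D graph by (auto simp: link_def simplicial_graph_def)
    then have "retract (V - {u}) n = n"
      using retract_sub[OF link_subset _ n(2), of u "V - {u}"] link_subset[of u] insert.prems
      by (simp add: subset_Diff_insert)
    then have "retract ((V - {u}) \<inter> (V - D')) n = n"
      using retract_retract[OF nc, of "V - {u}" "V - D'"] insert by simp
    moreover have "(V - {u}) \<inter> (V - D') = V - insert u D'" by auto
    ultimately show ?case by simp
  qed
  then have "retract (V - D) n = n" by simp
  then have "retract (D \<inter> (V - D)) n = n"
    using retract_retract[OF nc, of D "V - D"] retract_sub[OF D _ n(1)] by simp
  then show ?thesis using retract_empty[OF nc] by (simp add: Diff_Int_distrib)
qed

end

section \<open>Reduced words in a free product of copies of a group\<close>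

context group
begin

definition reduced :: "'i set \<Rightarrow> ('i \<times> 'a) list \<Rightarrow> bool" where
  "reduced I w \<longleftrightarrow> (\<forall>(i, x)\<in>set w. i \<in> I \<and> x \<in> carrier G \<and> x \<noteq> \<one>) \<and> distinct_adj (map fst w)"

definition lmul :: "'i \<Rightarrow> 'a \<Rightarrow> ('i \<times> 'a) list \<Rightarrow> ('i \<times> 'a) list" where
  "lmul i x w = (if x = \<one> then w else
     case w of [] \<Rightarrow> [(i, x)]
     | (j, y) # w' \<Rightarrow>
       if i = j then (if x \<otimes> y = \<one> then w' else (i, x \<otimes> y) # w') else (i, x) # w)"

definition wmul :: "('i \<times> 'a) list \<Rightarrow> ('i \<times> 'a) list \<Rightarrow> ('i \<times> 'a) list" where
  "wmul q w = foldr (\<lambda>(i, x). lmul i x) q w"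

definition winv :: "('i \<times> 'a) list \<Rightarrow> ('i \<times> 'a) list" where
  "winv w = rev (map (apsnd (m_inv G)) w)"

text \<open>The words with first index \<open>i\<close> form one side of a wall; this is the
  half-space used later, with the coset \<open>C\<close> as \<open>i\<close>.\<close>

definition starts :: "'i \<Rightarrow> ('i \<times> 'a) list \<Rightarrow> bool" where
  "starts i w \<longleftrightarrow> w \<noteq> [] \<and> fst (hd w) = i"

lemma reduced_Nil: "reduced I []"
  by (simp add: reduced_def)

lemma reduced_Cons:
  "reduced I ((i, x) # w) \<longleftrightarrow> i \<in> I \<and> x \<in> carrier G \<and> x \<noteq> \<one> \<and> reduced I w \<and> \<not> starts i w"
  by (cases w) (auto simp: reduced_def starts_def)

lemma reduced_append:
  "reduced I (p @ q) \<longleftrightarrow>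
    reduced I p \<and> reduced I q \<and> (p = [] \<or> q = [] \<or> fst (last p) \<noteq> fst (hd q))"
  by (auto simp: reduced_def distinct_adj_append_iff last_map hd_map)

lemma reduced_last:
  assumes "reduced I w" "w \<noteq> []"
  shows "fst (last w) \<in> I" "fst (hd w) \<in> I"
proof -
  have "last w \<in> set w" "hd w \<in> set w" using assms by auto
  then show "fst (last w) \<in> I" "fst (hd w) \<in> I"
    using assms(1) by (auto simp: reduced_def split_beta)
qed

lemma reduced_winv:
  assumes "reduced I w"
  shows "reduced I (winv w)"
proof -
  have "map fst (winv w) = rev (map fst w)" by (simp add: winv_def rev_map comp_def)
  moreover have "i \<in> I \<and> x \<in> carrier G \<and> x \<noteq> \<one>" if ix: "(i, x) \<in> set (winv w)" for i x
  proof -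
    obtain y where y: "(i, y) \<in> set w" "x = inv y" using ix by (auto simp: winv_def)
    then have "i \<in> I" "y \<in> carrier G" "y \<noteq> \<one>" using assms by (auto simp: reduced_def)
    then show ?thesis using y(2) by simp
  qed
  ultimately show ?thesis using assms by (auto simp: reduced_def)
qed

lemma winv_ends:
  assumes "w \<noteq> []"
  shows "winv w \<noteq> []" "fst (hd (winv w)) = fst (last w)" "fst (last (winv w)) = fst (hd w)"
  using assms by (auto simp: winv_def hd_rev last_rev last_map hd_map)

lemma lmul_one: "lmul i \<one> w = w"
  by (simp add: lmul_def)

lemma lmul_not_starts:
  assumes "x \<noteq> \<one>" "\<not> starts i w"
  shows "lmul i x w = (i, x) # w"
  using assms by (cases w) (auto simp: lmul_def starts_def)

lemma reduced_lmul:
  assumes "reduced I w" "i \<in> I" "x \<in> carrier G"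
  shows "reduced I (lmul i x w)"
proof (cases w)
  case Nil
  then show ?thesis using assms by (auto simp: lmul_def reduced_Cons reduced_Nil starts_def)
next
  case (Cons a w')
  then show ?thesis using assms
    by (cases a) (auto simp: lmul_def reduced_Cons starts_def)
qed

text \<open>This makes \<open>lmul i\<close> an action of the copy of the group with index
  \<open>i\<close>. Letting a free product act on reduced words in this way is van der Waerden's
  route to the uniqueness of normal forms.\<close>

lemma lmul_mult:
  assumes w: "reduced I w" and xy: "x \<in> carrier G" "y \<in> carrier G"
  shows "lmul i x (lmul i y w) = lmul i (x \<otimes> y) w"
proof (cases "x = \<one> \<or> y = \<one>")
  case True
  then show ?thesis using xy by (auto simp: lmul_one)
next
  case False
  then have ne: "x \<noteq> \<one>" "y \<noteq> \<one>" by auto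
  show ?thesis
  proof (cases "starts i w")
    case False
    then have *: "lmul i y w = (i, y) # w" using ne(2) by (simp add: lmul_not_starts)
    show ?thesis
    proof (cases "x \<otimes> y = \<one>")
      case True
      then show ?thesis using ne(1) unfolding * by (simp add: lmul_def)
    next
      case xy1: False
      then have "lmul i (x \<otimes> y) w = (i, x \<otimes> y) # w" using False by (rule lmul_not_starts)
      then show ?thesis using ne(1) xy1 unfolding * by (simp add: lmul_def)
    qed
  next
    case True
    then obtain z w' where wz: "w = (i, z) # w'" by (cases w) (auto simp: starts_def)
    have z: "z \<in> carrier G" "z \<noteq> \<one>" and w': "\<not> starts i w'" using w wz by (auto simp: reduced_Cons)
    show ?thesis
    proof (cases "y \<otimes> z = \<one>")
      case yz: True
      have "x \<otimes> y \<otimes> z = x" using yz xy z by (simp add: m_assoc)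
      then have "lmul i (x \<otimes> y) w = (i, x) # w'"
        using z(1) wz ne(1) by (cases "x \<otimes> y = \<one>") (simp_all add: lmul_def)
      moreover have "lmul i x (lmul i y w) = (i, x) # w'"
        using yz ne wz lmul_not_starts[OF ne(1) w'] by (simp add: lmul_def)
      ultimately show ?thesis by simp
    next
      case False
      have "lmul i y w = (i, y \<otimes> z) # w'" using False ne wz by (simp add: lmul_def)
      then have L: "lmul i x (lmul i y w) = (if x \<otimes> y \<otimes> z = \<one> then w' else (i, x \<otimes> y \<otimes> z) # w')"
        using ne xy z by (simp add: lmul_def m_assoc)
      show ?thesis
      proof (cases "x \<otimes> y = \<one>")
        case True
        then show ?thesis using L wz z by (simp add: lmul_one)
      next
        case False
        then show ?thesis using L wz by (simp add: lmul_def)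
      qed
    qed
  qed
qed

lemma lmul_map:
  assumes "\<And>j. j \<in> fst ` set w \<Longrightarrow> f i = f j \<Longrightarrow> i = j"
  shows "map (apfst f) (lmul i x w) = lmul (f i) x (map (apfst f) w)"
proof (cases w)
  case Nil
  then show ?thesis by (simp add: lmul_def)
next
  case (Cons a w')
  then show ?thesis using assms by (cases a) (auto simp: lmul_def)
qed

lemma reduced_map:
  assumes "reduced I w" "inj_on f I" "f ` I \<subseteq> J"
  shows "reduced J (map (apfst f) w)"
  using assms(1)
proof (induction w)
  case Nil
  then show ?case by (simp add: reduced_Nil)
next
  case (Cons a w)
  obtain i x where a: "a = (i, x)" by fastforce
  have "\<not> starts (f i) (map (apfst f) w)"
  proof (cases w)
    case (Cons b w')
    have "i \<in> I" "fst b \<in> I" "fst b \<noteq> i"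
      using Cons.prems a Cons reduced_last(2)[of I w] by (auto simp: reduced_Cons starts_def)
    then show ?thesis using Cons assms(2) by (auto simp: starts_def inj_on_def)
  qed (simp add: starts_def)
  then show ?case using Cons a assms(3) by (auto simp: reduced_Cons)
qed

lemma wmul_simps:
  "wmul [] w = w" "wmul ((i, x) # q) w = lmul i x (wmul q w)" "wmul (p @ q) w = wmul p (wmul q w)"
  by (simp_all add: wmul_def)

lemma wmul_append:
  assumes "reduced I (q @ w)"
  shows "wmul q w = q @ w"
  using assms
proof (induction q)
  case (Cons a q)
  then show ?case by (cases a) (auto simp: wmul_simps reduced_Cons lmul_not_starts)
qed (simp add: wmul_simps)

lemma reduced_wmul:
  assumes "reduced I q" "reduced I w"
  shows "reduced I (wmul q w)"
  using assms(1)
proof (induction q)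
  case (Cons a q)
  then show ?case by (cases a) (auto simp: wmul_simps reduced_Cons reduced_lmul)
qed (simp add: wmul_simps assms(2))

lemma lmul_starts_or_shorter:
  assumes "x \<noteq> \<one>"
  shows "starts i (lmul i x w) \<or> length (lmul i x w) + 1 = length w"
proof (cases w)
  case (Cons a w')
  then show ?thesis using assms by (cases a) (auto simp: lmul_def starts_def)
qed (use assms in \<open>simp add: lmul_def starts_def\<close>)

text \<open>The letters of \<open>q\<close> are applied from its end. As soon as one survives, all
  earlier ones are merely prepended, since neighbouring indices differ; otherwise every letter of
  \<open>q\<close> deletes one of \<open>w\<close>.\<close>

lemma wmul_starts_or_shorter:
  assumes "reduced I q" "q \<noteq> []"
  shows "starts (fst (hd q)) (wmul q w) \<or> length (wmul q w) + length q = length w"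
  using assms
proof (induction q)
  case (Cons a q)
  obtain i x where a: "a = (i, x)" by fastforce
  have x: "x \<noteq> \<one>" and q: "reduced I q" "\<not> starts i q" using Cons.prems a by (auto simp: reduced_Cons)
  show ?case
  proof (cases "q = []")
    case True
    then show ?thesis using a x lmul_starts_or_shorter[of x i w] by (simp add: wmul_simps)
  next
    case False
    then consider "starts (fst (hd q)) (wmul q w)" | "length (wmul q w) + length q = length w"
      using Cons.IH q by blast
    then show ?thesis
    proof cases
      case 1
      then have "\<not> starts i (wmul q w)" using q(2) False by (auto simp: starts_def)
      then have "wmul (a # q) w = (i, x) # wmul q w" using a x by (simp add: wmul_simps lmul_not_starts)
      then show ?thesis using a by (simp add: starts_def)
    next
      case 2
      then show ?thesis using a x lmul_starts_or_shorter[of x i "wmul q w"] by (auto simp: wmul_simps)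
    qed
  qed
qed simp

text \<open>Right multiplication by a letter alters only the end of \<open>q\<close>. It can affect
  the first index only when \<open>q\<close> is empty or is a single letter cancelled by the new
  one; these two words make the boundary of the half-space finite modulo \<open>C\<close>.\<close>

lemma starts_boundary:
  assumes q: "reduced I q" and x: "x \<in> carrier G" "x \<noteq> \<one>"
    and change: "starts i (wmul q [(j, x)]) \<noteq> starts i q"
  shows "j = i \<and> (q = [] \<or> q = [(i, inv x)])"
proof (cases q)
  case Nil
  then show ?thesis using change by (auto simp: wmul_simps starts_def)
next
  case (Cons a q')
  obtain k y where a: "a = (k, y)" by fastforce
  have y: "y \<in> carrier G" "y \<noteq> \<one>" and q': "reduced I q'" "\<not> starts k q'"
    using q Cons a by (auto simp: reduced_Cons)
  show ?thesis
  proof (cases "q' = []")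
    case True
    then show ?thesis
    proof (cases "k = j \<and> y \<otimes> x = \<one>")
      case kj: True
      then have "y = inv x" using x y inv_equality[of y x] by simp
      moreover have "wmul q [(j, x)] = []"
        using kj True Cons a y(2) by (simp add: wmul_simps lmul_def)
      then have "starts i q" using change by (simp add: starts_def)
      then have "k = i" using Cons a by (simp add: starts_def)
      ultimately show ?thesis using kj True Cons a by simp
    next
      case False
      then have "starts i (wmul q [(j, x)]) \<longleftrightarrow> k = i"
        using True Cons a y(2) by (simp add: wmul_simps lmul_def starts_def)
      then show ?thesis using change Cons a by (simp add: starts_def)
    qed
  next
    case False
    \<comment> \<open>The product starts with the first index of \<open>q'\<close>, which differs
      from \<open>k\<close>, or it is empty by the length count. In both cases the letter with index
      \<open>k\<close> has nothing to merge with.\<close>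
    have "\<not> starts k (wmul q' [(j, x)])"
      using wmul_starts_or_shorter[OF q'(1) False, of "[(j, x)]"]
    proof
      assume "starts (fst (hd q')) (wmul q' [(j, x)])"
      then show ?thesis using q'(2) False by (auto simp: starts_def)
    next
      assume "length (wmul q' [(j, x)]) + length q' = length [(j, x)]"
      then have "wmul q' [(j, x)] = []" using False by (cases q') auto
      then show ?thesis by (simp add: starts_def)
    qed
    then have "wmul q [(j, x)] = (k, y) # wmul q' [(j, x)]"
      using Cons a y by (simp add: wmul_simps lmul_not_starts)
    then show ?thesis using change Cons a by (simp add: starts_def)
  qed
qed

text \<open>Different first and last indices mean that \<open>p\<close> is cyclically reduced:
  powers arise by concatenation without cancellation.\<close>

lemma reduced_pow:
  assumes "reduced I p" "p \<noteq> []" "fst (last p) \<noteq> fst (hd p)"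
  shows "reduced I (concat (replicate n p)) \<and> (n > 0 \<longrightarrow> starts (fst (hd p)) (concat (replicate n p)))"
proof (induction n)
  case (Suc n)
  then show ?case using assms by (cases "n = 0") (auto simp: reduced_append starts_def reduced_Nil)
qed (simp add: reduced_Nil)

text \<open>A product of \<open>length w + 1\<close> copies of \<open>p\<close> is longer than
  \<open>w\<close>, so \<open>w\<close> cannot cancel all of it and its first index
  survives.\<close>

lemma wmul_pow_starts:
  assumes "reduced I p" "p \<noteq> []" "fst (last p) \<noteq> fst (hd p)"
  shows "starts (fst (hd p)) (wmul (concat (replicate (Suc (length w)) p)) w)"
proof -
  define q where "q = concat (replicate (Suc (length w)) p)"
  have q: "reduced I q" "starts (fst (hd p)) q"
    using reduced_pow[OF assms, of "Suc (length w)"] unfolding q_def by auto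
  have "length (concat (replicate n p)) = n * length p" for n by (induction n) auto
  then have "length q = Suc (length w) * length p" by (simp only: q_def)
  moreover have "Suc (length w) * length p \<ge> Suc (length w)" using assms(2) by (cases p) auto
  ultimately have len: "length q > length w" by linarith
  have ne: "q \<noteq> []" "fst (hd q) = fst (hd p)" using q(2) by (simp_all add: starts_def)
  show ?thesis
    using wmul_starts_or_shorter[OF q(1) ne(1), of w] len ne(2) unfolding q_def[symmetric] by auto
qed

end

section \<open>The action of a graph product on reduced words\<close>

text \<open>Write \<open>B\<close> for the subgroup on all vertices but \<open>v\<close> and \<open>C\<close> for the one on the link of \<open>v\<close>.
  The kernel of the retraction onto \<open>B\<close> is the free product of the conjugates of the vertex group of
  \<open>v\<close>, indexed by the left cosets of \<open>C\<close> in \<open>B\<close>; the graph product acts on its reduced words.\<close>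

locale graph_product_vertex = graph_product_groups +
  fixes v :: 'a
  assumes v: "v \<in> V"
begin

sublocale Gv: group "G v"
  by (rule groups[OF v])

abbreviation B :: "('a \<times> 'b) list set set" where
  "B \<equiv> gp_sub V E G (V - {v})"

abbreviation C :: "('a \<times> 'b) list set set" where
  "C \<equiv> gp_sub V E G (link v)"

text \<open>Going through the retraction onto \<open>B\<close> lets the whole graph product act on
  the cosets of \<open>C\<close> in \<open>B\<close>, with the vertex group of \<open>v\<close>
  acting trivially.\<close>

definition coset_act :: "('a \<times> 'b) list set \<Rightarrow> ('a \<times> 'b) list set set \<Rightarrow> ('a \<times> 'b) list set set" where
  "coset_act g i = retract (V - {v}) g <#\<^bsub>GP\<^esub> i"

text \<open>The retraction maps onto \<open>B\<close>, so this orbit consists of all left cosets of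
  \<open>C\<close> in \<open>B\<close>; see \<open>cosets_rep\<close>.\<close>

definition cosets :: "('a \<times> 'b) list set set set" where
  "cosets = (\<lambda>g. coset_act g C) ` carrier GP"

abbreviation words :: "(('a \<times> 'b) list set set \<times> 'b) list set" where
  "words \<equiv> {w. Gv.reduced cosets w}"

section \<open>The action on the cosets of \<open>C\<close>\<close>

lemma B_subgroup: "subgroup B GP"
  by (rule sub_subgroup) auto

lemma C_subgroup: "subgroup C GP"
  by (rule sub_subgroup[OF link_subset])

lemma B_closed: "b \<in> B \<Longrightarrow> b \<in> carrier GP"
  by (rule subgroup.mem_carrier[OF B_subgroup])

lemma C_closed: "c \<in> C \<Longrightarrow> c \<in> carrier GP"
  by (rule subgroup.mem_carrier[OF C_subgroup])

lemma B_inv: "b \<in> B \<Longrightarrow> inv\<^bsub>GP\<^esub> b \<in> B"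
  by (rule subgroup.m_inv_closed[OF B_subgroup])

lemma B_mult: "b \<in> B \<Longrightarrow> b' \<in> B \<Longrightarrow> b \<otimes>\<^bsub>GP\<^esub> b' \<in> B"
  by (rule subgroup.m_closed[OF B_subgroup])

lemma incl_in_B: "u \<in> V \<Longrightarrow> u \<noteq> v \<Longrightarrow> x \<in> carrier (G u) \<Longrightarrow> incl u x \<in> B"
  by (rule incl_in_sub) auto

lemma v_notin_link: "v \<notin> link v"
  using graph v by (simp add: link_def simplicial_graph_def)

lemma retract_B: "b \<in> B \<Longrightarrow> retract (V - {v}) b = b"
  by (rule retract_sub) auto

lemma retract_C: "c \<in> C \<Longrightarrow> retract (V - {v}) c = c"
  by (rule retract_sub[OF link_subset]) (use link_subset[of v] v_notin_link in auto)

lemma coset_act_mult: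
  assumes "g \<in> carrier GP" "h \<in> carrier GP" "i \<subseteq> carrier GP"
  shows "coset_act (g \<otimes>\<^bsub>GP\<^esub> h) i = coset_act g (coset_act h i)"
  using assms by (simp add: coset_act_def retract_mult retract_closed GP.lcos_m_assoc)

lemma cosets_closed: "i \<in> cosets \<Longrightarrow> i \<subseteq> carrier GP"
  using GP.l_coset_subset_G[OF subgroup.subset[OF C_subgroup] retract_closed]
  by (auto simp: cosets_def coset_act_def)

lemma coset_act_one: "i \<in> cosets \<Longrightarrow> coset_act \<one>\<^bsub>GP\<^esub> i = i"
  using cosets_closed[of i] by (simp add: coset_act_def retract_one GP.lcos_mult_one)

lemma coset_act_closed:
  assumes "g \<in> carrier GP" "i \<in> cosets"
  shows "coset_act g i \<in> cosets"
proof -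
  obtain h where h: "h \<in> carrier GP" "i = coset_act h C" using assms(2) by (auto simp: cosets_def)
  have "coset_act g i = coset_act (g \<otimes>\<^bsub>GP\<^esub> h) C"
    using coset_act_mult[OF assms(1) h(1) subgroup.subset[OF C_subgroup]] h(2) by simp
  then show ?thesis using assms(1) h(1) unfolding cosets_def by blast
qed

lemma coset_act_mult':
  assumes "g \<in> carrier GP" "h \<in> carrier GP" "i \<in> cosets"
  shows "coset_act (g \<otimes>\<^bsub>GP\<^esub> h) i = coset_act g (coset_act h i)"
  by (rule coset_act_mult[OF assms(1,2) cosets_closed[OF assms(3)]])

lemma coset_act_inv:
  assumes "g \<in> carrier GP" "i \<in> cosets"
  shows "coset_act (inv\<^bsub>GP\<^esub> g) (coset_act g i) = i" "coset_act g (coset_act (inv\<^bsub>GP\<^esub> g) i) = i"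
  using assms by (simp_all add: coset_act_mult'[symmetric] coset_act_one)

lemma coset_act_inj:
  assumes "g \<in> carrier GP"
  shows "inj_on (coset_act g) cosets"
  by (rule inj_on_inverseI[of _ "coset_act (inv\<^bsub>GP\<^esub> g)"]) (simp add: coset_act_inv assms)

lemma coset_act_incl_v:
  assumes "x \<in> carrier (G v)" "i \<in> cosets"
  shows "coset_act (incl v x) i = i"
  using coset_act_one[OF assms(2)] v assms(1) by (simp add: coset_act_def retract_one retract_incl)

lemma C_in_cosets: "C \<in> cosets"
proof -
  have "coset_act \<one>\<^bsub>GP\<^esub> C = C"
    using subgroup.subset[OF C_subgroup] by (simp add: coset_act_def retract_one GP.lcos_mult_one)
  then show ?thesis unfolding cosets_def by (metis GP.one_closed imageI)
qed

lemma coset_act_C: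
  assumes "c \<in> C"
  shows "coset_act c C = C"
  using assms retract_C[OF assms] GP.coset_join3[OF C_closed[OF assms] C_subgroup] by (simp add: coset_act_def)

lemma coset_act_B_fix:
  assumes "b \<in> B" "coset_act b C = C"
  shows "b \<in> C"
proof -
  have "b <#\<^bsub>GP\<^esub> C = C" using assms by (simp add: coset_act_def retract_B)
  moreover have "b \<in> b <#\<^bsub>GP\<^esub> C"
    using GP.lcos_self[OF B_closed[OF assms(1)] C_subgroup] .
  ultimately show ?thesis by simp
qed

lemma cosets_rep:
  assumes "i \<in> cosets"
  shows "\<exists>b\<in>B. coset_act b C = i"
proof -
  obtain g where g: "g \<in> carrier GP" "i = coset_act g C" using assms by (auto simp: cosets_def)
  have "retract (V - {v}) g \<in> B" using g by (intro retract_in_sub) auto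
  moreover have "coset_act (retract (V - {v}) g) C = i"
    using g by (simp add: coset_act_def retract_retract)
  ultimately show ?thesis by blast
qed

text \<open>Mirrors the semidirect product of the free product with \<open>B\<close>: the vertex
  group of \<open>v\<close> is the factor with index \<open>C\<close> and multiplies, while the
  other vertices conjugate, which permutes the indices.\<close>

definition letter_act :: "'a \<Rightarrow> 'b \<Rightarrow> (('a \<times> 'b) list set set \<times> 'b) list \<Rightarrow> (('a \<times> 'b) list set set \<times> 'b) list"
  where "letter_act u x w = (if u = v then Gv.lmul C x w else map (apfst (coset_act (incl u x))) w)"

section \<open>The action on reduced words\<close>

lemma map_coset_act_reduced:
  assumes "g \<in> carrier GP" "w \<in> words"
  shows "map (apfst (coset_act g)) w \<in> words"
  using Gv.reduced_map[OF _ coset_act_inj[OF assms(1)], of w cosets] assms coset_act_closed by auto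

lemma words_index:
  assumes "w \<in> words" "j \<in> fst ` set w"
  shows "j \<in> cosets"
  using assms by (auto simp: Gv.reduced_def)

lemma map_coset_act_cong:
  assumes "w \<in> words" "\<And>i. i \<in> cosets \<Longrightarrow> f i = g i"
  shows "map (apfst f) w = map (apfst g) w"
proof (rule map_cong[OF HOL.refl])
  fix a assume "a \<in> set w"
  then have "fst a \<in> cosets" using words_index[OF assms(1)] by blast
  then show "apfst f a = apfst g a" using assms(2) by (cases a) simp
qed

lemma map_coset_act_mult:
  assumes "g \<in> carrier GP" "h \<in> carrier GP" "w \<in> words"
  shows "map (apfst (coset_act (g \<otimes>\<^bsub>GP\<^esub> h))) w = map (apfst (coset_act g)) (map (apfst (coset_act h)) w)"
proof -
  have "map (apfst (coset_act (g \<otimes>\<^bsub>GP\<^esub> h))) w = map (apfst (coset_act g \<circ> coset_act h)) w"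
    by (rule map_coset_act_cong[OF assms(3)]) (simp add: coset_act_mult' assms)
  then show ?thesis by (simp add: apfst_compose comp_def)
qed

lemma map_coset_act_one:
  assumes "w \<in> words"
  shows "map (apfst (coset_act \<one>\<^bsub>GP\<^esub>)) w = w"
  using map_coset_act_cong[OF assms, of "coset_act \<one>\<^bsub>GP\<^esub>" id] by (simp add: coset_act_one apfst_id)

lemma map_coset_act_lmul:
  assumes "g \<in> carrier GP" "w \<in> words" "i \<in> cosets"
  shows "map (apfst (coset_act g)) (Gv.lmul i x w) = Gv.lmul (coset_act g i) x (map (apfst (coset_act g)) w)"
proof (rule Gv.lmul_map)
  fix j assume "j \<in> fst ` set w" "coset_act g i = coset_act g j"
  then show "i = j" using inj_onD[OF coset_act_inj[OF assms(1)]] words_index assms(2,3) by blast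
qed

lemma letter_act_closed:
  assumes "u \<in> V" "x \<in> carrier (G u)" "w \<in> words"
  shows "letter_act u x w \<in> words"
proof (cases "u = v")
  case True
  then show ?thesis using Gv.reduced_lmul[OF _ C_in_cosets] assms by (simp add: letter_act_def)
next
  case False
  then show ?thesis using map_coset_act_reduced[OF incl_closed[OF assms(1,2)] assms(3)]
    by (simp add: letter_act_def)
qed

lemma letter_act_mult:
  assumes "u \<in> V" "x \<in> carrier (G u)" "y \<in> carrier (G u)" "w \<in> words"
  shows "letter_act u (x \<otimes>\<^bsub>G u\<^esub> y) w = letter_act u x (letter_act u y w)"
proof (cases "u = v")
  case True
  then show ?thesis using assms Gv.lmul_mult[of cosets w x y C] by (simp add: letter_act_def)
next
  case False
  then show ?thesis using assms map_coset_act_mult[OF incl_closed[OF assms(1,2)] incl_closed[OF assms(1,3)] assms(4)]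
    by (simp add: letter_act_def incl_mult)
qed

lemma letter_act_one:
  assumes "u \<in> V" "w \<in> words"
  shows "letter_act u \<one>\<^bsub>G u\<^esub> w = w"
  using assms map_coset_act_one[OF assms(2)] by (auto simp: letter_act_def incl_one Gv.lmul_one)

text \<open>The only commutation relation that mixes multiplying and permuting letters. It holds
  because the vertex groups of the link fix the index \<open>C\<close>.\<close>

lemma letter_act_commute_link:
  assumes "u \<in> link v" "x \<in> carrier (G v)" "y \<in> carrier (G u)" "w \<in> words"
  shows "letter_act u y (letter_act v x w) = letter_act v x (letter_act u y w)"
proof -
  have "u \<noteq> v" and uV: "u \<in> V" using assms(1) v_notin_link link_subset by auto
  moreover have "coset_act (incl u y) C = C" using assms by (intro coset_act_C incl_in_sub)
  ultimately show ?thesis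
    using map_coset_act_lmul[OF incl_closed[OF uV assms(3)] assms(4) C_in_cosets, of x]
    by (simp add: letter_act_def)
qed

lemma letter_act_commute:
  assumes "u \<in> V" "u' \<in> V" "E u u'" "x \<in> carrier (G u)" "y \<in> carrier (G u')" "w \<in> words"
  shows "letter_act u x (letter_act u' y w) = letter_act u' y (letter_act u x w)"
proof -
  have sym: "E u' u" and irr: "u \<noteq> u'" using graph assms(1-3) by (auto simp: simplicial_graph_def)
  consider "u = v" | "u' = v" | "u \<noteq> v" "u' \<noteq> v" by blast
  then show ?thesis
  proof cases
    case 1
    then have "u' \<in> link v" using assms by (simp add: link_def)
    then show ?thesis using letter_act_commute_link[of u' x y w] assms 1 by simp
  next
    case 2
    then have "u \<in> link v" using assms sym by (simp add: link_def)
    then show ?thesis using letter_act_commute_link[of u y x w] assms 2 by simp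
  next
    case 3
    then show ?thesis
      using map_coset_act_mult[OF incl_closed[OF assms(1,4)] incl_closed[OF assms(2,5)] assms(6)]
        map_coset_act_mult[OF incl_closed[OF assms(2,5)] incl_closed[OF assms(1,4)] assms(6)]
        incl_commute[OF assms(1-5)]
      by (simp add: letter_act_def)
  qed
qed

text \<open>Maps are restricted to \<open>words\<close>, so that agreement on reduced words is
  equality of maps. Elsewhere \<open>lmul\<close> need not satisfy the laws of an action.\<close>

definition word_maps :: "((('a \<times> 'b) list set set \<times> 'b) list \<Rightarrow> (('a \<times> 'b) list set set \<times> 'b) list) monoid" where
  "word_maps = \<lparr>carrier = words \<rightarrow>\<^sub>E words, monoid.mult = compose words, one = (\<lambda>w\<in>words. w)\<rparr>"

lemma monoid_word_maps: "monoid word_maps"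
proof (rule monoidI)
  fix f g assume "f \<in> carrier word_maps" "g \<in> carrier word_maps"
  then show "f \<otimes>\<^bsub>word_maps\<^esub> g \<in> carrier word_maps"
    by (auto simp: word_maps_def compose_def PiE_iff)
next
  fix f g h assume "f \<in> carrier word_maps" "g \<in> carrier word_maps" "h \<in> carrier word_maps"
  then show "f \<otimes>\<^bsub>word_maps\<^esub> g \<otimes>\<^bsub>word_maps\<^esub> h = f \<otimes>\<^bsub>word_maps\<^esub> (g \<otimes>\<^bsub>word_maps\<^esub> h)"
    by (auto simp: word_maps_def compose_def PiE_iff restrict_def fun_eq_iff)
next
  fix f assume "f \<in> carrier word_maps"
  then show "\<one>\<^bsub>word_maps\<^esub> \<otimes>\<^bsub>word_maps\<^esub> f = f" "f \<otimes>\<^bsub>word_maps\<^esub> \<one>\<^bsub>word_maps\<^esub> = f"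
    by (auto simp: word_maps_def compose_def PiE_iff restrict_def extensional_def fun_eq_iff)
qed (auto simp: word_maps_def)

definition act :: "('a \<times> 'b) list set \<Rightarrow> (('a \<times> 'b) list set set \<times> 'b) list \<Rightarrow> (('a \<times> 'b) list set set \<times> 'b) list" where
  "act = (SOME f. f \<in> hom GP word_maps \<and> f \<one>\<^bsub>GP\<^esub> = \<one>\<^bsub>word_maps\<^esub> \<and>
     (\<forall>u\<in>V. \<forall>x\<in>carrier (G u). f (incl u x) = restrict (letter_act u x) words))"

lemma act_props:
  "act \<in> hom GP word_maps \<and> act \<one>\<^bsub>GP\<^esub> = \<one>\<^bsub>word_maps\<^esub> \<and>
     (\<forall>u\<in>V. \<forall>x\<in>carrier (G u). act (incl u x) = restrict (letter_act u x) words)"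
proof -
  have "\<exists>f. f \<in> hom GP word_maps \<and> f \<one>\<^bsub>GP\<^esub> = \<one>\<^bsub>word_maps\<^esub> \<and>
     (\<forall>u\<in>V. \<forall>x\<in>carrier (G u). f (incl u x) = restrict (letter_act u x) words)"
  proof (rule universal_property[OF monoid_word_maps], goal_cases)
    case (1 u x)
    then show ?case using letter_act_closed[of u x] by (auto simp: word_maps_def)
  next
    case (2 u x y)
    show ?case
    proof
      fix w
      show "restrict (letter_act u (x \<otimes>\<^bsub>G u\<^esub> y)) words w =
        (restrict (letter_act u x) words \<otimes>\<^bsub>word_maps\<^esub> restrict (letter_act u y) words) w"
        using letter_act_mult[OF 2, of w] letter_act_closed[OF 2(1,3), of w]
        by (simp add: word_maps_def compose_def)
    qed
  next
    case (3 u)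
    show ?case
    proof
      fix w
      show "restrict (letter_act u \<one>\<^bsub>G u\<^esub>) words w = \<one>\<^bsub>word_maps\<^esub> w"
        using letter_act_one[OF 3, of w] by (simp add: word_maps_def)
    qed
  next
    case (4 u u' x y)
    show ?case
    proof
      fix w
      show "(restrict (letter_act u x) words \<otimes>\<^bsub>word_maps\<^esub> restrict (letter_act u' y) words) w =
        (restrict (letter_act u' y) words \<otimes>\<^bsub>word_maps\<^esub> restrict (letter_act u x) words) w"
        using letter_act_commute[OF 4, of w] letter_act_closed[OF 4(1,4), of w] letter_act_closed[OF 4(2,5), of w]
        by (simp add: word_maps_def compose_def)
    qed
  qed
  from someI_ex[OF this] show ?thesis unfolding act_def .
qed

lemma act_closed:
  assumes "g \<in> carrier GP" "w \<in> words"
  shows "act g w \<in> words"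
proof -
  have "act g \<in> carrier word_maps" using act_props assms(1) unfolding hom_def by blast
  then show ?thesis using assms(2) by (auto simp: word_maps_def)
qed

lemma act_mult:
  assumes "g \<in> carrier GP" "h \<in> carrier GP" "w \<in> words"
  shows "act (g \<otimes>\<^bsub>GP\<^esub> h) w = act g (act h w)"
proof -
  have "act (g \<otimes>\<^bsub>GP\<^esub> h) = act g \<otimes>\<^bsub>word_maps\<^esub> act h"
    using act_props assms(1,2) unfolding hom_def by blast
  then show ?thesis using assms(3) by (simp add: word_maps_def compose_def)
qed

lemma act_one: "w \<in> words \<Longrightarrow> act \<one>\<^bsub>GP\<^esub> w = w"
  using act_props by (simp add: word_maps_def)

lemma act_incl:
  assumes "u \<in> V" "x \<in> carrier (G u)" "w \<in> words"
  shows "act (incl u x) w = letter_act u x w"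
  using act_props assms by simp

text \<open>The case of elements of \<open>B\<close>, where the retraction is the identity, phrased
  for all \<open>g\<close> so that \<open>GP_induct\<close> applies.\<close>

lemma act_retract:
  assumes "g \<in> carrier GP" "w \<in> words"
  shows "act (retract (V - {v}) g) w = map (apfst (coset_act g)) w"
  using assms
proof (induction arbitrary: w rule: GP_induct)
  case one
  then show ?case by (simp add: retract_one act_one map_coset_act_one)
next
  case (mult u x g)
  have cl: "incl u x \<in> carrier GP" by (rule incl_closed[OF mult(1,2)])
  show ?case
  proof (cases "u = v")
    case True
    have "map (apfst (coset_act (incl u x \<otimes>\<^bsub>GP\<^esub> g))) w = map (apfst (coset_act g)) w"
      by (rule map_coset_act_cong[OF mult.prems])
        (use True mult cl in \<open>simp add: coset_act_mult' coset_act_incl_v coset_act_closed\<close>)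
    then show ?thesis using True mult cl by (simp add: retract_mult retract_incl retract_closed)
  next
    case False
    have "act (retract (V - {v}) (incl u x \<otimes>\<^bsub>GP\<^esub> g)) w = act (incl u x) (act (retract (V - {v}) g) w)"
      using False mult cl by (simp add: retract_mult retract_incl retract_closed act_mult)
    also have "\<dots> = letter_act u x (map (apfst (coset_act g)) w)"
      using mult map_coset_act_reduced[OF mult(3) mult.prems] by (simp add: act_incl)
    also have "\<dots> = map (apfst (coset_act (incl u x \<otimes>\<^bsub>GP\<^esub> g))) w"
      using False map_coset_act_mult[OF cl mult(3) mult.prems] by (simp add: letter_act_def)
    finally show ?thesis .
  qed
qed

lemma act_B:
  assumes "b \<in> B" "w \<in> words"
  shows "act b w = map (apfst (coset_act b)) w"
  using act_retract[OF B_closed[OF assms(1)] assms(2)] retract_B[OF assms(1)] by simp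

lemma act_B_Nil: "b \<in> B \<Longrightarrow> act b [] = []"
  by (simp add: act_B Gv.reduced_Nil)

section \<open>The free product inside the graph product\<close>

definition rep :: "('a \<times> 'b) list set set \<Rightarrow> ('a \<times> 'b) list set" where
  "rep i = (SOME b. b \<in> B \<and> coset_act b C = i)"

definition letter_elt :: "('a \<times> 'b) list set set \<Rightarrow> 'b \<Rightarrow> ('a \<times> 'b) list set" where
  "letter_elt i x = rep i \<otimes>\<^bsub>GP\<^esub> incl v x \<otimes>\<^bsub>GP\<^esub> inv\<^bsub>GP\<^esub> rep i"

definition word_elt :: "(('a \<times> 'b) list set set \<times> 'b) list \<Rightarrow> ('a \<times> 'b) list set" where
  "word_elt q = foldr (\<lambda>(i, x) a. letter_elt i x \<otimes>\<^bsub>GP\<^esub> a) q \<one>\<^bsub>GP\<^esub>"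

lemma rep:
  assumes "i \<in> cosets"
  shows "rep i \<in> B" "coset_act (rep i) C = i"
proof -
  have "\<exists>b. b \<in> B \<and> coset_act b C = i" using cosets_rep[OF assms] by blast
  from someI_ex[OF this] show "rep i \<in> B" "coset_act (rep i) C = i" by (simp_all add: rep_def)
qed

text \<open>Two representatives of a coset differ by an element of \<open>C\<close>, which commutes
  with the vertex group of \<open>v\<close>. Hence the choice made in \<open>rep\<close> does not
  matter.\<close>

lemma letter_elt_eq:
  assumes b: "b \<in> B" and x: "x \<in> carrier (G v)"
  shows "letter_elt (coset_act b C) x = b \<otimes>\<^bsub>GP\<^esub> incl v x \<otimes>\<^bsub>GP\<^esub> inv\<^bsub>GP\<^esub> b"
proof -
  define r where "r = rep (coset_act b C)"
  define c where "c = inv\<^bsub>GP\<^esub> b \<otimes>\<^bsub>GP\<^esub> r"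
  have r: "r \<in> B" "coset_act r C = coset_act b C"
    using rep[OF coset_act_closed[OF B_closed[OF b] C_in_cosets]] by (simp_all add: r_def)
  have cB: "c \<in> B" using b r by (simp add: c_def B_inv B_mult)
  have "coset_act c C = C"
    using b r by (simp add: c_def coset_act_mult' B_closed C_in_cosets coset_act_inv)
  then have c: "c \<in> C" using cB coset_act_B_fix by blast
  have cl: "b \<in> carrier GP" "c \<in> carrier GP" "incl v x \<in> carrier GP"
    using b c x v by (simp_all add: B_closed C_closed incl_closed)
  have rbc: "r = b \<otimes>\<^bsub>GP\<^esub> c" using cl b r by (simp add: c_def GP.mult_inv_cancel B_closed)
  have "letter_elt (coset_act b C) x = b \<otimes>\<^bsub>GP\<^esub> (c \<otimes>\<^bsub>GP\<^esub> incl v x) \<otimes>\<^bsub>GP\<^esub> inv\<^bsub>GP\<^esub> c \<otimes>\<^bsub>GP\<^esub> inv\<^bsub>GP\<^esub> b"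
    unfolding letter_elt_def r_def[symmetric] rbc using cl by (simp add: GP.inv_mult_group GP.m_assoc)
  also have "c \<otimes>\<^bsub>GP\<^esub> incl v x = incl v x \<otimes>\<^bsub>GP\<^esub> c" by (rule sub_link_commute[OF v x c])
  also have "b \<otimes>\<^bsub>GP\<^esub> (incl v x \<otimes>\<^bsub>GP\<^esub> c) \<otimes>\<^bsub>GP\<^esub> inv\<^bsub>GP\<^esub> c \<otimes>\<^bsub>GP\<^esub> inv\<^bsub>GP\<^esub> b = b \<otimes>\<^bsub>GP\<^esub> incl v x \<otimes>\<^bsub>GP\<^esub> inv\<^bsub>GP\<^esub> b"
    using cl by (simp add: GP.m_assoc GP.mult_inv_cancel)
  finally show ?thesis .
qed

lemma letter_elt_closed:
  assumes "i \<in> cosets" "x \<in> carrier (G v)"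
  shows "letter_elt i x \<in> carrier GP"
  using assms rep[OF assms(1)] v by (simp add: letter_elt_def B_closed incl_closed)

lemma letter_elt_C:
  assumes "x \<in> carrier (G v)"
  shows "letter_elt C x = incl v x"
proof -
  have one: "\<one>\<^bsub>GP\<^esub> \<in> B" by (rule subgroup.one_closed[OF B_subgroup])
  show ?thesis using letter_elt_eq[OF one assms] coset_act_one[OF C_in_cosets] incl_closed[OF v assms] by simp
qed

lemma letter_elt_conj:
  assumes "b \<in> B" "i \<in> cosets" "x \<in> carrier (G v)"
  shows "letter_elt (coset_act b i) x = b \<otimes>\<^bsub>GP\<^esub> letter_elt i x \<otimes>\<^bsub>GP\<^esub> inv\<^bsub>GP\<^esub> b"
proof -
  have r: "rep i \<in> B" "coset_act (rep i) C = i" using rep assms(2) by blast+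
  have cl: "b \<in> carrier GP" "rep i \<in> carrier GP" "incl v x \<in> carrier GP"
    using assms r v by (simp_all add: B_closed incl_closed)
  have "coset_act b i = coset_act (b \<otimes>\<^bsub>GP\<^esub> rep i) C"
    using coset_act_mult'[OF cl(1,2) C_in_cosets] r by simp
  then have "letter_elt (coset_act b i) x = (b \<otimes>\<^bsub>GP\<^esub> rep i) \<otimes>\<^bsub>GP\<^esub> incl v x \<otimes>\<^bsub>GP\<^esub> inv\<^bsub>GP\<^esub> (b \<otimes>\<^bsub>GP\<^esub> rep i)"
    using letter_elt_eq[OF B_mult[OF assms(1) r(1)] assms(3)] by simp
  then show ?thesis using cl by (simp add: letter_elt_def GP.inv_mult_group GP.m_assoc)
qed

lemma letter_elt_mult:
  assumes "i \<in> cosets" "x \<in> carrier (G v)" "y \<in> carrier (G v)"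
  shows "letter_elt i (x \<otimes>\<^bsub>G v\<^esub> y) = letter_elt i x \<otimes>\<^bsub>GP\<^esub> letter_elt i y"
proof -
  have "rep i \<in> carrier GP" using rep assms(1) B_closed by blast
  then show ?thesis using assms v
    by (simp add: letter_elt_def incl_mult incl_closed GP.m_assoc GP.mult_inv_cancel)
qed

lemma letter_elt_one:
  assumes "i \<in> cosets"
  shows "letter_elt i \<one>\<^bsub>G v\<^esub> = \<one>\<^bsub>GP\<^esub>"
  using rep[OF assms] B_closed v by (simp add: letter_elt_def incl_one)

lemma letter_elt_inv:
  assumes "i \<in> cosets" "x \<in> carrier (G v)"
  shows "letter_elt i (inv\<^bsub>G v\<^esub> x) = inv\<^bsub>GP\<^esub> letter_elt i x"
proof -
  have "letter_elt i (inv\<^bsub>G v\<^esub> x) \<otimes>\<^bsub>GP\<^esub> letter_elt i x = \<one>\<^bsub>GP\<^esub>"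
    using assms letter_elt_mult[of i "inv\<^bsub>G v\<^esub> x" x] letter_elt_one by simp
  then show ?thesis using assms GP.inv_equality letter_elt_closed by simp
qed

text \<open>Conjugation by the representative carries the index \<open>C\<close> to
  \<open>i\<close>, so multiplication at \<open>C\<close> turns into multiplication at
  \<open>i\<close>.\<close>

lemma act_letter_elt:
  assumes "i \<in> cosets" "x \<in> carrier (G v)" "w \<in> words"
  shows "act (letter_elt i x) w = Gv.lmul i x w"
proof -
  define b where "b = rep i"
  have b: "b \<in> B" "coset_act b C = i" "inv\<^bsub>GP\<^esub> b \<in> B" using rep[OF assms(1)] B_inv by (simp_all add: b_def)
  have cl: "b \<in> carrier GP" "inv\<^bsub>GP\<^esub> b \<in> carrier GP" "incl v x \<in> carrier GP"
    using b assms v by (simp_all add: B_closed incl_closed)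
  define w' where "w' = map (apfst (coset_act (inv\<^bsub>GP\<^esub> b))) w"
  have w': "w' \<in> words" unfolding w'_def by (rule map_coset_act_reduced[OF cl(2) assms(3)])
  have lm: "Gv.lmul C x w' \<in> words" using Gv.reduced_lmul[OF _ C_in_cosets assms(2)] w' by simp
  have "act (letter_elt i x) w = act b (act (incl v x) (act (inv\<^bsub>GP\<^esub> b) w))"
    using cl assms(3) act_closed by (simp add: letter_elt_def b_def[symmetric] act_mult)
  also have "\<dots> = map (apfst (coset_act b)) (Gv.lmul C x w')"
    using b assms(2,3) v w' lm by (simp add: act_B w'_def[symmetric] act_incl letter_act_def)
  also have "\<dots> = Gv.lmul i x (map (apfst (coset_act b)) w')"
    using map_coset_act_lmul[OF cl(1) w' C_in_cosets, of x] b(2) by simp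
  also have "map (apfst (coset_act b)) w' = w"
    using map_coset_act_mult[OF cl(1,2) assms(3)] map_coset_act_one[OF assms(3)] cl(1) by (simp add: w'_def)
  finally show ?thesis .
qed

lemma word_elt_simps:
  "word_elt [] = \<one>\<^bsub>GP\<^esub>" "word_elt ((i, x) # q) = letter_elt i x \<otimes>\<^bsub>GP\<^esub> word_elt q"
  by (simp_all add: word_elt_def)

lemma word_elt_closed:
  assumes "q \<in> words"
  shows "word_elt q \<in> carrier GP"
  using assms
proof (induction q)
  case (Cons a q)
  then show ?case by (cases a) (simp add: word_elt_simps letter_elt_closed Gv.reduced_Cons)
qed (simp add: word_elt_simps)

lemma act_word_elt:
  assumes "q \<in> words" "w \<in> words"
  shows "act (word_elt q) w = Gv.wmul q w"
  using assms(1)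
proof (induction q)
  case Nil
  then show ?case using assms(2) by (simp add: word_elt_simps act_one Gv.wmul_simps)
next
  case (Cons a q)
  obtain i x where a: "a = (i, x)" by fastforce
  have q: "q \<in> words" "i \<in> cosets" "x \<in> carrier (G v)" using Cons.prems a by (simp_all add: Gv.reduced_Cons)
  have "Gv.wmul q w \<in> words" using Gv.reduced_wmul q assms(2) by simp
  then show ?case using Cons.IH[OF q(1)] a q assms(2)
    by (simp add: word_elt_simps act_mult letter_elt_closed word_elt_closed act_letter_elt Gv.wmul_simps)
qed

text \<open>Uniqueness of normal forms: the word can be recovered from its element, so
  \<open>word_elt\<close> is injective on reduced words.\<close>

lemma act_word_elt_Nil:
  assumes "q \<in> words"
  shows "act (word_elt q) [] = q"
  using act_word_elt[OF assms, of "[]"] Gv.wmul_append[of cosets q "[]"] assms by (simp add: Gv.reduced_Nil)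

lemma word_elt_lmul:
  assumes "i \<in> cosets" "x \<in> carrier (G v)" "w \<in> words"
  shows "word_elt (Gv.lmul i x w) = letter_elt i x \<otimes>\<^bsub>GP\<^esub> word_elt w"
proof (cases "x = \<one>\<^bsub>G v\<^esub>")
  case True
  then show ?thesis using assms by (simp add: Gv.lmul_one letter_elt_one word_elt_closed)
next
  case x: False
  show ?thesis
  proof (cases "Gv.starts i w")
    case False
    then show ?thesis using x by (simp add: Gv.lmul_not_starts word_elt_simps)
  next
    case True
    then obtain y w' where w: "w = (i, y) # w'" by (cases w) (auto simp: Gv.starts_def)
    have y: "y \<in> carrier (G v)" and w': "w' \<in> words" using assms(3) w by (simp_all add: Gv.reduced_Cons)
    have "letter_elt i x \<otimes>\<^bsub>GP\<^esub> word_elt w = letter_elt i (x \<otimes>\<^bsub>G v\<^esub> y) \<otimes>\<^bsub>GP\<^esub> word_elt w'"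
      using assms y w' by (simp add: w word_elt_simps letter_elt_mult GP.m_assoc letter_elt_closed word_elt_closed)
    then show ?thesis using x w assms(1) w'
      by (simp add: Gv.lmul_def word_elt_simps letter_elt_one word_elt_closed)
  qed
qed

lemma word_elt_wmul:
  assumes "q \<in> words" "w \<in> words"
  shows "word_elt (Gv.wmul q w) = word_elt q \<otimes>\<^bsub>GP\<^esub> word_elt w"
  using assms(1)
proof (induction q)
  case Nil
  then show ?case using assms(2) by (simp add: word_elt_simps Gv.wmul_simps word_elt_closed)
next
  case (Cons a q)
  obtain i x where a: "a = (i, x)" by fastforce
  have q: "q \<in> words" "i \<in> cosets" "x \<in> carrier (G v)" using Cons.prems a by (simp_all add: Gv.reduced_Cons)
  have "Gv.wmul q w \<in> words" using Gv.reduced_wmul q assms(2) by simp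
  then show ?case using Cons.IH[OF q(1)] a q assms(2)
    by (simp add: word_elt_simps Gv.wmul_simps word_elt_lmul GP.m_assoc letter_elt_closed word_elt_closed)
qed

lemma word_elt_append:
  assumes "p @ q \<in> words"
  shows "word_elt (p @ q) = word_elt p \<otimes>\<^bsub>GP\<^esub> word_elt q"
  using word_elt_wmul[of p q] Gv.wmul_append[of cosets p q] assms by (simp add: Gv.reduced_append)

lemma word_elt_winv:
  assumes "q \<in> words"
  shows "word_elt (Gv.winv q) = inv\<^bsub>GP\<^esub> word_elt q"
  using assms
proof (induction q)
  case Nil
  then show ?case by (simp add: word_elt_simps Gv.winv_def)
next
  case (Cons a q)
  obtain i x where a: "a = (i, x)" by fastforce
  have q: "q \<in> words" "i \<in> cosets" "x \<in> carrier (G v)" using Cons.prems a by (simp_all add: Gv.reduced_Cons)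
  have eq: "Gv.winv (a # q) = Gv.winv q @ [(i, inv\<^bsub>G v\<^esub> x)]" by (simp add: Gv.winv_def a)
  have "Gv.winv q @ [(i, inv\<^bsub>G v\<^esub> x)] \<in> words" using Gv.reduced_winv[of cosets "a # q"] Cons.prems eq by simp
  then have "word_elt (Gv.winv (a # q)) = word_elt (Gv.winv q) \<otimes>\<^bsub>GP\<^esub> word_elt [(i, inv\<^bsub>G v\<^esub> x)]"
    unfolding eq by (rule word_elt_append)
  then show ?case using Cons.IH[OF q(1)] q a
    by (simp add: word_elt_simps letter_elt_inv GP.inv_mult_group letter_elt_closed word_elt_closed)
qed

lemma word_elt_conj:
  assumes "b \<in> B" "q \<in> words"
  shows "word_elt (map (apfst (coset_act b)) q) = b \<otimes>\<^bsub>GP\<^esub> word_elt q \<otimes>\<^bsub>GP\<^esub> inv\<^bsub>GP\<^esub> b"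
  using assms(2)
proof (induction q)
  case Nil
  then show ?case using B_closed[OF assms(1)] by (simp add: word_elt_simps)
next
  case (Cons a q)
  obtain i x where a: "a = (i, x)" by fastforce
  have q: "q \<in> words" "i \<in> cosets" "x \<in> carrier (G v)" using Cons.prems a by (simp_all add: Gv.reduced_Cons)
  show ?case using Cons.IH[OF q(1)] q a assms(1) B_closed[OF assms(1)]
    by (simp add: word_elt_simps letter_elt_conj GP.m_assoc GP.mult_inv_cancel letter_elt_closed word_elt_closed)
qed

text \<open>The semidirect decomposition. Its free product component is the image of the empty word,
  because \<open>B\<close> fixes the empty word.\<close>

lemma word_elt_decomposition:
  assumes "g \<in> carrier GP"
  shows "\<exists>b\<in>B. g = word_elt (act g []) \<otimes>\<^bsub>GP\<^esub> b"
  using assms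
proof (induction rule: GP_induct)
  case one
  have "\<one>\<^bsub>GP\<^esub> \<in> B" by (rule subgroup.one_closed[OF B_subgroup])
  then show ?case by (intro bexI[of _ "\<one>\<^bsub>GP\<^esub>"]) (simp_all add: act_one Gv.reduced_Nil word_elt_simps)
next
  case (mult u x g)
  then obtain b where b: "b \<in> B" "g = word_elt (act g []) \<otimes>\<^bsub>GP\<^esub> b" by blast
  define q where "q = act g []"
  have q: "q \<in> words" using act_closed[OF mult(3)] by (simp add: q_def Gv.reduced_Nil)
  have g: "g = word_elt q \<otimes>\<^bsub>GP\<^esub> b" using b by (simp add: q_def)
  have cl: "incl u x \<in> carrier GP" "word_elt q \<in> carrier GP" "b \<in> carrier GP"
    using mult q b by (simp_all add: incl_closed word_elt_closed B_closed)
  have a: "act (incl u x \<otimes>\<^bsub>GP\<^esub> g) [] = letter_act u x q"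
    using mult q by (simp add: act_mult cl(1) Gv.reduced_Nil q_def[symmetric] act_incl)
  show ?case
  proof (cases "u = v")
    case True
    then have "word_elt (letter_act u x q) = incl u x \<otimes>\<^bsub>GP\<^esub> word_elt q"
      using mult q by (simp add: letter_act_def word_elt_lmul C_in_cosets letter_elt_C)
    then show ?thesis unfolding a using b(1) cl g by (intro bexI[of _ b]) (simp_all add: GP.m_assoc)
  next
    case False
    have uB: "incl u x \<in> B" using False mult by (simp add: incl_in_B)
    then have "word_elt (letter_act u x q) = incl u x \<otimes>\<^bsub>GP\<^esub> word_elt q \<otimes>\<^bsub>GP\<^esub> inv\<^bsub>GP\<^esub> incl u x"
      using False q by (simp add: letter_act_def word_elt_conj)
    then show ?thesis unfolding a using b(1) cl g uB
      by (intro bexI[of _ "incl u x \<otimes>\<^bsub>GP\<^esub> b"]) (simp_all add: GP.m_assoc GP.mult_inv_cancel B_mult)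
  qed
qed

end

section \<open>Normal subgroups of a graph product\<close>

context graph_product_vertex
begin

text \<open>A vertex not adjacent to \<open>v\<close> yields a second index besides
  \<open>C\<close>. Without one, words would have length at most one and there would be no
  hyperbolic elements.\<close>

lemma nontrivial_coset:
  assumes "u \<in> V" "u \<noteq> v" "\<not> E v u" "x \<in> carrier (G u)" "x \<noteq> \<one>\<^bsub>G u\<^esub>"
  shows "coset_act (incl u x) C \<in> cosets" "coset_act (incl u x) C \<noteq> C"
proof -
  show "coset_act (incl u x) C \<in> cosets" by (rule coset_act_closed[OF incl_closed[OF assms(1,4)] C_in_cosets])
  show "coset_act (incl u x) C \<noteq> C"
  proof
    assume "coset_act (incl u x) C = C"
    then have "incl u x \<in> C" using coset_act_B_fix incl_in_B assms by blast
    then have "u \<in> link v" using incl_in_sub_iff[OF link_subset] assms by blast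
    then show False using assms(3) by (simp add: link_def)
  qed
qed

text \<open>The commutator of \<open>n\<close> with an element \<open>letter_elt i y\<close> lies
  both in \<open>N\<close> and in the kernel of the retraction onto \<open>B\<close>. With
  \<open>n = q b\<close> it is \<open>q\<close>, a letter at index \<open>b i\<close>, the inverse
  of \<open>q\<close>, and a letter at \<open>i\<close>; the index \<open>i\<close> is chosen so
  that little cancels.\<close>

lemma normal_contains_word:
  assumes N: "N \<lhd> GP" and n: "n \<in> N" "n \<notin> C"
    and y: "y \<in> carrier (G v)" "y \<noteq> \<one>\<^bsub>G v\<^esub>" and j: "j \<in> cosets" "j \<noteq> C"
  shows "\<exists>q\<in>words. q \<noteq> [] \<and> word_elt q \<in> N"
proof -
  interpret N: normal N GP by (rule N)
  have nc: "n \<in> carrier GP" using n(1) by simp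
  define q where "q = act n []"
  obtain b where b: "b \<in> B" "n = word_elt q \<otimes>\<^bsub>GP\<^esub> b" using word_elt_decomposition[OF nc] by (auto simp: q_def)
  have q: "q \<in> words" using act_closed[OF nc] by (simp add: q_def Gv.reduced_Nil)
  have bc: "b \<in> carrier GP" "word_elt q \<in> carrier GP" using b q by (simp_all add: B_closed word_elt_closed)
  have comm: "word_elt q \<otimes>\<^bsub>GP\<^esub> letter_elt (coset_act b i) y \<otimes>\<^bsub>GP\<^esub> inv\<^bsub>GP\<^esub> word_elt q \<otimes>\<^bsub>GP\<^esub> letter_elt i (inv\<^bsub>G v\<^esub> y) \<in> N"
    if i: "i \<in> cosets" for i
  proof -
    have kc: "letter_elt i y \<in> carrier GP" using i y by (simp add: letter_elt_closed)
    have "letter_elt i y \<otimes>\<^bsub>GP\<^esub> inv\<^bsub>GP\<^esub> n \<otimes>\<^bsub>GP\<^esub> inv\<^bsub>GP\<^esub> letter_elt i y \<in> N"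
      by (rule N.inv_op_closed2[OF kc N.m_inv_closed[OF n(1)]])
    then have "n \<otimes>\<^bsub>GP\<^esub> (letter_elt i y \<otimes>\<^bsub>GP\<^esub> inv\<^bsub>GP\<^esub> n \<otimes>\<^bsub>GP\<^esub> inv\<^bsub>GP\<^esub> letter_elt i y) \<in> N"
      using n(1) N.m_closed by blast
    moreover have "n \<otimes>\<^bsub>GP\<^esub> (letter_elt i y \<otimes>\<^bsub>GP\<^esub> inv\<^bsub>GP\<^esub> n \<otimes>\<^bsub>GP\<^esub> inv\<^bsub>GP\<^esub> letter_elt i y) =
      word_elt q \<otimes>\<^bsub>GP\<^esub> letter_elt (coset_act b i) y \<otimes>\<^bsub>GP\<^esub> inv\<^bsub>GP\<^esub> word_elt q \<otimes>\<^bsub>GP\<^esub> letter_elt i (inv\<^bsub>G v\<^esub> y)"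
      unfolding b(2) using b(1) bc kc i y
      by (simp add: letter_elt_conj letter_elt_inv GP.inv_mult_group GP.m_assoc)
    ultimately show ?thesis by simp
  qed
  show ?thesis
  proof (cases "q = []")
    case True
    have "n = b" using b(2) bc True by (simp add: word_elt_simps)
    then have "coset_act b C \<noteq> C" using coset_act_B_fix b(1) n(2) by blast
    then have red: "[(coset_act b C, y), (C, inv\<^bsub>G v\<^esub> y)] \<in> words"
      using y C_in_cosets coset_act_closed[OF bc(1)]
      by (simp add: Gv.reduced_Cons Gv.reduced_Nil Gv.starts_def)
    moreover have "word_elt [(coset_act b C, y), (C, inv\<^bsub>G v\<^esub> y)] \<in> N"
      using comm[OF C_in_cosets] True y C_in_cosets coset_act_closed[OF bc(1)]
      by (simp add: word_elt_simps letter_elt_closed)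
    ultimately show ?thesis by blast
  next
    case False
    define l where "l = fst (last q)"
    have "l \<in> cosets" using Gv.reduced_last(1)[of cosets q] q False by (simp add: l_def)
    \<comment> \<open>No cancellation between \<open>q\<close> and the middle letter. Since
      \<open>b\<close> permutes the cosets, at most one of \<open>C\<close> and \<open>j\<close> is
      sent to \<open>l\<close>.\<close>
    have "\<exists>i\<in>cosets. coset_act b i \<noteq> l"
    proof (cases "coset_act b C = l")
      case True
      then have "coset_act b j \<noteq> l" using inj_onD[OF coset_act_inj[OF bc(1)], of j C] j C_in_cosets by auto
      then show ?thesis using j(1) by blast
    qed (use C_in_cosets in blast)
    then obtain i where i: "i \<in> cosets" "coset_act b i \<noteq> l" by blast
    define r where "r = q @ (coset_act b i, y) # Gv.winv q"
    have wq: "Gv.winv q \<in> words" "Gv.winv q \<noteq> []" "fst (hd (Gv.winv q)) = l"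
      using Gv.reduced_winv q Gv.winv_ends[OF False] by (simp_all add: l_def)
    have bi: "coset_act b i \<in> cosets" by (rule coset_act_closed[OF bc(1) i(1)])
    have tail: "(coset_act b i, y) # Gv.winv q \<in> words"
      using wq bi y i(2) by (simp add: Gv.reduced_Cons Gv.starts_def)
    then have r: "r \<in> words"
      using q i(2) False by (simp add: r_def Gv.reduced_append l_def)
    have s: "[(i, inv\<^bsub>G v\<^esub> y)] \<in> words"
      using i(1) y by (simp add: Gv.reduced_Cons Gv.reduced_Nil Gv.starts_def)
    have "word_elt (Gv.wmul r [(i, inv\<^bsub>G v\<^esub> y)]) \<in> N"
    proof -
      have "word_elt r = word_elt q \<otimes>\<^bsub>GP\<^esub> (letter_elt (coset_act b i) y \<otimes>\<^bsub>GP\<^esub> inv\<^bsub>GP\<^esub> word_elt q)"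
        using word_elt_append[of q "(coset_act b i, y) # Gv.winv q"] r q by (simp add: r_def word_elt_simps word_elt_winv)
      then show ?thesis
        using comm[OF i(1)] word_elt_wmul[OF r s] bc bi y i(1)
        by (simp add: word_elt_simps letter_elt_closed GP.m_assoc)
    qed
    moreover have "Gv.wmul r [(i, inv\<^bsub>G v\<^esub> y)] \<in> words"
      using Gv.reduced_wmul r s by simp
    moreover have "Gv.wmul r [(i, inv\<^bsub>G v\<^esub> y)] \<noteq> []"
    proof
      assume "Gv.wmul r [(i, inv\<^bsub>G v\<^esub> y)] = []"
      \<comment> \<open>A word of more than one letter cannot cancel completely against a single
        letter.\<close>
      moreover have "length r > 1" using False wq(2) by (simp add: r_def)
      ultimately show False
        using Gv.wmul_starts_or_shorter[of cosets r "[(i, inv\<^bsub>G v\<^esub> y)]"] r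
        by (cases r) (auto simp: Gv.starts_def)
    qed
    ultimately show ?thesis by blast
  qed
qed

text \<open>A word that begins and ends at \<open>C\<close> is not cyclically reduced, but its
  commutator with a letter at \<open>j\<close> begins at \<open>C\<close>, ends at \<open>j\<close>
  and is reduced as written.\<close>

lemma hyperbolic_word_of_both_ends:
  assumes N: "N \<lhd> GP" and q: "q \<in> words" "q \<noteq> []" "word_elt q \<in> N"
    and ends: "fst (hd q) = C" "fst (last q) = C"
    and y: "y \<in> carrier (G v)" "y \<noteq> \<one>\<^bsub>G v\<^esub>" and j: "j \<in> cosets" "j \<noteq> C"
  shows "\<exists>p\<in>words. p \<noteq> [] \<and> fst (hd p) = C \<and> fst (last p) \<noteq> C \<and> word_elt p \<in> N"
proof -
  interpret N: normal N GP by (rule N)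
  define p where "p = q @ (j, y) # Gv.winv q @ [(j, inv\<^bsub>G v\<^esub> y)]"
  have wq: "Gv.winv q \<in> words" "Gv.winv q \<noteq> []" "fst (hd (Gv.winv q)) = C" "fst (last (Gv.winv q)) = C"
    using Gv.reduced_winv q(1) Gv.winv_ends[OF q(2)] ends by simp_all
  have t: "Gv.winv q @ [(j, inv\<^bsub>G v\<^esub> y)] \<in> words"
    using wq j y by (simp add: Gv.reduced_append Gv.reduced_Cons Gv.reduced_Nil Gv.starts_def)
  then have t': "(j, y) # Gv.winv q @ [(j, inv\<^bsub>G v\<^esub> y)] \<in> words"
    using wq j y by (simp add: Gv.reduced_Cons Gv.starts_def)
  then have p: "p \<in> words" using q ends j by (simp add: p_def Gv.reduced_append)
  have k: "word_elt q \<in> carrier GP" "letter_elt j y \<in> carrier GP" using q(1) j y by (simp_all add: word_elt_closed letter_elt_closed)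
  have "word_elt p = word_elt q \<otimes>\<^bsub>GP\<^esub> (letter_elt j y \<otimes>\<^bsub>GP\<^esub> (inv\<^bsub>GP\<^esub> word_elt q \<otimes>\<^bsub>GP\<^esub> inv\<^bsub>GP\<^esub> letter_elt j y))"
    using word_elt_append[of q "(j, y) # Gv.winv q @ [(j, inv\<^bsub>G v\<^esub> y)]"] p word_elt_append[OF t] k q(1) j y
    by (simp add: p_def word_elt_simps word_elt_winv letter_elt_inv)
  moreover have "letter_elt j y \<otimes>\<^bsub>GP\<^esub> inv\<^bsub>GP\<^esub> word_elt q \<otimes>\<^bsub>GP\<^esub> inv\<^bsub>GP\<^esub> letter_elt j y \<in> N"
    by (rule N.inv_op_closed2[OF k(2) N.m_inv_closed[OF q(3)]])
  ultimately have "word_elt p \<in> N" using q(3) k N.m_closed by (simp add: GP.m_assoc)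
  moreover have "p \<noteq> []" "fst (hd p) = C" "fst (last p) \<noteq> C" using q(2) ends j by (simp_all add: p_def)
  ultimately show ?thesis using p by blast
qed

text \<open>If only the last index is \<open>C\<close>, pass to the inverse. If neither is,
  conjugating by a letter at \<open>C\<close> puts \<open>C\<close> at both ends, where the
  preceding commutator applies.\<close>

lemma hyperbolic_word:
  assumes N: "N \<lhd> GP" and q: "q \<in> words" "q \<noteq> []" "word_elt q \<in> N"
    and y: "y \<in> carrier (G v)" "y \<noteq> \<one>\<^bsub>G v\<^esub>" and j: "j \<in> cosets" "j \<noteq> C"
  shows "\<exists>p\<in>words. p \<noteq> [] \<and> fst (hd p) = C \<and> fst (last p) \<noteq> C \<and> word_elt p \<in> N"
proof -
  interpret N: normal N GP by (rule N)
  consider "fst (hd q) = C" "fst (last q) = C" | "fst (hd q) = C" "fst (last q) \<noteq> C"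
    | "fst (hd q) \<noteq> C" "fst (last q) = C" | "fst (hd q) \<noteq> C" "fst (last q) \<noteq> C" by blast
  then show ?thesis
  proof cases
    case 1
    then show ?thesis using hyperbolic_word_of_both_ends[OF N q _ _ y j] by blast
  next
    case 2
    then show ?thesis using q by blast
  next
    case 3
    then show ?thesis
      using Gv.winv_ends[OF q(2)] Gv.reduced_winv[of cosets q] word_elt_winv[OF q(1)] q N.m_inv_closed[OF q(3)]
      by (intro bexI[of _ "Gv.winv q"]) simp_all
  next
    case 4
    define q' where "q' = (C, y) # q @ [(C, inv\<^bsub>G v\<^esub> y)]"
    have t: "q @ [(C, inv\<^bsub>G v\<^esub> y)] \<in> words"
      using 4 q y C_in_cosets by (simp add: Gv.reduced_append Gv.reduced_Cons Gv.reduced_Nil Gv.starts_def)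
    then have q': "q' \<in> words" "q' \<noteq> []" "fst (hd q') = C" "fst (last q') = C"
      using 4 q y C_in_cosets by (simp_all add: q'_def Gv.reduced_Cons Gv.starts_def)
    have k: "word_elt q \<in> carrier GP" "letter_elt C y \<in> carrier GP"
      using q(1) y C_in_cosets by (simp_all add: word_elt_closed letter_elt_closed)
    have "word_elt q' = letter_elt C y \<otimes>\<^bsub>GP\<^esub> word_elt q \<otimes>\<^bsub>GP\<^esub> inv\<^bsub>GP\<^esub> letter_elt C y"
      using word_elt_append[OF t] k y C_in_cosets by (simp add: q'_def word_elt_simps letter_elt_inv GP.m_assoc)
    then have "word_elt q' \<in> N" using N.inv_op_closed2[OF k(2) q(3)] by simp
    then show ?thesis using hyperbolic_word_of_both_ends[OF N q'(1,2) _ q'(3,4) y j] by blast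
  qed
qed

text \<open>Normality turns right multiplication into left multiplication: the conjugate of a power
  of \<open>word_elt p\<close> by \<open>inv g\<close> is in \<open>N\<close>, and multiplying
  \<open>g\<close> by it puts that power in front of \<open>g\<close>.\<close>

lemma coset_meets_halfspace:
  assumes N: "N \<lhd> GP" and p: "p \<in> words" "p \<noteq> []" "fst (last p) \<noteq> fst (hd p)" "word_elt p \<in> N"
    and g: "g \<in> carrier GP"
  shows "\<exists>n\<in>N. Gv.starts (fst (hd p)) (act (g \<otimes>\<^bsub>GP\<^esub> n) [])"
proof -
  interpret N: normal N GP by (rule N)
  define w where "w = act g []"
  define q where "q = concat (replicate (Suc (length w)) p)"
  have w: "w \<in> words" using act_closed[OF g] by (simp add: w_def Gv.reduced_Nil)
  have pw: "concat (replicate m p) \<in> words" for m using Gv.reduced_pow[OF _ p(2,3)] p(1) by simp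
  have "word_elt (concat (replicate m p)) \<in> N" for m
  proof (induction m)
    case (Suc m)
    then show ?case using word_elt_append[of p "concat (replicate m p)"] pw[of "Suc m"] p(4) N.m_closed by simp
  qed (simp add: word_elt_simps)
  then have kN: "word_elt q \<in> N" by (simp only: q_def)
  have q: "q \<in> words" unfolding q_def by (rule pw)
  have k: "word_elt q \<in> carrier GP" using word_elt_closed[OF q] .
  have "act (g \<otimes>\<^bsub>GP\<^esub> (inv\<^bsub>GP\<^esub> g \<otimes>\<^bsub>GP\<^esub> word_elt q \<otimes>\<^bsub>GP\<^esub> g)) [] = act (word_elt q \<otimes>\<^bsub>GP\<^esub> g) []"
    using g k by (simp add: GP.m_assoc GP.mult_inv_cancel)
  also have "\<dots> = Gv.wmul q w" using g k act_word_elt[OF q w] by (simp add: act_mult Gv.reduced_Nil w_def)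
  finally have eq: "act (g \<otimes>\<^bsub>GP\<^esub> (inv\<^bsub>GP\<^esub> g \<otimes>\<^bsub>GP\<^esub> word_elt q \<otimes>\<^bsub>GP\<^esub> g)) [] = Gv.wmul q w" .
  have "Gv.starts (fst (hd p)) (Gv.wmul q w)"
    using Gv.wmul_pow_starts[OF _ p(2,3)] p(1) unfolding q_def by simp
  then show ?thesis using eq N.inv_op_closed1[OF g kN] by (metis (no_types))
qed

text \<open>With \<open>g = q b\<close>, the word of \<open>g\<close> is \<open>q\<close>, and that
  of \<open>g\<close> times the letter is \<open>q\<close> multiplied by a letter at index
  \<open>b C\<close>. By \<open>starts_boundary\<close> the wall is crossed only if \<open>b\<close>
  is in \<open>C\<close> and \<open>q\<close> is trivial or a cancelled letter, which commutes with
  \<open>b\<close>.\<close>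

lemma halfspace_boundary_letter:
  assumes g: "g \<in> carrier GP" and x: "x \<in> carrier (G v)"
    and change: "Gv.starts C (act g []) \<noteq> Gv.starts C (act (g \<otimes>\<^bsub>GP\<^esub> incl v x) [])"
  shows "\<exists>c\<in>C. \<exists>f\<in>{\<one>\<^bsub>GP\<^esub>, inv\<^bsub>GP\<^esub> incl v x}. g = c \<otimes>\<^bsub>GP\<^esub> f"
proof -
  define q where "q = act g []"
  obtain b where b: "b \<in> B" "g = word_elt q \<otimes>\<^bsub>GP\<^esub> b" using word_elt_decomposition[OF g] by (auto simp: q_def)
  have q: "q \<in> words" using act_closed[OF g] by (simp add: q_def Gv.reduced_Nil)
  have cl: "b \<in> carrier GP" "word_elt q \<in> carrier GP" "incl v x \<in> carrier GP"
    using b q x v by (simp_all add: B_closed word_elt_closed incl_closed)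
  have x1: "x \<noteq> \<one>\<^bsub>G v\<^esub>" using change g v by (auto simp: incl_one)
  have wx: "[(C, x)] \<in> words" using x x1 C_in_cosets by (simp add: Gv.reduced_Cons Gv.reduced_Nil Gv.starts_def)
  have wb: "[(coset_act b C, x)] \<in> words" using map_coset_act_reduced[OF cl(1) wx] by simp
  have "act (g \<otimes>\<^bsub>GP\<^esub> incl v x) [] = act g [(C, x)]"
    using g cl x v x1 by (simp add: act_mult Gv.reduced_Nil act_incl letter_act_def Gv.lmul_def)
  also have "\<dots> = act (word_elt q) [(coset_act b C, x)]"
    using b cl wx by (simp add: act_mult act_B)
  also have "\<dots> = Gv.wmul q [(coset_act b C, x)]" by (rule act_word_elt[OF q wb])
  finally have "coset_act b C = C \<and> (q = [] \<or> q = [(C, inv\<^bsub>G v\<^esub> x)])"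
    using Gv.starts_boundary[of cosets q x C "coset_act b C"] q x x1 change by (auto simp: q_def[symmetric])
  then have bC: "b \<in> C" and cases: "q = [] \<or> q = [(C, inv\<^bsub>G v\<^esub> x)]" using coset_act_B_fix b(1) by auto
  from cases show ?thesis
  proof
    assume "q = []"
    then have "g = b \<otimes>\<^bsub>GP\<^esub> \<one>\<^bsub>GP\<^esub>" using b(2) cl by (simp add: word_elt_simps)
    then show ?thesis using bC by blast
  next
    assume "q = [(C, inv\<^bsub>G v\<^esub> x)]"
    then have "g = incl v (inv\<^bsub>G v\<^esub> x) \<otimes>\<^bsub>GP\<^esub> b"
      using b(2) x v by (simp add: word_elt_simps letter_elt_C incl_closed)
    also have "\<dots> = b \<otimes>\<^bsub>GP\<^esub> incl v (inv\<^bsub>G v\<^esub> x)"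
      using sub_link_commute[OF v _ bC, of "inv\<^bsub>G v\<^esub> x"] x by simp
    finally have "g = b \<otimes>\<^bsub>GP\<^esub> inv\<^bsub>GP\<^esub> incl v x" using incl_inv[OF v x] by simp
    then show ?thesis using bC by blast
  qed
qed

text \<open>Walk from \<open>g\<close> to \<open>g s\<close> letter by letter. Only letters of
  \<open>v\<close> can cross the wall, since those of other vertices fix the empty word.\<close>

lemma halfspace_boundary:
  assumes "s \<in> carrier GP"
  shows "\<exists>F. finite F \<and> F \<subseteq> carrier GP \<and>
    (\<forall>g\<in>carrier GP. Gv.starts C (act g []) \<noteq> Gv.starts C (act (g \<otimes>\<^bsub>GP\<^esub> s) []) \<longrightarrow>
      (\<exists>c\<in>C. \<exists>f\<in>F. g = c \<otimes>\<^bsub>GP\<^esub> f))"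
  using assms
proof (induction rule: GP_induct)
  case one
  then show ?case by (intro exI[of _ "{}"]) simp
next
  case (mult u x s)
  obtain F where conj: "finite F \<and> F \<subseteq> carrier GP \<and>
    (\<forall>g\<in>carrier GP. Gv.starts C (act g []) \<noteq> Gv.starts C (act (g \<otimes>\<^bsub>GP\<^esub> s) []) \<longrightarrow>
      (\<exists>c\<in>C. \<exists>f\<in>F. g = c \<otimes>\<^bsub>GP\<^esub> f))"
    using mult.IH by (rule exE)
  have F: "finite F" "F \<subseteq> carrier GP" using conj by simp_all
  have F_bd: "\<exists>c\<in>C. \<exists>f\<in>F. g = c \<otimes>\<^bsub>GP\<^esub> f"
    if "g \<in> carrier GP" "Gv.starts C (act g []) \<noteq> Gv.starts C (act (g \<otimes>\<^bsub>GP\<^esub> s) [])" for g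
    using conj that by simp
  define i where "i = incl u x"
  have i: "i \<in> carrier GP" using mult by (simp add: i_def incl_closed)
  \<comment> \<open>The first two elements account for a crossing between \<open>g\<close> and
    \<open>g i\<close>. The translates of \<open>F\<close> account for a later one, where
    \<open>g i\<close> lies in some \<open>C f\<close>.\<close>
  define F' where "F' = {\<one>\<^bsub>GP\<^esub>, inv\<^bsub>GP\<^esub> i} \<union> (\<lambda>f. f \<otimes>\<^bsub>GP\<^esub> inv\<^bsub>GP\<^esub> i) ` F"
  have "\<exists>c\<in>C. \<exists>f\<in>F'. g = c \<otimes>\<^bsub>GP\<^esub> f"
    if g: "g \<in> carrier GP" and change: "Gv.starts C (act g []) \<noteq> Gv.starts C (act (g \<otimes>\<^bsub>GP\<^esub> (i \<otimes>\<^bsub>GP\<^esub> s)) [])" for g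
  proof (cases "Gv.starts C (act g []) = Gv.starts C (act (g \<otimes>\<^bsub>GP\<^esub> i) [])")
    case False
    have "u = v"
    proof (rule ccontr)
      assume "u \<noteq> v"
      then have "act i [] = []" using mult by (simp add: i_def act_B_Nil incl_in_B)
      then show False using False g i by (simp add: act_mult Gv.reduced_Nil)
    qed
    then have "\<exists>c\<in>C. \<exists>f\<in>{\<one>\<^bsub>GP\<^esub>, inv\<^bsub>GP\<^esub> i}. g = c \<otimes>\<^bsub>GP\<^esub> f"
      using halfspace_boundary_letter[OF g, of x] False mult(2) by (simp add: i_def)
    then show ?thesis unfolding F'_def by blast
  next
    case True
    then have "\<exists>c\<in>C. \<exists>f\<in>F. g \<otimes>\<^bsub>GP\<^esub> i = c \<otimes>\<^bsub>GP\<^esub> f"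
      using F_bd[of "g \<otimes>\<^bsub>GP\<^esub> i"] change g i mult(3) by (simp add: GP.m_assoc)
    then obtain c f where cf: "c \<in> C" "f \<in> F" "g \<otimes>\<^bsub>GP\<^esub> i = c \<otimes>\<^bsub>GP\<^esub> f" by blast
    have cl: "c \<in> carrier GP" "f \<in> carrier GP" using cf F(2) C_closed by auto
    have "g = g \<otimes>\<^bsub>GP\<^esub> i \<otimes>\<^bsub>GP\<^esub> inv\<^bsub>GP\<^esub> i" using g i by (simp add: GP.m_assoc)
    also have "\<dots> = c \<otimes>\<^bsub>GP\<^esub> (f \<otimes>\<^bsub>GP\<^esub> inv\<^bsub>GP\<^esub> i)" unfolding cf(3) using cl i by (simp add: GP.m_assoc)
    finally show ?thesis using cf unfolding F'_def by blast
  qed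
  moreover have "finite F'" "F' \<subseteq> carrier GP" using F i by (auto simp: F'_def)
  ultimately show ?case unfolding i_def by blast
qed

text \<open>Every coset \<open>gN\<close> meets both sides of the wall separating the words that start with the coset
  \<open>C\<close> from the others, hence it crosses the boundary of this half-space along some generator of \<open>N\<close>.\<close>

theorem link_finite_index:
  assumes N: "N \<lhd> GP" and fg: "finitely_generated_subgroup GP N" and nC: "\<not> N \<subseteq> C"
    and y: "y \<in> carrier (G v)" "y \<noteq> \<one>\<^bsub>G v\<^esub>" and j: "j \<in> cosets" "j \<noteq> C"
  shows "\<exists>F. finite F \<and> F \<subseteq> carrier GP \<and>
    (\<forall>g\<in>carrier GP. \<exists>c\<in>C. \<exists>f\<in>F. \<exists>n\<in>N. g = c \<otimes>\<^bsub>GP\<^esub> f \<otimes>\<^bsub>GP\<^esub> n)"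
proof -
  interpret N: normal N GP by (rule N)
  obtain S where S: "finite S" "S \<subseteq> carrier GP" "generate GP S = N"
    using fg by (auto simp: finitely_generated_subgroup_def)
  define half where "half g = Gv.starts C (act g [])" for g
  have "\<forall>s\<in>S. \<exists>F. finite F \<and> F \<subseteq> carrier GP \<and>
      (\<forall>g\<in>carrier GP. half g \<noteq> half (g \<otimes>\<^bsub>GP\<^esub> s) \<longrightarrow> (\<exists>c\<in>C. \<exists>f\<in>F. g = c \<otimes>\<^bsub>GP\<^esub> f))"
    using halfspace_boundary[folded half_def] S(2) by (intro ballI) (simp add: subset_iff)
  from bchoice[OF this] obtain \<F> where \<F>: "\<forall>s\<in>S. finite (\<F> s) \<and> \<F> s \<subseteq> carrier GP \<and>
      (\<forall>g\<in>carrier GP. half g \<noteq> half (g \<otimes>\<^bsub>GP\<^esub> s) \<longrightarrow> (\<exists>c\<in>C. \<exists>f\<in>\<F> s. g = c \<otimes>\<^bsub>GP\<^esub> f))"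
    by (rule exE)
  define F where "F = (\<Union>s\<in>S. \<F> s)"
  have F: "finite F" using S(1) \<F> by (simp add: F_def)
  have Fc: "F \<subseteq> carrier GP" unfolding F_def by (rule UN_least) (use \<F> in simp)
  have bd: "\<exists>c\<in>C. \<exists>f\<in>F. g = c \<otimes>\<^bsub>GP\<^esub> f"
    if s: "s \<in> S" and g: "g \<in> carrier GP" "half g \<noteq> half (g \<otimes>\<^bsub>GP\<^esub> s)" for s g
  proof -
    have "\<forall>g\<in>carrier GP. half g \<noteq> half (g \<otimes>\<^bsub>GP\<^esub> s) \<longrightarrow> (\<exists>c\<in>C. \<exists>f\<in>\<F> s. g = c \<otimes>\<^bsub>GP\<^esub> f)"
      using bspec[OF \<F> s] by (elim conjE)
    from mp[OF bspec[OF this g(1)] g(2)] show ?thesis using s unfolding F_def by blast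
  qed
  obtain n0 where n0: "n0 \<in> N" "n0 \<notin> C" using nC by blast
  obtain q where q: "q \<in> words" "q \<noteq> []" "word_elt q \<in> N" using normal_contains_word[OF N n0 y j] by blast
  obtain p where p: "p \<in> words" "p \<noteq> []" "fst (hd p) = C" "fst (last p) \<noteq> C" "word_elt p \<in> N"
    using hyperbolic_word[OF N q y j] by blast
  have "\<exists>c\<in>C. \<exists>f\<in>F. \<exists>n\<in>N. g = c \<otimes>\<^bsub>GP\<^esub> f \<otimes>\<^bsub>GP\<^esub> n" if g: "g \<in> carrier GP" for g
  proof (rule ccontr)
    assume no: "\<not> ?thesis"
    \<comment> \<open>For a counterexample \<open>g\<close> the whole coset \<open>gN\<close> stays
      off the boundary, so \<open>half\<close> cannot change along it.\<close>
    have avoid: "\<not> (\<exists>c\<in>C. \<exists>f\<in>F. g \<otimes>\<^bsub>GP\<^esub> n = c \<otimes>\<^bsub>GP\<^esub> f)" if n: "n \<in> N" for n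
    proof
      assume "\<exists>c\<in>C. \<exists>f\<in>F. g \<otimes>\<^bsub>GP\<^esub> n = c \<otimes>\<^bsub>GP\<^esub> f"
      then obtain c f where cf: "c \<in> C" "f \<in> F" "g \<otimes>\<^bsub>GP\<^esub> n = c \<otimes>\<^bsub>GP\<^esub> f" by blast
      have "g = g \<otimes>\<^bsub>GP\<^esub> n \<otimes>\<^bsub>GP\<^esub> inv\<^bsub>GP\<^esub> n" using g n by (simp add: GP.m_assoc)
      then have "g = c \<otimes>\<^bsub>GP\<^esub> f \<otimes>\<^bsub>GP\<^esub> inv\<^bsub>GP\<^esub> n" unfolding cf(3) .
      then show False using no cf N.m_inv_closed[OF n] by blast
    qed
    have step: "half (g \<otimes>\<^bsub>GP\<^esub> m) = half (g \<otimes>\<^bsub>GP\<^esub> m \<otimes>\<^bsub>GP\<^esub> n)" if "n \<in> generate GP S" "m \<in> N" for n m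
      using that
    proof (induction arbitrary: m rule: generate.induct)
      case one
      then show ?case using g by simp
    next
      case (incl s)
      then show ?case using bd[OF incl(1), of "g \<otimes>\<^bsub>GP\<^esub> m"] avoid[OF incl(2)] g by auto
    next
      \<comment> \<open>The step is taken in reverse: the generator \<open>s\<close> leads from
        \<open>m inv s\<close> to \<open>m\<close>, so the boundary is tested at the former.\<close>
      case (inv s)
      have s: "s \<in> carrier GP" "s \<in> N" using inv(1) S(2,3) generate.incl[OF inv(1), of GP] by auto
      have m': "m \<otimes>\<^bsub>GP\<^esub> inv\<^bsub>GP\<^esub> s \<in> N" using s(2) inv(2) N.m_closed N.m_inv_closed by blast
      have "half (g \<otimes>\<^bsub>GP\<^esub> (m \<otimes>\<^bsub>GP\<^esub> inv\<^bsub>GP\<^esub> s)) = half (g \<otimes>\<^bsub>GP\<^esub> (m \<otimes>\<^bsub>GP\<^esub> inv\<^bsub>GP\<^esub> s) \<otimes>\<^bsub>GP\<^esub> s)"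
        using bd[OF inv(1), of "g \<otimes>\<^bsub>GP\<^esub> (m \<otimes>\<^bsub>GP\<^esub> inv\<^bsub>GP\<^esub> s)"] avoid[OF m'] g s inv(2) by auto
      then show ?case using g s inv(2) by (simp add: GP.m_assoc)
    next
      case (eng h1 h2)
      have h: "h1 \<in> N" "h2 \<in> N" using eng S(3) by auto
      have "half (g \<otimes>\<^bsub>GP\<^esub> m) = half (g \<otimes>\<^bsub>GP\<^esub> m \<otimes>\<^bsub>GP\<^esub> h1)" by (rule eng.IH(1)[OF eng.prems])
      also have "\<dots> = half (g \<otimes>\<^bsub>GP\<^esub> (m \<otimes>\<^bsub>GP\<^esub> h1))" using g h eng.prems by (simp add: GP.m_assoc)
      also have "\<dots> = half (g \<otimes>\<^bsub>GP\<^esub> (m \<otimes>\<^bsub>GP\<^esub> h1) \<otimes>\<^bsub>GP\<^esub> h2)"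
        by (rule eng.IH(2)[OF N.m_closed[OF eng.prems h(1)]])
      finally show ?case using g h eng.prems by (simp add: GP.m_assoc)
    qed
    then have const: "half (g \<otimes>\<^bsub>GP\<^esub> n) = half g" if "n \<in> N" for n
      using step[of n "\<one>\<^bsub>GP\<^esub>"] that S(3) g N.one_closed by simp
    obtain n1 where n1: "n1 \<in> N" "Gv.starts C (act (g \<otimes>\<^bsub>GP\<^esub> n1) [])"
      using coset_meets_halfspace[OF N p(1,2) _ p(5) g] p(3,4) by auto
    \<comment> \<open>The inverse word begins with the last index of \<open>p\<close>, which is not
      \<open>C\<close>, and so leads to the other side of the wall.\<close>
    have wp: "Gv.winv p \<in> words" "word_elt (Gv.winv p) \<in> N"
      using Gv.reduced_winv p(1) word_elt_winv[OF p(1)] N.m_inv_closed[OF p(5)] by simp_all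
    have we: "fst (last (Gv.winv p)) \<noteq> fst (hd (Gv.winv p))"
      using Gv.winv_ends[OF p(2)] p(3,4) by simp
    obtain n2 where n2: "n2 \<in> N" "Gv.starts (fst (hd (Gv.winv p))) (act (g \<otimes>\<^bsub>GP\<^esub> n2) [])"
      using coset_meets_halfspace[OF N wp(1) Gv.winv_ends(1)[OF p(2)] we wp(2) g] by blast
    have "\<not> half (g \<otimes>\<^bsub>GP\<^esub> n2)"
      using n2(2) Gv.winv_ends(2)[OF p(2)] p(4) by (auto simp: half_def Gv.starts_def)
    moreover have "half (g \<otimes>\<^bsub>GP\<^esub> n1)" using n1(2) by (simp add: half_def)
    ultimately show False using const n1(1) n2(1) by simp
  qed
  then show ?thesis using F Fc by (intro exI[of _ F] conjI ballI)
qed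

text \<open>Otherwise \<open>N\<close> contains an element whose reduced word starts at
  \<open>C\<close>. Conjugation by \<open>incl u x\<close> moves this first index to another coset,
  yet fixes the element, contrary to the uniqueness of reduced words.\<close>

lemma subset_link_of_centralizing:
  assumes N: "N \<lhd> GP" and u: "u \<in> V" "u \<noteq> v" "\<not> E v u" "x \<in> carrier (G u)" "x \<noteq> \<one>\<^bsub>G u\<^esub>"
    and y: "y \<in> carrier (G v)" "y \<noteq> \<one>\<^bsub>G v\<^esub>"
    and comm: "\<And>n. n \<in> N \<Longrightarrow> n \<otimes>\<^bsub>GP\<^esub> incl u x = incl u x \<otimes>\<^bsub>GP\<^esub> n"
  shows "N \<subseteq> C"
proof (rule ccontr)
  assume "\<not> ?thesis"
  then obtain n0 where n0: "n0 \<in> N" "n0 \<notin> C" by blast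
  note j = nontrivial_coset[OF u]
  obtain q where q: "q \<in> words" "q \<noteq> []" "word_elt q \<in> N" using normal_contains_word[OF N n0 y j] by blast
  obtain p where p: "p \<in> words" "p \<noteq> []" "fst (hd p) = C" "word_elt p \<in> N"
    using hyperbolic_word[OF N q y j] by blast
  have cl: "incl u x \<in> carrier GP" "word_elt p \<in> carrier GP" using u p by (simp_all add: incl_closed word_elt_closed)
  have "word_elt (map (apfst (coset_act (incl u x))) p) = incl u x \<otimes>\<^bsub>GP\<^esub> word_elt p \<otimes>\<^bsub>GP\<^esub> inv\<^bsub>GP\<^esub> incl u x"
    using incl_in_B u p(1) by (intro word_elt_conj) simp_all
  also have "\<dots> = word_elt p"
    using cl unfolding comm[OF p(4), symmetric] by (simp add: GP.m_assoc)
  finally have "map (apfst (coset_act (incl u x))) p = p"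
    using act_word_elt_Nil[OF map_coset_act_reduced[OF cl(1) p(1)]] act_word_elt_Nil[OF p(1)] by simp
  then have "fst (hd (map (apfst (coset_act (incl u x))) p)) = fst (hd p)" by simp
  then have "coset_act (incl u x) C = C" using p(2,3) by (simp add: hd_map)
  then show False using j(2) by simp
qed

end

section \<open>The quotient of a graph product by a full normal subgroup\<close>

text \<open>Here \<open>C\<close> is a mere set that commutes with \<open>S\<close> modulo
  \<open>N\<close> only. The case of a central vertex needs this generality, since it multiplies the
  link subgroup by lifts of central elements of a quotient.\<close>

lemma (in group) centralizer_Mod_finite_index:
  assumes N: "N \<lhd> G" and F: "finite F" "F \<subseteq> carrier G" and C: "C \<subseteq> carrier G" and S: "S \<subseteq> carrier G"
    and decomp: "\<And>g. g \<in> carrier G \<Longrightarrow> \<exists>c\<in>C. \<exists>f\<in>F. \<exists>n\<in>N. g = c \<otimes> f \<otimes> n"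
    and comm: "\<And>c s. c \<in> C \<Longrightarrow> s \<in> S \<Longrightarrow> N #> (c \<otimes> s) = N #> (s \<otimes> c)"
  shows "finite (rcosets\<^bsub>G Mod N\<^esub> (group.centralizer (G Mod N) ((\<lambda>s. N #> s) ` S)))"
proof -
  interpret N: normal N G by (rule N)
  interpret Q: group "G Mod N" by (rule N.factorgroup_is_group)
  have cl: "N #> g \<in> carrier (G Mod N)" if "g \<in> carrier G" for g
    using that by (auto simp: FactGroup_def RCOSETS_def)
  have mult: "(N #> g) \<otimes>\<^bsub>G Mod N\<^esub> (N #> h) = N #> (g \<otimes> h)" if "g \<in> carrier G" "h \<in> carrier G" for g h
    using that by (simp add: FactGroup_def N.rcos_sum)
  have SQ: "(\<lambda>s. N #> s) ` S \<subseteq> carrier (G Mod N)" using S cl by auto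
  have cent: "N #> c \<in> Q.centralizer ((\<lambda>s. N #> s) ` S)" if c: "c \<in> C" for c
  proof (rule Q.centralizerI)
    have cc: "c \<in> carrier G" using c C by blast
    then show "N #> c \<in> carrier (G Mod N)" by (rule cl)
    fix t assume "t \<in> (\<lambda>s. N #> s) ` S"
    then obtain s where s: "s \<in> S" "t = N #> s" by blast
    have sc: "s \<in> carrier G" using s(1) S by blast
    show "(N #> c) \<otimes>\<^bsub>G Mod N\<^esub> t = t \<otimes>\<^bsub>G Mod N\<^esub> (N #> c)"
      unfolding s(2) mult[OF cc sc] mult[OF sc cc] by (rule comm[OF c s(1)])
  qed
  show ?thesis
  proof (rule Q.finite_rcosetsI[OF Q.centralizer_subgroup[OF SQ], of "(\<lambda>f. N #> f) ` F"])
    show "finite ((\<lambda>f. N #> f) ` F)" using F(1) by simp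
    show "(\<lambda>f. N #> f) ` F \<subseteq> carrier (G Mod N)" using F(2) cl by auto
    fix R assume "R \<in> carrier (G Mod N)"
    then obtain g where g: "g \<in> carrier G" "R = N #> g" by (auto simp: FactGroup_def RCOSETS_def)
    obtain c f n where cfn: "c \<in> C" "f \<in> F" "n \<in> N" "g = c \<otimes> f \<otimes> n" using decomp[OF g(1)] by blast
    have c: "c \<in> carrier G" "f \<in> carrier G" "n \<in> carrier G" using cfn C F by auto
    have cf: "c \<otimes> f \<in> carrier G" using c by simp
    have one: "N #> n = \<one>\<^bsub>G Mod N\<^esub>" using cfn(3) by (simp add: N.rcos_const[OF is_group])
    have "R = (N #> (c \<otimes> f)) \<otimes>\<^bsub>G Mod N\<^esub> (N #> n)"
      unfolding g(2) cfn(4) by (rule mult[OF cf c(3), symmetric])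
    then have "R = N #> (c \<otimes> f)" unfolding one Q.r_one[OF cl[OF cf]] .
    then have "R = (N #> c) \<otimes>\<^bsub>G Mod N\<^esub> (N #> f)" unfolding mult[OF c(1,2)] .
    then show "\<exists>a\<in>Q.centralizer ((\<lambda>s. N #> s) ` S). \<exists>f\<in>(\<lambda>f. N #> f) ` F. R = a \<otimes>\<^bsub>G Mod N\<^esub> f"
      using cent[OF cfn(1)] cfn(2) by (intro bexI[of _ "N #> c"] bexI[of _ "N #> f"]) auto
  qed
qed

text \<open>Lifts the finite index of the center of the quotient to factorizations in
  \<open>G\<close> itself, which \<open>incl v\<close> can then carry into the graph
  product.\<close>

lemma (in group) central_Mod_decomposition:
  assumes M: "M \<lhd> G" and "abelian_by_finite (G Mod M)" "finite_by_abelian (G Mod M)"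
  shows "\<exists>F. finite F \<and> F \<subseteq> carrier G \<and> (\<forall>x\<in>carrier G. \<exists>z\<in>carrier G. \<exists>f\<in>F. x = z \<otimes> f \<and>
    (\<forall>y\<in>carrier G. M #> (z \<otimes> y) = M #> (y \<otimes> z)))"
proof -
  interpret M: normal M G by (rule M)
  interpret Q: group "G Mod M" by (rule M.factorgroup_is_group)
  let ?Z = "Q.centralizer (carrier (G Mod M))"
  have cl: "M #> g \<in> carrier (G Mod M)" if "g \<in> carrier G" for g
    using that by (auto simp: FactGroup_def RCOSETS_def)
  have mult: "(M #> g) \<otimes>\<^bsub>G Mod M\<^esub> (M #> h) = M #> (g \<otimes> h)" if "g \<in> carrier G" "h \<in> carrier G" for g h
    using that by (simp add: FactGroup_def M.rcos_sum)
  have carr: "carrier (G Mod M) = (\<lambda>g. M #> g) ` carrier G" by (auto simp: FactGroup_def RCOSETS_def)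
  have subZ: "subgroup ?Z (G Mod M)" by (rule Q.centralizer_subgroup[OF order.refl])
  have "finite (rcosets\<^bsub>G Mod M\<^esub> ?Z)"
    by (rule Q.finite_rcosets_center_of_abelian_by_finite[OF assms(2,3)])
  then obtain F0 where F0: "finite F0" "F0 \<subseteq> carrier (G Mod M)"
    "\<And>g. g \<in> carrier (G Mod M) \<Longrightarrow> \<exists>a\<in>?Z. \<exists>f\<in>F0. g = a \<otimes>\<^bsub>G Mod M\<^esub> f"
    using Q.finite_rcosets_obtain[OF subZ] by blast
  obtain F where F: "F \<subseteq> carrier G" "finite F" "F0 = (\<lambda>g. M #> g) ` F"
    using finite_subset_image[OF F0(1), of "\<lambda>g. M #> g" "carrier G"] F0(2) carr by auto
  have "\<exists>z\<in>carrier G. \<exists>f\<in>F. x = z \<otimes> f \<and> (\<forall>y\<in>carrier G. M #> (z \<otimes> y) = M #> (y \<otimes> z))"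
    if x: "x \<in> carrier G" for x
  proof -
    obtain a f0 where af0: "a \<in> ?Z" "f0 \<in> F0" "M #> x = a \<otimes>\<^bsub>G Mod M\<^esub> f0"
      using F0(3)[OF cl[OF x]] by blast
    obtain f where f: "f \<in> F" "f0 = M #> f" using af0(2) F(3) by blast
    have fc: "f \<in> carrier G" using f F(1) by blast
    have "a \<in> carrier (G Mod M)" by (rule Q.centralizerD(1)[OF af0(1)])
    then obtain z0 where z0: "z0 \<in> carrier G" "a = M #> z0" using carr by blast
    have eq: "M #> x = M #> (z0 \<otimes> f)" using af0(3) f(2) z0 mult fc by simp
    have "x \<in> M #> (z0 \<otimes> f)" using rcos_self[OF x M.subgroup_axioms] eq by simp
    then obtain m where m: "m \<in> M" "x = m \<otimes> (z0 \<otimes> f)" by (auto simp: r_coset_def)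
    have mc: "m \<in> carrier G" using m(1) by simp
    \<comment> \<open>The factor \<open>m\<close> from \<open>M\<close> is absorbed into the lift,
      so that \<open>x = z f\<close> holds exactly and not just modulo \<open>M\<close>.\<close>
    define z where "z = m \<otimes> z0"
    have z: "z \<in> carrier G" "x = z \<otimes> f" using mc z0 m(2) fc by (simp_all add: z_def m_assoc)
    have "M #> m = M" using m(1) by (simp add: M.rcos_const[OF is_group])
    then have za: "M #> z = a"
      using coset_mult_assoc[OF M.subset mc z0(1)] by (simp add: z_def z0(2))
    have "M #> (z \<otimes> y) = M #> (y \<otimes> z)" if y: "y \<in> carrier G" for y
      using Q.centralizerD(2)[OF af0(1) cl[OF y]]
      unfolding za[symmetric] mult[OF z(1) y] mult[OF y z(1)] .
    then show ?thesis using z f(1) by blast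
  qed
  then show ?thesis using F(1,2) by (intro exI[of _ F] conjI ballI)
qed

context graph_product_groups
begin

text \<open>If \<open>N\<close> lies in the subgroup of the link of \<open>a\<close>, it centralizes
  the vertex group of \<open>a\<close>; by \<open>subset_link_of_centralizing\<close> it then lies
  in that of the link of every vertex not adjacent to \<open>a\<close>.\<close>

lemma full_not_in_link:
  assumes nontriv: "\<And>v. v \<in> V \<Longrightarrow> carrier (G v) \<noteq> {\<one>\<^bsub>G v\<^esub>}"
    and N: "N \<lhd> GP" and D: "D \<subseteq> V" "\<not> is_join E D" "N \<inter> gp_sub V E G D \<noteq> {\<one>\<^bsub>GP\<^esub>}"
    and v: "v \<in> D"
  shows "\<not> N \<subseteq> gp_sub V E G (link v)"
proof
  assume Nv: "N \<subseteq> gp_sub V E G (link v)"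
  interpret N: normal N GP by (rule N)
  \<comment> \<open>No vertex of \<open>D\<close> outside \<open>A\<close> can fail to be adjacent
    to a vertex of \<open>A\<close>, so \<open>D\<close> would be the join of \<open>A\<close> and
    its complement unless \<open>A = D\<close>.\<close>
  define A where "A = {u \<in> D. N \<subseteq> gp_sub V E G (link u)}"
  have vA: "v \<in> A" using v Nv by (simp add: A_def)
  have "E a b" if a: "a \<in> A" and b: "b \<in> D - A" for a b
  proof (rule ccontr)
    assume nE: "\<not> E a b"
    have aV: "a \<in> V" and bV: "b \<in> V" and ab: "a \<noteq> b" using a b D(1) by (auto simp: A_def)
    have nE': "\<not> E b a" using nE graph aV bV by (auto simp: simplicial_graph_def)
    interpret Ga: group "G a" by (rule groups[OF aV])
    interpret Gb: group "G b" by (rule groups[OF bV])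
    obtain x where x: "x \<in> carrier (G a)" "x \<noteq> \<one>\<^bsub>G a\<^esub>" using nontriv[OF aV] Ga.one_closed by blast
    obtain y where y: "y \<in> carrier (G b)" "y \<noteq> \<one>\<^bsub>G b\<^esub>" using nontriv[OF bV] Gb.one_closed by blast
    interpret vb: graph_product_vertex V E G b by unfold_locales (rule bV)
    have "N \<subseteq> gp_sub V E G (link b)"
    proof (rule vb.subset_link_of_centralizing[OF N aV ab nE' x y])
      fix n assume "n \<in> N"
      then have "n \<in> gp_sub V E G (link a)" using a by (auto simp: A_def)
      then show "n \<otimes>\<^bsub>GP\<^esub> incl a x = incl a x \<otimes>\<^bsub>GP\<^esub> n" by (rule sub_link_commute[OF aV x(1)])
    qed
    then show False using b by (simp add: A_def)
  qed
  then have join: "\<forall>a\<in>A. \<forall>b\<in>D - A. E a b" by simp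
  have "D - A = {}"
  proof (rule ccontr)
    assume "D - A \<noteq> {}"
    moreover have "A \<noteq> {}" "A \<inter> (D - A) = {}" "A \<union> (D - A) = D" using vA by (auto simp: A_def)
    ultimately have "is_join E D" unfolding is_join_def using join by (intro exI[of _ A] exI[of _ "D - A"]) simp
    then show False using D(2) by simp
  qed
  then have all: "N \<subseteq> gp_sub V E G (link u)" if "u \<in> D" for u using that by (auto simp: A_def)
  have "\<one>\<^bsub>GP\<^esub> \<in> N \<inter> gp_sub V E G D" using subgroup.one_closed[OF sub_subgroup[OF D(1)]] by simp
  then obtain n where n: "n \<in> N" "n \<in> gp_sub V E G D" "n \<noteq> \<one>\<^bsub>GP\<^esub>" using D(3) by blast
  have "n = \<one>\<^bsub>GP\<^esub>" by (rule trivial_if_in_links[OF D(1) n(2)]) (rule subsetD[OF all n(1)])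
  then show False using n(3) by simp
qed

text \<open>All vertices other than a central one belong to its link, so letters of \<open>v\<close>
  can be moved to the right past everything else.\<close>

lemma central_decomposition:
  assumes v: "central_vertex V E v" and g: "g \<in> carrier GP"
  shows "\<exists>r\<in>gp_sub V E G (link v). \<exists>x\<in>carrier (G v). g = r \<otimes>\<^bsub>GP\<^esub> incl v x"
  using g
proof (induction rule: GP_induct)
  case one
  have vV: "v \<in> V" using v by (simp add: central_vertex_def)
  interpret Gv: group "G v" by (rule groups[OF vV])
  have "\<one>\<^bsub>GP\<^esub> \<in> gp_sub V E G (link v)" by (rule subgroup.one_closed[OF sub_subgroup[OF link_subset]])
  then show ?case
    by (intro bexI[of _ "\<one>\<^bsub>GP\<^esub>"] bexI[of _ "\<one>\<^bsub>G v\<^esub>"]) (simp_all add: incl_one vV)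
next
  case (mult u y g)
  have vV: "v \<in> V" using v by (simp add: central_vertex_def)
  interpret Gv: group "G v" by (rule groups[OF vV])
  obtain r x where rx: "r \<in> gp_sub V E G (link v)" "x \<in> carrier (G v)" "g = r \<otimes>\<^bsub>GP\<^esub> incl v x"
    using mult.IH by blast
  have cl: "r \<in> carrier GP" "incl v x \<in> carrier GP" "incl u y \<in> carrier GP"
    using subgroup.mem_carrier[OF sub_subgroup[OF link_subset] rx(1)] rx(2) vV mult by (simp_all add: incl_closed)
  show ?case
  proof (cases "u = v")
    case True
    have "incl u y \<otimes>\<^bsub>GP\<^esub> g = incl v y \<otimes>\<^bsub>GP\<^esub> r \<otimes>\<^bsub>GP\<^esub> incl v x" using True rx(3) cl by (simp add: GP.m_assoc)
    also have "incl v y \<otimes>\<^bsub>GP\<^esub> r = r \<otimes>\<^bsub>GP\<^esub> incl v y"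
      using sub_link_commute[OF vV _ rx(1), of y] mult(2) True by simp
    also have "r \<otimes>\<^bsub>GP\<^esub> incl v y \<otimes>\<^bsub>GP\<^esub> incl v x = r \<otimes>\<^bsub>GP\<^esub> incl v (y \<otimes>\<^bsub>G v\<^esub> x)"
      using True mult(2) rx(2) vV cl by (simp add: incl_mult GP.m_assoc)
    finally show ?thesis using rx mult(2) True
      by (intro bexI[of _ r] bexI[of _ "y \<otimes>\<^bsub>G v\<^esub> x"]) simp_all
  next
    case False
    have "u \<in> link v" using False v mult(1) by (simp add: link_def central_vertex_def)
    then have "incl u y \<otimes>\<^bsub>GP\<^esub> r \<in> gp_sub V E G (link v)"
      using rx(1) mult(2) by (intro subgroup.m_closed[OF sub_subgroup[OF link_subset]] incl_in_sub)
    moreover have "incl u y \<otimes>\<^bsub>GP\<^esub> g = incl u y \<otimes>\<^bsub>GP\<^esub> r \<otimes>\<^bsub>GP\<^esub> incl v x"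
      using rx(3) cl by (simp add: GP.m_assoc)
    ultimately show ?thesis using rx(2) by blast
  qed
qed

lemma incl_image_subgroup:
  assumes "v \<in> V"
  shows "subgroup (incl v ` carrier (G v)) GP"
proof -
  interpret group_hom "G v" GP "incl v"
    using assms incl_hom groups by (auto simp: group_hom_def group_hom_axioms_def group_GP)
  show ?thesis by (rule img_is_subgroup)
qed

text \<open>This is the subgroup of \<open>G v\<close> whose quotient the hypothesis on central
  vertices is applied to.\<close>

lemma preimage_normal:
  assumes "v \<in> V" "N \<lhd> GP"
  shows "{x \<in> carrier (G v). incl v x \<in> N} \<lhd> G v"
proof -
  interpret N: normal N GP by (rule assms(2))
  interpret Gv: group "G v" by (rule groups[OF assms(1)])
  have sub: "subgroup {x \<in> carrier (G v). incl v x \<in> N} (G v)"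
  proof (rule Gv.subgroupI)
    have "\<one>\<^bsub>G v\<^esub> \<in> {x \<in> carrier (G v). incl v x \<in> N}" using assms(1) by (simp add: incl_one)
    then show "{x \<in> carrier (G v). incl v x \<in> N} \<noteq> {}" by blast
  qed (use assms(1) in \<open>auto simp: incl_inv incl_mult\<close>)
  show ?thesis
    unfolding Gv.normal_inv_iff
    using sub assms(1) N.inv_op_closed2[OF incl_closed[OF assms(1)]]
    by (auto simp: incl_mult incl_inv)
qed

text \<open>The link subgroup commutes with the vertex group, and \<open>link_finite_index\<close>
  provides the decomposition modulo \<open>N\<close>. A vertex not adjacent to \<open>v\<close>
  supplies the second coset needed there.\<close>

lemma vertex_centralizer_noncentral:
  assumes nontriv: "\<And>v. v \<in> V \<Longrightarrow> carrier (G v) \<noteq> {\<one>\<^bsub>G v\<^esub>}"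
    and N: "N \<lhd> GP" and fg: "finitely_generated_subgroup GP N" and full: "full_subgroup V E G N"
    and v: "v \<in> V" "\<not> central_vertex V E v"
  shows "finite (rcosets\<^bsub>GP Mod N\<^esub>
    (group.centralizer (GP Mod N) ((\<lambda>s. N #>\<^bsub>GP\<^esub> s) ` (incl v ` carrier (G v)))))"
proof -
  obtain P where P: "join_decomposition V E P" "\<And>D. D \<in> P \<Longrightarrow> N \<inter> gp_sub V E G D \<noteq> {\<one>\<^bsub>GP\<^esub>}"
    using full by (auto simp: full_subgroup_def)
  obtain D where D: "D \<in> P" "v \<in> D" using P(1) v(1) by (auto simp: join_decomposition_def)
  have DV: "D \<subseteq> V" "\<not> is_join E D" using P(1) D(1) by (auto simp: join_decomposition_def)
  have notin: "\<not> N \<subseteq> gp_sub V E G (link v)"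
    by (rule full_not_in_link[OF nontriv N DV P(2)[OF D(1)] D(2)])
  obtain u where u: "u \<in> V" "u \<noteq> v" "\<not> E v u" using v by (auto simp: central_vertex_def)
  interpret Gu: group "G u" by (rule groups[OF u(1)])
  interpret vv: graph_product_vertex V E G v by unfold_locales (rule v(1))
  obtain x where x: "x \<in> carrier (G u)" "x \<noteq> \<one>\<^bsub>G u\<^esub>" using nontriv[OF u(1)] Gu.one_closed by blast
  obtain y where y: "y \<in> carrier (G v)" "y \<noteq> \<one>\<^bsub>G v\<^esub>" using nontriv[OF v(1)] vv.Gv.one_closed by blast
  from vv.link_finite_index[OF N fg notin y vv.nontrivial_coset[OF u x]]
  obtain F where F: "finite F \<and> F \<subseteq> carrier GP \<and>
    (\<forall>g\<in>carrier GP. \<exists>c\<in>gp_sub V E G (link v). \<exists>f\<in>F. \<exists>n\<in>N. g = c \<otimes>\<^bsub>GP\<^esub> f \<otimes>\<^bsub>GP\<^esub> n)"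
    by (rule exE)
  show ?thesis
  proof (rule GP.centralizer_Mod_finite_index[OF N, of F "gp_sub V E G (link v)"])
    show "gp_sub V E G (link v) \<subseteq> carrier GP" by (rule subgroup.subset[OF sub_subgroup[OF link_subset]])
    show "incl v ` carrier (G v) \<subseteq> carrier GP" using incl_closed[OF v(1)] by blast
    fix c s assume "c \<in> gp_sub V E G (link v)" "s \<in> incl v ` carrier (G v)"
    then have "c \<otimes>\<^bsub>GP\<^esub> s = s \<otimes>\<^bsub>GP\<^esub> c" using sub_link_commute[OF v(1)] by blast
    then show "N #>\<^bsub>GP\<^esub> (c \<otimes>\<^bsub>GP\<^esub> s) = N #>\<^bsub>GP\<^esub> (s \<otimes>\<^bsub>GP\<^esub> c)" by simp
  qed (use F in simp_all)
qed

text \<open>A central vertex is a join factor by itself, so fullness makes the preimage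
  \<open>M\<close> of \<open>N\<close> in \<open>G v\<close> nontrivial and \<open>G v Mod M\<close>
  a proper quotient. The finite index of its center is then carried over to the graph
  product.\<close>

lemma vertex_centralizer_central:
  assumes N: "N \<lhd> GP" and full: "full_subgroup V E G N" and v: "central_vertex V E v"
    and quot: "\<And>M. M \<lhd> G v \<Longrightarrow> M \<noteq> {\<one>\<^bsub>G v\<^esub>} \<Longrightarrow>
      abelian_by_finite (G v Mod M) \<and> finite_by_abelian (G v Mod M)"
  shows "finite (rcosets\<^bsub>GP Mod N\<^esub>
    (group.centralizer (GP Mod N) ((\<lambda>s. N #>\<^bsub>GP\<^esub> s) ` (incl v ` carrier (G v)))))"
proof -
  interpret N: normal N GP by (rule N)
  have vV: "v \<in> V" using v by (simp add: central_vertex_def)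
  interpret Gv: group "G v" by (rule groups[OF vV])
  obtain P where P: "join_decomposition V E P" "\<And>D. D \<in> P \<Longrightarrow> N \<inter> gp_sub V E G D \<noteq> {\<one>\<^bsub>GP\<^esub>}"
    using full by (auto simp: full_subgroup_def)
  obtain D where D: "D \<in> P" "v \<in> D" using P(1) vV by (auto simp: join_decomposition_def)
  have DV: "D \<subseteq> V" "\<not> is_join E D" using P(1) D(1) by (auto simp: join_decomposition_def)
  have "D = {v}"
  proof (rule ccontr)
    assume "D \<noteq> {v}"
    then have "D - {v} \<noteq> {}" using D(2) by blast
    moreover have "\<forall>a\<in>{v}. \<forall>b\<in>D - {v}. E a b" using v DV(1) by (auto simp: central_vertex_def)
    moreover have "{v} \<union> (D - {v}) = D" using D(2) by blast
    ultimately have "is_join E D" unfolding is_join_def by (intro exI[of _ "{v}"] exI[of _ "D - {v}"]) auto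
    then show False using DV(2) by blast
  qed
  then have ne: "N \<inter> gp_sub V E G {v} \<noteq> {\<one>\<^bsub>GP\<^esub>}" using P(2)[OF D(1)] by simp
  have "\<one>\<^bsub>GP\<^esub> \<in> N \<inter> gp_sub V E G {v}" using subgroup.one_closed[OF sub_subgroup[of "{v}"]] vV by simp
  then obtain n where n: "n \<in> N" "n \<in> gp_sub V E G {v}" "n \<noteq> \<one>\<^bsub>GP\<^esub>" using ne by blast
  have "gp_sub V E G {v} \<subseteq> incl v ` carrier (G v)"
    by (rule sub_minimal[OF incl_image_subgroup[OF vV]]) auto
  then obtain x0 where x0: "x0 \<in> carrier (G v)" "n = incl v x0" using n(2) by blast
  define M where "M = {x \<in> carrier (G v). incl v x \<in> N}"
  have M: "M \<lhd> G v" unfolding M_def by (rule preimage_normal[OF vV N])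
  have M_sub: "subgroup M (G v)" by (rule normal_imp_subgroup[OF M])
  have "x0 \<in> M" using x0 n(1) by (simp add: M_def)
  moreover have "x0 \<noteq> \<one>\<^bsub>G v\<^esub>" using x0(2) n(3) incl_one[OF vV] by metis
  ultimately have "M \<noteq> {\<one>\<^bsub>G v\<^esub>}" by blast
  then have "abelian_by_finite (G v Mod M)" "finite_by_abelian (G v Mod M)" using quot[OF M] by auto
  from Gv.central_Mod_decomposition[OF M this]
  obtain F where F: "finite F \<and> F \<subseteq> carrier (G v) \<and>
    (\<forall>x\<in>carrier (G v). \<exists>z\<in>carrier (G v). \<exists>f\<in>F. x = z \<otimes>\<^bsub>G v\<^esub> f \<and>
      (\<forall>y\<in>carrier (G v). M #>\<^bsub>G v\<^esub> (z \<otimes>\<^bsub>G v\<^esub> y) = M #>\<^bsub>G v\<^esub> (y \<otimes>\<^bsub>G v\<^esub> z)))"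
    by (rule exE)
  \<comment> \<open>The preimage in \<open>G v\<close> of the center of
    \<open>G v Mod M\<close>.\<close>
  define Z where "Z = {z \<in> carrier (G v). \<forall>y\<in>carrier (G v). M #>\<^bsub>G v\<^esub> (z \<otimes>\<^bsub>G v\<^esub> y) = M #>\<^bsub>G v\<^esub> (y \<otimes>\<^bsub>G v\<^esub> z)}"
  have ZF: "\<exists>z\<in>Z. \<exists>f\<in>F. x = z \<otimes>\<^bsub>G v\<^esub> f" if "x \<in> carrier (G v)" for x
    using F that unfolding Z_def by blast
  have Zc: "N #>\<^bsub>GP\<^esub> (incl v z \<otimes>\<^bsub>GP\<^esub> incl v y) = N #>\<^bsub>GP\<^esub> (incl v y \<otimes>\<^bsub>GP\<^esub> incl v z)"
    if z: "z \<in> Z" and y: "y \<in> carrier (G v)" for z y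
  proof -
    have zc: "z \<in> carrier (G v)" using z by (simp add: Z_def)
    have "z \<otimes>\<^bsub>G v\<^esub> y \<in> M #>\<^bsub>G v\<^esub> (z \<otimes>\<^bsub>G v\<^esub> y)"
      using Gv.rcos_self[OF _ M_sub] zc y by simp
    then have "z \<otimes>\<^bsub>G v\<^esub> y \<in> M #>\<^bsub>G v\<^esub> (y \<otimes>\<^bsub>G v\<^esub> z)" using z y by (simp add: Z_def)
    then obtain m where m: "m \<in> M" "z \<otimes>\<^bsub>G v\<^esub> y = m \<otimes>\<^bsub>G v\<^esub> (y \<otimes>\<^bsub>G v\<^esub> z)" by (auto simp: r_coset_def)
    have mc: "m \<in> carrier (G v)" "incl v m \<in> N" using m(1) by (simp_all add: M_def)
    have cl: "incl v m \<in> carrier GP" "incl v y \<otimes>\<^bsub>GP\<^esub> incl v z \<in> carrier GP"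
      using mc y zc vV by (simp_all add: incl_closed)
    have "incl v z \<otimes>\<^bsub>GP\<^esub> incl v y = incl v m \<otimes>\<^bsub>GP\<^esub> (incl v y \<otimes>\<^bsub>GP\<^esub> incl v z)"
      using arg_cong[OF m(2), of "incl v"] mc y zc vV by (simp add: incl_mult)
    then have "N #>\<^bsub>GP\<^esub> (incl v z \<otimes>\<^bsub>GP\<^esub> incl v y) = N #>\<^bsub>GP\<^esub> incl v m #>\<^bsub>GP\<^esub> (incl v y \<otimes>\<^bsub>GP\<^esub> incl v z)"
      using GP.coset_mult_assoc[OF N.subset cl] by simp
    also have "N #>\<^bsub>GP\<^esub> incl v m = N" using mc(2) by (simp add: N.rcos_const[OF group_GP])
    finally show ?thesis .
  qed
  \<comment> \<open>Products of elements that commute with the vertex group exactly, from the link,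
    and modulo \<open>N\<close>, from \<open>Z\<close>. Together with the finite set from
    \<open>F\<close> they exhaust the graph product.\<close>
  define K where "K = {r \<otimes>\<^bsub>GP\<^esub> incl v z | r z. r \<in> gp_sub V E G (link v) \<and> z \<in> Z}"
  have linkc: "r \<in> carrier GP" if "r \<in> gp_sub V E G (link v)" for r
    by (rule subgroup.mem_carrier[OF sub_subgroup[OF link_subset] that])
  have Zcl: "incl v z \<in> carrier GP" if "z \<in> Z" for z using that vV by (simp add: Z_def incl_closed)
  show ?thesis
  proof (rule GP.centralizer_Mod_finite_index[OF N, of "incl v ` F" K])
    show "finite (incl v ` F)" using F by simp
    show "incl v ` F \<subseteq> carrier GP" using F incl_closed[OF vV] by blast
    show "K \<subseteq> carrier GP" using linkc Zcl by (auto simp: K_def)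
    show "incl v ` carrier (G v) \<subseteq> carrier GP" using incl_closed[OF vV] by blast
  next
    fix g assume "g \<in> carrier GP"
    then obtain r x where rx: "r \<in> gp_sub V E G (link v)" "x \<in> carrier (G v)" "g = r \<otimes>\<^bsub>GP\<^esub> incl v x"
      using central_decomposition[OF v] by blast
    obtain z f where zf: "z \<in> Z" "f \<in> F" "x = z \<otimes>\<^bsub>G v\<^esub> f" using ZF[OF rx(2)] by blast
    have fc: "f \<in> carrier (G v)" "z \<in> carrier (G v)" using zf F by (auto simp: Z_def)
    have "g = r \<otimes>\<^bsub>GP\<^esub> incl v z \<otimes>\<^bsub>GP\<^esub> incl v f \<otimes>\<^bsub>GP\<^esub> \<one>\<^bsub>GP\<^esub>"
      using rx zf(3) fc vV linkc by (simp add: incl_mult incl_closed GP.m_assoc)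
    moreover have "r \<otimes>\<^bsub>GP\<^esub> incl v z \<in> K" using rx(1) zf(1) unfolding K_def by blast
    ultimately show "\<exists>c\<in>K. \<exists>f\<in>incl v ` F. \<exists>n\<in>N. g = c \<otimes>\<^bsub>GP\<^esub> f \<otimes>\<^bsub>GP\<^esub> n"
      using zf(2) N.one_closed by blast
  next
    fix c s assume "c \<in> K" "s \<in> incl v ` carrier (G v)"
    then obtain r z y where rz: "r \<in> gp_sub V E G (link v)" "z \<in> Z" "c = r \<otimes>\<^bsub>GP\<^esub> incl v z"
      and y: "y \<in> carrier (G v)" "s = incl v y" by (auto simp: K_def)
    have cl: "r \<in> carrier GP" "incl v z \<in> carrier GP" "incl v y \<in> carrier GP"
      using linkc[OF rz(1)] Zcl[OF rz(2)] incl_closed[OF vV y(1)] by auto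
    have Nr: "N #>\<^bsub>GP\<^esub> (r \<otimes>\<^bsub>GP\<^esub> t) = (N #>\<^bsub>GP\<^esub> r) <#>\<^bsub>GP\<^esub> (N #>\<^bsub>GP\<^esub> t)" if "t \<in> carrier GP" for t
      using N.rcos_sum cl(1) that by simp
    have "N #>\<^bsub>GP\<^esub> (c \<otimes>\<^bsub>GP\<^esub> s) = N #>\<^bsub>GP\<^esub> (r \<otimes>\<^bsub>GP\<^esub> (incl v z \<otimes>\<^bsub>GP\<^esub> incl v y))"
      using rz(3) y(2) cl by (simp add: GP.m_assoc)
    also have "\<dots> = N #>\<^bsub>GP\<^esub> (r \<otimes>\<^bsub>GP\<^esub> (incl v y \<otimes>\<^bsub>GP\<^esub> incl v z))"
      using Nr cl Zc[OF rz(2) y(1)] by simp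
    also have "r \<otimes>\<^bsub>GP\<^esub> (incl v y \<otimes>\<^bsub>GP\<^esub> incl v z) = r \<otimes>\<^bsub>GP\<^esub> incl v y \<otimes>\<^bsub>GP\<^esub> incl v z"
      using cl by (simp add: GP.m_assoc)
    also have "r \<otimes>\<^bsub>GP\<^esub> incl v y = incl v y \<otimes>\<^bsub>GP\<^esub> r" by (rule sub_link_commute[OF vV y(1) rz(1)])
    also have "incl v y \<otimes>\<^bsub>GP\<^esub> r \<otimes>\<^bsub>GP\<^esub> incl v z = s \<otimes>\<^bsub>GP\<^esub> c" using rz(3) y(2) cl by (simp add: GP.m_assoc)
    finally show "N #>\<^bsub>GP\<^esub> (c \<otimes>\<^bsub>GP\<^esub> s) = N #>\<^bsub>GP\<^esub> (s \<otimes>\<^bsub>GP\<^esub> c)" .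
  qed
qed

end

theorem theorem2p5:
  fixes V :: "'v set" and E :: "'v \<Rightarrow> 'v \<Rightarrow> bool" and G :: "'v \<Rightarrow> 'g monoid"
    and N :: "('v \<times> 'g) list set set"
  assumes graph: "simplicial_graph V E"
    and groups: "\<And>v. v \<in> V \<Longrightarrow> group (G v)"
    and nontriv: "\<And>v. v \<in> V \<Longrightarrow> carrier (G v) \<noteq> {\<one>\<^bsub>G v\<^esub>}"
    and normal: "N \<lhd> graph_product V E G"
    and fg: "finitely_generated_subgroup (graph_product V E G) N"
    and full: "full_subgroup V E G N"
    and central: "\<And>v M. central_vertex V E v \<Longrightarrow> M \<lhd> G v \<Longrightarrow> M \<noteq> {\<one>\<^bsub>G v\<^esub>} \<Longrightarrow>
                    abelian_by_finite (G v Mod M) \<and> finite_by_abelian (G v Mod M)"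
  shows "finite_by_abelian (graph_product V E G Mod N) \<and>
         abelian_by_finite (graph_product V E G Mod N)"
proof -
  interpret graph_product_groups V E G by (rule graph_product_groups.intro) (fact graph, fact groups)
  interpret N: normal N GP by (rule normal)
  interpret Q: group "GP Mod N" by (rule N.factorgroup_is_group)
  interpret \<pi>: group_hom GP "GP Mod N" "\<lambda>s. N #>\<^bsub>GP\<^esub> s"
    using N.r_coset_hom_Mod by (simp add: group_hom_def group_hom_axioms_def group_GP Q.is_group)
  have sub: "(\<lambda>s. N #>\<^bsub>GP\<^esub> s) ` (incl v ` carrier (G v)) \<subseteq> carrier (GP Mod N)" if "v \<in> V" for v
    using incl_closed[OF that] \<pi>.hom_closed by blast
  have gen: "generate (GP Mod N) (\<Union>v\<in>V. (\<lambda>s. N #>\<^bsub>GP\<^esub> s) ` (incl v ` carrier (G v))) = carrier (GP Mod N)"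
  proof -
    have "(\<Union>v\<in>V. (\<lambda>s. N #>\<^bsub>GP\<^esub> s) ` (incl v ` carrier (G v))) =
        (\<lambda>s. N #>\<^bsub>GP\<^esub> s) ` (\<Union>v\<in>V. incl v ` carrier (G v))" by blast
    also have "generate (GP Mod N) \<dots> = (\<lambda>s. N #>\<^bsub>GP\<^esub> s) ` carrier GP"
      using \<pi>.generate_img[OF sub_generators_closed[OF order.refl]] sub_V by (simp add: gp_sub_def)
    also have "\<dots> = carrier (GP Mod N)" by (auto simp: FactGroup_def RCOSETS_def)
    finally show ?thesis .
  qed
  have fin: "finite (rcosets\<^bsub>GP Mod N\<^esub> (Q.centralizer ((\<lambda>s. N #>\<^bsub>GP\<^esub> s) ` (incl v ` carrier (G v)))))"
    if v: "v \<in> V" for v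
  proof (cases "central_vertex V E v")
    case True
    show ?thesis by (rule vertex_centralizer_central[OF normal full True central[OF True]])
  next
    case False
    show ?thesis by (rule vertex_centralizer_noncentral[OF nontriv normal fg full v False])
  qed
  have "finite V" using graph by (simp add: simplicial_graph_def)
  then have "finite (rcosets\<^bsub>GP Mod N\<^esub> (Q.centralizer (carrier (GP Mod N))))"
    by (rule Q.finite_rcosets_center[OF _ sub fin gen])
  then show ?thesis
    by (intro conjI Q.finite_by_abelian_if_center Q.abelian_by_finite_if_center)
qed

end
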